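(* Let $m\ge1$ and $1<p<\infty$. The twisted dyadic square functions $S_d^{(2)}$ and $S_d^{(3)}$ are bounded operators on $L^p(\mathbb R^{2m})$. Furthermore, for all $f\in L^p(\mathbb R^{2m})$, $$\big\|S_d^{(i)}(f)\big\|_{L^p(\mathbb R^{2m})}\simeq\|f\|_{L^p(\mathbb R^{2m})},\qquad i\in\{1,2,3\},$$ where the implicit constants depend only on $p$ and $m$.
   Context: $\mathscr{D}$ is the collection of standard (half-open) dyadic cubes in $\mathbb{R}^m$. For $I=I_1\times\cdots\times I_m\in\mathscr{D}$, $\{h_I^\epsilon\}_{\epsilon\in\mathcal{E}}$, $\mathcal{E}=\{1,\dots,2^m-1\}$, is the standard $L^2$-normalized Haar basis supported on $I$: the functions $\bigotimes_{i=1}^m h_{I_i}^{a_i}$, $a\in\{0,1\}^m\setminus\{0\}$, with $h_{K}^0=|K|^{-1/2}\chi_K$ and $h_K^1=|K|^{-1/2}(\chi_{K_{\rm left}}-\chi_{K_{\rm right}})$ for a dyadic interval $K$. On $\mathbb R^{2m}=\mathbb R^m\times\mathbb R^m$ put $T_2(x_1,x_2)=(x_1-x_2,x_2)$, $T_3(x_1,x_2)=(x_1,x_2-x_1)$, $I\times_t J=T_2^{-1}(I\times J)$, $I\,{}_t\!\times J=T_3^{-1}(I\times J)$, $h_{I\times J}^{\vec\epsilon}(x_1,x_2)=h_I^{\epsilon_1}(x_1)h_J^{\epsilon_2}(x_2)$ for $\vec\epsilon=(\epsilon_1,\epsilon_2)\in\mathcal E\times\mathcal E$, $h_{I\times_t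 J}^{\vec\epsilon}=h_{I\times J}^{\vec\epsilon}\circ T_2$, $h_{I\,{}_t\!\times J}^{\vec\epsilon}=h_{I\times J}^{\vec\epsilon}\circ T_3$. Let $\mathscr R^{(1)}=\{I\times J\}$, $\mathscr R^{(2)}=\{I\times_t J\}$, $\mathscr R^{(3)}=\{I\,{}_t\!\times J\}$ with $I,J\in\mathscr D$. For $i\in\{1,2,3\}$ the dyadic square function is $$S_d^{(i)}(f)(\mathbf x)=\Big(\sum_{R\in\mathscr R^{(i)}}\sum_{\vec\epsilon\in\mathcal E\times\mathcal E}\big|\langle f,h_R^{\vec\epsilon}\rangle h_R^{\vec\epsilon}(\mathbf x)\big|^2\Big)^{1/2}.$$ $A\simeq B$ means $c\,B\le A\le C\,B$ for constants $0<c\le C<\infty$. *)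

theory Defs
  imports "HOL-Analysis.Analysis"
begin

definition dyadic_intervals_of_level :: "int \<Rightarrow> real set set" where
  "dyadic_intervals_of_level k =
     {{of_int n * 2 powi k ..< (of_int n + 1) * 2 powi k} | n :: int. True}"

definition dyadic_cubes :: "(real ^ 'm::finite) set set" where
  "dyadic_cubes =
     {{x. \<forall>i. x $ i \<in> K i} | K. \<exists>k. \<forall>i. K i \<in> dyadic_intervals_of_level k}"

text \<open>The one-dimensional functions \<open>h\<^sup>0\<close> (for \<^const>\<open>False\<close>) and \<open>h\<^sup>1\<close> (for \<^const>\<open>True\<close>) of an
  interval, which is cut into its left and right halves at its midpoint.\<close>

definition left_half :: "real set \<Rightarrow> real set" where
  "left_half K = {t \<in> K. t < (Inf K + Sup K) / 2}"

definition right_half :: "real set \<Rightarrow> real set" where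
  "right_half K = {t \<in> K. (Inf K + Sup K) / 2 \<le> t}"

definition haar1 :: "bool \<Rightarrow> real set \<Rightarrow> real \<Rightarrow> real" where
  "haar1 b K t =
     (if b then indicator (left_half K) t - indicator (right_half K) t else indicator K t)
       / sqrt (measure lborel K)"

text \<open>The index set \<open>\<E>\<close> is taken to be the nonzero elements of \<open>{0,1}\<^sup>m\<close>
  themselves instead of the numbers \<open>1, \<dots>, 2\<^sup>m - 1\<close> enumerating them.\<close>

definition haar_indices :: "('m::finite \<Rightarrow> bool) set" where
  "haar_indices = UNIV - {\<lambda>_. False}"

text \<open>The sides of a cube \<open>I\<close> are recovered as its coordinate projections.\<close>

definition haar :: "('m \<Rightarrow> bool) \<Rightarrow> (real ^ 'm::finite) set \<Rightarrow> real ^ 'm \<Rightarrow> real" where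
  "haar a I x = (\<Prod>i\<in>UNIV. haar1 (a i) ((\<lambda>y. y $ i) ` I) (x $ i))"

definition T2 :: "(real ^ 'm) \<times> (real ^ 'm) \<Rightarrow> (real ^ 'm) \<times> (real ^ 'm)" where
  "T2 = (\<lambda>(x1, x2). (x1 - x2, x2))"

definition T3 :: "(real ^ 'm) \<times> (real ^ 'm) \<Rightarrow> (real ^ 'm) \<times> (real ^ 'm)" where
  "T3 = (\<lambda>(x1, x2). (x1, x2 - x1))"

text \<open>The three geometries are treated uniformly through a bijective change of variables \<open>T\<close>:
  \<open>T = id\<close> gives \<open>\<R>\<^sup>(\<^sup>1\<^sup>)\<close>, \<open>T = T2\<close> gives \<open>\<R>\<^sup>(\<^sup>2\<^sup>)\<close> and \<open>T = T3\<close> gives \<open>\<R>\<^sup>(\<^sup>3\<^sup>)\<close>.\<close>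

definition dyadic_rects ::
  "((real ^ 'm) \<times> (real ^ 'm) \<Rightarrow> (real ^ 'm) \<times> (real ^ 'm)) \<Rightarrow>
   ((real ^ 'm::finite) \<times> (real ^ 'm)) set set" where
  "dyadic_rects T = {T -` (I \<times> J) | I J. I \<in> dyadic_cubes \<and> J \<in> dyadic_cubes}"

definition haar_prod ::
  "('m \<Rightarrow> bool) \<times> ('m \<Rightarrow> bool) \<Rightarrow> ((real ^ 'm::finite) \<times> (real ^ 'm)) set \<Rightarrow>
   (real ^ 'm) \<times> (real ^ 'm) \<Rightarrow> real" where
  "haar_prod = (\<lambda>(e1, e2) Q (x1, x2). haar e1 (fst ` Q) x1 * haar e2 (snd ` Q) x2)"

text \<open>For \<open>R = T -` (I \<times> J)\<close> one has \<open>T ` R = I \<times> J\<close>.\<close>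

definition haar_rect ::
  "((real ^ 'm) \<times> (real ^ 'm) \<Rightarrow> (real ^ 'm) \<times> (real ^ 'm)) \<Rightarrow>
   ('m \<Rightarrow> bool) \<times> ('m \<Rightarrow> bool) \<Rightarrow> ((real ^ 'm::finite) \<times> (real ^ 'm)) set \<Rightarrow>
   (real ^ 'm) \<times> (real ^ 'm) \<Rightarrow> real" where
  "haar_rect T e R = haar_prod e (T ` R) \<circ> T"

text \<open>The pairing needs no conjugation because the Haar functions are real-valued.\<close>

definition pairing :: "('a::euclidean_space \<Rightarrow> complex) \<Rightarrow> ('a \<Rightarrow> real) \<Rightarrow> complex" where
  "pairing f h = (LINT x|lebesgue. f x * complex_of_real (h x))"

text \<open>Powers of extended nonnegative reals with an exponent \<open>s > 0\<close>. Working in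
  \<^typ>\<open>ennreal\<close> gives the square function the value \<open>\<infinity>\<close> wherever the defining series diverges.\<close>

definition ennpowr :: "ennreal \<Rightarrow> real \<Rightarrow> ennreal" where
  "ennpowr a s = (if a = \<infinity> then \<infinity> else ennreal (enn2real a powr s))"

definition square_fun ::
  "((real ^ 'm) \<times> (real ^ 'm) \<Rightarrow> (real ^ 'm) \<times> (real ^ 'm)) \<Rightarrow>
   ((real ^ 'm::finite) \<times> (real ^ 'm) \<Rightarrow> complex) \<Rightarrow> (real ^ 'm) \<times> (real ^ 'm) \<Rightarrow> ennreal" where
  "square_fun T f x =
     ennpowr
       (\<Sum>\<^sub>\<infinity>R\<in>dyadic_rects T. \<Sum>e\<in>haar_indices \<times> haar_indices.
          ennreal ((cmod (pairing f (haar_rect T e R) * complex_of_real (haar_rect T e R x)))\<^sup>2))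
       (1 / 2)"

definition Lp_norm :: "real \<Rightarrow> ('a::euclidean_space \<Rightarrow> ennreal) \<Rightarrow> ennreal" where
  "Lp_norm p g = ennpowr (\<integral>\<^sup>+ x. ennpowr (g x) p \<partial>lebesgue) (1 / p)"

abbreviation Lp_norm_complex :: "real \<Rightarrow> ('a::euclidean_space \<Rightarrow> complex) \<Rightarrow> ennreal" where
  "Lp_norm_complex p f \<equiv> Lp_norm p (\<lambda>x. ennreal (cmod (f x)))"

definition Lp :: "real \<Rightarrow> ('a::euclidean_space \<Rightarrow> complex) set" where
  "Lp p = {f \<in> borel_measurable lebesgue. Lp_norm_complex p f < \<infinity>}"

text \<open>Boundedness on \<open>L\<^sup>p\<close> of an operator \<open>S\<close> with nonnegative values; since \<open>C\<close> is a real
  number, the estimate makes the \<open>L\<^sup>p\<close> norm of \<open>S f\<close> finite.\<close>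

definition bounded_on_Lp ::
  "real \<Rightarrow> (('a::euclidean_space \<Rightarrow> complex) \<Rightarrow> 'a \<Rightarrow> ennreal) \<Rightarrow> bool" where
  "bounded_on_Lp p S \<longleftrightarrow>
     (\<exists>C::real. \<forall>f\<in>Lp p. S f \<in> borel_measurable lebesgue \<and>
        Lp_norm p (S f) \<le> ennreal C * Lp_norm_complex p f)"

end

theory Submission
  imports Defs
begin

text \<open>
  The shears \<^const>\<open>T2\<close> and \<^const>\<open>T3\<close> preserve Lebesgue measure, so that each of the three square
  functions of \<open>f\<close> is the product square function of \<open>f \<circ> T\<^sup>-\<^sup>1\<close> composed with \<open>T\<close>, and all norms
  are those of the case \<open>T = id\<close> (\<open>square_fun_eq_SUP\<close>, \<open>measure_iso_T2\<close>, \<open>measure_iso_T3\<close>).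

  In the case \<open>T = id\<close>, keep only the cubes with levels in \<open>(-N, N]\<close>. The Haar functions of one cube
  reproduce the difference \<open>E\<^sub>k\<^sub>-\<^sub>1 - E\<^sub>k\<close> of two dyadic averaging operators (\<open>haar_kernel\<close>). Hence the
  truncated Haar expansion of \<open>f\<close> is \<open>(E\<^sub>-\<^sub>N - E\<^sub>N) \<otimes> (E\<^sub>-\<^sub>N - E\<^sub>N) f\<close>: its \<open>L\<^sup>p\<close> norm is at most a
  multiple of that of \<open>f\<close> by Jensen's inequality, and it converges to \<open>f\<close> in \<open>L\<^sup>p\<close>
  (\<open>approximable_Lp\<close>; here \<open>1 < p\<close> makes the averages over huge cubes disappear). The truncated
  square functions increase to the full one. So it suffices to compare the truncation of \<open>f\<close> with its
  square function, with constants independent of \<open>N\<close> (\<open>truncation_square_equiv\<close>). On a product of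
  two cubes of level \<open>N\<close> all functions involved are constant on the products of cubes of level \<open>-N\<close>,
  and the comparison becomes one of finite sums over two \<open>2\<^sup>m\<close>-ary trees.

  For these sums the two-parameter estimate (\<open>haar_sum2_square_equiv\<close>) is the one-parameter estimate
  for Hilbert space valued Haar sums (\<open>haar_sum_square_equiv\<close>), applied once in each variable: first
  with values in the complex numbers, then with values in the space \<open>\<ell>\<^sup>2\<close> over the Haar functions of
  the first variable.

  The one-parameter estimate follows from Burkholder's method. Suppose that two vectors \<open>x\<close> and \<open>y\<close>
  change from a cube to its children by increments with mean zero, and that the increment of \<open>y\<close> is
  smaller than a fixed multiple of that of \<open>x\<close>. One looks for a function \<open>U\<close> of \<open>X = |x|\<^sup>2\<close> and
  \<open>Y = |y|\<^sup>2\<close> whose average over the children is at most its value at the parent, and which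
  majorizes \<open>Y\<^bsup>p/2\<^esup> - K X\<^bsup>p/2\<^esup>\<close>; summation over the tree then bounds \<open>y\<close> by \<open>x\<close> in \<open>L\<^sup>p\<close>. Multiples
  of \<open>(X + Y)\<^bsup>p/2\<^esup> - C X\<^bsup>p/2\<^esup>\<close> for \<open>p \<le> 2\<close> and of \<open>2 Y\<^bsup>p/2\<^esup> - (X + Y)\<^bsup>p/2\<^esup>\<close> for \<open>p \<ge> 2\<close> have
  these properties, because they are concave along the relevant segments. To bound a Haar sum by its
  square function, \<open>x\<close> is the vector of all terms of the sum and \<open>y\<close> is the sum. To bound the square
  function, \<open>x\<close> is the sum and \<open>y\<close> is the vector of the terms with one fixed Haar index; as the term
  of one index may be larger than the whole increment of the sum at some children, the step from a
  cube to its children is cut in two, and the fixed index is taken first (\<open>haar_step_upper\<close>).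
\<close>

section \<open>A Bellman function for quadratic increments\<close>

text \<open>The second derivative of \<open>t \<mapsto> (a + 2 b t + c t\<^sup>2)\<^sup>q\<close>, in terms of the value \<open>A\<close> of the quadratic
  and of half its derivative, \<open>u = b + c t\<close>.\<close>

definition quad_powr_deriv2 :: "real \<Rightarrow> real \<Rightarrow> real \<Rightarrow> real \<Rightarrow> real" where
  "quad_powr_deriv2 q A u c = 2 * q * A powr (q - 1) * (c + 2 * (q - 1) * (u\<^sup>2 / A))"

lemma quad_powr_has_derivs:
  fixes a b c q t :: real
  assumes "0 < a + 2 * b * t + c * t\<^sup>2"
  shows "((\<lambda>t. (a + 2 * b * t + c * t\<^sup>2) powr q) has_real_derivative
            2 * q * (a + 2 * b * t + c * t\<^sup>2) powr (q - 1) * (b + c * t)) (at t)"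
    and "((\<lambda>t. 2 * q * (a + 2 * b * t + c * t\<^sup>2) powr (q - 1) * (b + c * t)) has_real_derivative
            quad_powr_deriv2 q (a + 2 * b * t + c * t\<^sup>2) (b + c * t) c) (at t)"
proof -
  define A where "A = a + 2 * b * t + c * t\<^sup>2"
  have A: "A > 0" using assms by (simp add: A_def)
  have 1: "((\<lambda>t. (a + 2 * b * t + c * t\<^sup>2) powr r) has_real_derivative
            2 * r * A powr (r - 1) * (b + c * t)) (at t)" for r
    using assms unfolding A_def
    by (auto intro!: derivative_eq_intros simp: algebra_simps powr_diff)
  show "((\<lambda>t. (a + 2 * b * t + c * t\<^sup>2) powr q) has_real_derivative
            2 * q * (a + 2 * b * t + c * t\<^sup>2) powr (q - 1) * (b + c * t)) (at t)"
    using 1[of q] by (simp add: A_def)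
  have e: "A powr (q - 1 - 1) = A powr (q - 1) / A" using A by (simp add: powr_diff power2_eq_square)
  show "((\<lambda>t. 2 * q * (a + 2 * b * t + c * t\<^sup>2) powr (q - 1) * (b + c * t)) has_real_derivative
            quad_powr_deriv2 q (a + 2 * b * t + c * t\<^sup>2) (b + c * t) c) (at t)"
  proof -
    have lin: "((\<lambda>t. b + c * t) has_real_derivative c) (at t)"
      by (auto intro!: derivative_eq_intros)
    have "((\<lambda>t. 2 * q * (a + 2 * b * t + c * t\<^sup>2) powr (q - 1) * (b + c * t)) has_real_derivative
        2 * q * (2 * (q - 1) * A powr (q - 1 - 1) * (b + c * t)) * (b + c * t)
        + c * (2 * q * A powr (q - 1))) (at t)"
      using DERIV_mult[OF DERIV_cmult[OF 1[of "q - 1"], of "2 * q"] lin] by (simp add: A_def)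
    also have "2 * q * (2 * (q - 1) * A powr (q - 1 - 1) * (b + c * t)) * (b + c * t)
        + c * (2 * q * A powr (q - 1)) = quad_powr_deriv2 q A (b + c * t) c"
      unfolding e quad_powr_deriv2_def using A by (simp add: field_simps power2_eq_square)
    finally show ?thesis by (simp add: A_def)
  qed
qed

text \<open>For a squared norm \<open>A = |x + t h|\<^sup>2\<close> one has \<open>u = \<langle>x + t h, h\<rangle>\<close> and \<open>c = |h|\<^sup>2\<close>, and the hypothesis
  on \<open>u\<close> is the Cauchy--Schwarz inequality. It confines \<open>c + 2 (q - 1) u\<^sup>2 / A\<close> between \<open>c\<close> and
  \<open>(2 q - 1) c\<close>.\<close>

lemma quad_powr_deriv2_bounds:
  assumes "0 < A" "0 < q" "u\<^sup>2 \<le> c * A" "0 \<le> c"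
  shows "q \<le> 1 \<Longrightarrow> quad_powr_deriv2 q A u c \<le> 2 * q * A powr (q - 1) * c"
    and "q \<le> 1 \<Longrightarrow> 2 * q * A powr (q - 1) * ((2 * q - 1) * c) \<le> quad_powr_deriv2 q A u c"
    and "1 \<le> q \<Longrightarrow> 2 * q * A powr (q - 1) * c \<le> quad_powr_deriv2 q A u c"
    and "1 \<le> q \<Longrightarrow> quad_powr_deriv2 q A u c \<le> 2 * q * A powr (q - 1) * ((2 * q - 1) * c)"
proof -
  have r: "0 \<le> u\<^sup>2 / A" "u\<^sup>2 / A \<le> c" using assms by (auto simp: field_simps)
  have f: "0 \<le> 2 * q * A powr (q - 1)" using assms by simp
  have m: "x \<le> y \<Longrightarrow> 2 * q * A powr (q - 1) * x \<le> 2 * q * A powr (q - 1) * y" for x y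
    using f by (rule mult_left_mono[rotated])
  { assume "q \<le> 1"
    then have "2 * (q - 1) \<le> 0" by simp
    then have "2 * (q - 1) * (u\<^sup>2 / A) \<le> 0" "2 * (q - 1) * c \<le> 2 * (q - 1) * (u\<^sup>2 / A)"
      by (rule mult_nonpos_nonneg[OF _ r(1)], rule mult_left_mono_neg[OF r(2)])
    moreover have "(2 * q - 1) * c = c + 2 * (q - 1) * c" by (simp add: algebra_simps)
    ultimately have "c + 2 * (q - 1) * (u\<^sup>2 / A) \<le> c" "(2 * q - 1) * c \<le> c + 2 * (q - 1) * (u\<^sup>2 / A)"
      by linarith+
    from m[OF this(1)] m[OF this(2)]
    show "quad_powr_deriv2 q A u c \<le> 2 * q * A powr (q - 1) * c"
         "2 * q * A powr (q - 1) * ((2 * q - 1) * c) \<le> quad_powr_deriv2 q A u c"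
      unfolding quad_powr_deriv2_def by - assumption+ }
  { assume "1 \<le> q"
    then have "0 \<le> 2 * (q - 1)" by simp
    then have "0 \<le> 2 * (q - 1) * (u\<^sup>2 / A)" "2 * (q - 1) * (u\<^sup>2 / A) \<le> 2 * (q - 1) * c"
      by (rule mult_nonneg_nonneg[OF _ r(1)], rule mult_left_mono[OF r(2)])
    moreover have "(2 * q - 1) * c = c + 2 * (q - 1) * c" by (simp add: algebra_simps)
    ultimately have "c \<le> c + 2 * (q - 1) * (u\<^sup>2 / A)" "c + 2 * (q - 1) * (u\<^sup>2 / A) \<le> (2 * q - 1) * c"
      by linarith+
    from m[OF this(1)] m[OF this(2)]
    show "2 * q * A powr (q - 1) * c \<le> quad_powr_deriv2 q A u c"
         "quad_powr_deriv2 q A u c \<le> 2 * q * A powr (q - 1) * ((2 * q - 1) * c)"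
      unfolding quad_powr_deriv2_def by - assumption+ }
qed

lemma quad_discriminant:
  fixes a b c t :: real
  assumes "b\<^sup>2 \<le> a * c"
  shows "(b + c * t)\<^sup>2 \<le> c * (a + 2 * b * t + c * t\<^sup>2)"
  using assms by (simp add: power2_eq_square algebra_simps)

lemma quad_pos:
  fixes a b c t :: real
  assumes "b\<^sup>2 \<le> X * c" "0 \<le> c" "0 \<le> X" "X < a"
  shows "0 < a + 2 * b * t + c * t\<^sup>2"
proof -
  have "0 \<le> X + 2 * b * t + c * t\<^sup>2"
  proof (cases "c = 0")
    case False
    then have c: "c > 0" using assms by simp
    have "(b + c * t)\<^sup>2 \<le> c * (X + 2 * b * t + c * t\<^sup>2)"
      using quad_discriminant[OF assms(1)] .
    then have "0 \<le> c * (X + 2 * b * t + c * t\<^sup>2)"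
      by (meson order_trans zero_le_power2)
    then show ?thesis using c by (simp add: zero_le_mult_iff)
  qed (use assms in auto)
  then show ?thesis using assms by simp
qed

text \<open>The Cauchy--Schwarz inequality in a product of two Hilbert spaces.\<close>

lemma quad_discriminant_add:
  fixes b b' c c' X Y :: real
  assumes b: "b\<^sup>2 \<le> X * c" and b': "b'\<^sup>2 \<le> Y * c'"
    and X: "0 \<le> X" and Y: "0 \<le> Y" and c: "0 \<le> c" and c': "0 \<le> c'"
  shows "(b + b')\<^sup>2 \<le> (X + Y) * (c + c')"
proof -
  have "(b * b')\<^sup>2 \<le> (X * c) * (Y * c')"
    unfolding power_mult_distrib using b b' by (intro mult_mono) (auto intro: mult_nonneg_nonneg X Y c c')
  then have "(2 * (b * b'))\<^sup>2 \<le> 4 * ((X * c) * (Y * c'))"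
    by (simp add: power_mult_distrib)
  also have "\<dots> \<le> (X * c' + Y * c)\<^sup>2"
    using sum_squares_ge_zero[of "X * c' - Y * c" 0] by (simp add: power2_eq_square algebra_simps)
  finally have "2 * (b * b') \<le> X * c' + Y * c"
    by (rule power2_le_imp_le) (intro add_nonneg_nonneg mult_nonneg_nonneg X Y c c')
  then show ?thesis using b b' by (simp add: power2_eq_square algebra_simps)
qed

text \<open>Here \<open>X\<close>, \<open>b\<close>, \<open>c\<close> stand for \<open>|x|\<^sup>2\<close>, \<open>\<langle>x, h\<rangle>\<close>, \<open>|h|\<^sup>2\<close>, and \<open>Y\<close>, \<open>b'\<close>, \<open>c'\<close> for \<open>|y|\<^sup>2\<close>, \<open>\<langle>y, k\<rangle>\<close>,
  \<open>|k|\<^sup>2\<close>. The two quadratics are the regularized squared norms of \<open>x + t h\<close> and of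
  \<open>(x + t h, y + t k)\<close>.\<close>

lemma quad_pair:
  fixes b b' c c' X Y \<epsilon> t :: real
  assumes b: "b\<^sup>2 \<le> X * c" and b': "b'\<^sup>2 \<le> Y * c'" and X: "0 \<le> X" and Y: "0 \<le> Y"
    and c: "0 \<le> c" and c': "0 \<le> c'" and eps: "0 < \<epsilon>"
  shows "0 < \<epsilon> + X + 2 * b * t + c * t\<^sup>2"
    and "\<epsilon> + X + 2 * b * t + c * t\<^sup>2 \<le> \<epsilon> + X + Y + 2 * (b + b') * t + (c + c') * t\<^sup>2"
    and "b\<^sup>2 \<le> (\<epsilon> + X) * c"
    and "(b + b')\<^sup>2 \<le> (\<epsilon> + X + Y) * (c + c')"
proof -
  show "0 < \<epsilon> + X + 2 * b * t + c * t\<^sup>2"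
    using b c X eps by (intro quad_pos[of _ X]) auto
  have "0 \<le> Y + 2 * b' * t + c' * t\<^sup>2"
  proof (rule field_le_epsilon)
    fix \<delta> :: real assume "\<delta> > 0"
    then show "0 \<le> Y + 2 * b' * t + c' * t\<^sup>2 + \<delta>"
      using quad_pos[OF b' c' Y, of "Y + \<delta>" t] by simp
  qed
  then show "\<epsilon> + X + 2 * b * t + c * t\<^sup>2 \<le> \<epsilon> + X + Y + 2 * (b + b') * t + (c + c') * t\<^sup>2"
    by (simp add: algebra_simps)
  show "b\<^sup>2 \<le> (\<epsilon> + X) * c"
    using b mult_nonneg_nonneg[OF less_imp_le[OF eps] c] by (simp add: distrib_right)
  have "(b + b')\<^sup>2 \<le> (X + Y) * (c + c')"
    by (rule quad_discriminant_add[OF b b' X Y c c'])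
  then show "(b + b')\<^sup>2 \<le> (\<epsilon> + X + Y) * (c + c')"
    using mult_nonneg_nonneg[OF less_imp_le[OF eps] add_nonneg_nonneg[OF c c']] by (simp add: algebra_simps)
qed

text \<open>The hypothesis on the second derivatives makes the combination of the two powers concave on the
  segment from \<open>t = 0\<close> to \<open>t = 1\<close>, so its value at \<open>1\<close> lies below the tangent at \<open>0\<close>.\<close>

lemma quad_powr_tangent:
  fixes a b c d e g q \<kappa> \<mu> :: real
  assumes A: "\<And>t. 0 < a + 2 * b * t + c * t\<^sup>2" and D: "\<And>t. 0 < d + 2 * e * t + g * t\<^sup>2"
    and le: "\<And>t. \<kappa> * quad_powr_deriv2 q (d + 2 * e * t + g * t\<^sup>2) (e + g * t) g
                 \<le> \<mu> * quad_powr_deriv2 q (a + 2 * b * t + c * t\<^sup>2) (b + c * t) c"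
  shows "\<kappa> * (d + 2 * e + g) powr q - \<mu> * (a + 2 * b + c) powr q
    \<le> \<kappa> * d powr q - \<mu> * a powr q
      + (\<kappa> * (2 * q * d powr (q - 1)) * e - \<mu> * (2 * q * a powr (q - 1)) * b)"
proof -
  define G where "G = (\<lambda>t. \<mu> * (a + 2 * b * t + c * t\<^sup>2) powr q - \<kappa> * (d + 2 * e * t + g * t\<^sup>2) powr q)"
  define G' where "G' = (\<lambda>t. \<mu> * (2 * q * (a + 2 * b * t + c * t\<^sup>2) powr (q - 1) * (b + c * t))
      - \<kappa> * (2 * q * (d + 2 * e * t + g * t\<^sup>2) powr (q - 1) * (e + g * t)))"
  define G'' where "G'' = (\<lambda>t. \<mu> * quad_powr_deriv2 q (a + 2 * b * t + c * t\<^sup>2) (b + c * t) c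
      - \<kappa> * quad_powr_deriv2 q (d + 2 * e * t + g * t\<^sup>2) (e + g * t) g)"
  have "G' 0 * (1 - 0) \<le> G 1 - G 0"
  proof (rule f''_imp_f'[where C = UNIV and f'' = G''])
    show "(G has_real_derivative G' t) (at t)" for t
      unfolding G_def G'_def by (intro DERIV_diff DERIV_cmult quad_powr_has_derivs A D)
    show "(G' has_real_derivative G'' t) (at t)" for t
      unfolding G'_def G''_def by (intro DERIV_diff DERIV_cmult quad_powr_has_derivs A D)
    show "0 \<le> G'' t" for t using le[of t] by (simp add: G''_def)
  qed auto
  then show ?thesis by (simp add: G_def G'_def algebra_simps)
qed

text \<open>The coefficient of \<open>Y\<^sup>q\<close> has to be smaller than \<open>2\<close>, the coefficient of \<open>Y\<^sup>q\<close> in the Bellman function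
  for \<open>q \<ge> 1\<close> (up to a common factor).\<close>

lemma powr_sum_split:
  fixes q :: real
  assumes "1 \<le> q"
  obtains K where "K > 0" "\<And>V Y. 0 \<le> V \<Longrightarrow> 0 \<le> Y \<Longrightarrow> (V + Y) powr q \<le> 3/2 * Y powr q + K * V powr q"
proof -
  \<comment> \<open>The solution of \<open>(1 + \<theta>)\<^sup>q = 3/2\<close>: the first term suffices if \<open>V \<le> \<theta> Y\<close>, the second one otherwise.\<close>
  define \<theta> :: real where "\<theta> = (3/2) powr (1 / q) - 1"
  have "1 < (3/2::real) powr (1/q)" using assms by (intro gr_one_powr) auto
  then have th: "\<theta> > 0" by (simp add: \<theta>_def)
  have th2: "(1 + \<theta>) powr q = 3/2" using assms by (simp add: \<theta>_def powr_powr)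
  show ?thesis
  proof (rule that[of "(1 + 1/\<theta>) powr q"])
    show "(1 + 1/\<theta>) powr q > 0" 
    proof -
      have "0 < 1 + 1/\<theta>" using divide_pos_pos[OF zero_less_one th] by linarith
      then show ?thesis by simp
    qed
    fix V Y :: real assume V: "0 \<le> V" and Y: "0 \<le> Y"
    show "(V + Y) powr q \<le> 3/2 * Y powr q + (1 + 1/\<theta>) powr q * V powr q"
    proof (cases "V \<le> \<theta> * Y")
      case True
      then have "(V + Y) powr q \<le> ((1 + \<theta>) * Y) powr q"
        using V Y assms by (intro powr_mono2) (auto simp: algebra_simps)
      also have "\<dots> = 3/2 * Y powr q" using th Y th2 by (simp add: powr_mult)
      finally show ?thesis
        using mult_nonneg_nonneg[OF powr_ge_zero[of "1 + 1/\<theta>" q] powr_ge_zero[of V q]] by linarith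
    next
      case False
      then have "(V + Y) powr q \<le> ((1 + 1/\<theta>) * V) powr q"
        using V Y assms th by (intro powr_mono2) (auto simp: field_simps)
      also have "\<dots> = (1 + 1/\<theta>) powr q * V powr q" using th V by (simp add: powr_mult)
      finally show ?thesis using powr_ge_zero[of Y q] by linarith
    qed
  qed
qed

text \<open>The function \<open>U\<close> is evaluated at squared norms. The inner products \<open>b = \<langle>x, h\<rangle>\<close>, \<open>b' = \<langle>y, k\<rangle>\<close> and the
  squared norms \<open>c = |h|\<^sup>2\<close>, \<open>c' = |k|\<^sup>2\<close> of the increments enter as numbers, which leaves the
  dimensions of the two Hilbert spaces open. Only the linear terms \<open>A b + B b'\<close> remain in the first
  condition, and these cancel in a sum over increments with mean zero. The parameter \<open>\<epsilon>\<close> keeps \<open>U\<close>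
  smooth where \<open>x\<close> or \<open>y\<close> vanishes and is sent to zero in the end.\<close>

definition bellman_fun :: "real \<Rightarrow> real \<Rightarrow> real \<Rightarrow> real \<Rightarrow> (real \<Rightarrow> real \<Rightarrow> real) \<Rightarrow> bool" where
  "bellman_fun q \<gamma> K \<epsilon> U \<longleftrightarrow>
     (\<forall>X\<ge>0. \<forall>Y\<ge>0. \<exists>A B. \<forall>b c b' c'. b\<^sup>2 \<le> X * c \<longrightarrow> b'\<^sup>2 \<le> Y * c' \<longrightarrow> 0 \<le> c' \<longrightarrow> c' \<le> \<gamma> * c \<longrightarrow>
        U (X + 2 * b + c) (Y + 2 * b' + c') \<le> U X Y + A * b + B * b') \<and>
     (\<forall>X\<ge>0. \<forall>Y\<ge>0. Y powr q \<le> K * (X + \<epsilon>) powr q + U X Y) \<and>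
     U 0 0 \<le> K * \<epsilon> powr q"

text \<open>As \<open>q \<le> 1\<close>, the second derivative of \<open>(\<epsilon> + X + Y)\<^sup>q\<close> is at most \<open>2 q (c + c') (\<epsilon> + X + Y)\<^bsup>q-1\<^esup>\<close>, and
  that of \<open>(\<epsilon> + X)\<^sup>q\<close> is at least \<open>2 q (2 q - 1) c (\<epsilon> + X)\<^bsup>q-1\<^esup>\<close>. Since \<open>q - 1 \<le> 0\<close>, the power
  \<open>(\<epsilon> + X)\<^bsup>q-1\<^esup>\<close> is the larger one, and the factor \<open>C\<close> makes up for \<open>c + c' \<le> 2 c\<close> and for
  \<open>2 q - 1\<close>. The factor \<open>1\<close> gives \<open>U\<close> the shape of
  \<open>quad_powr_tangent\<close>.\<close>

lemma bellman_fun_le_1: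
  assumes q: "1 / 2 < q" "q \<le> 1" and eps: "0 < \<epsilon>" and C: "C = 2 / (2 * q - 1)"
  shows "bellman_fun q 1 (C + 1) \<epsilon> (\<lambda>X Y. 1 * (\<epsilon> + X + Y) powr q - C * (\<epsilon> + X) powr q)"
proof -
  have q: "0 < q" "q \<le> 1" "0 < 2 * q - 1" using q by auto
  have C: "C > 0" "C * (2 * q - 1) = 2"
  proof -
    show "C > 0" using q(3) by (simp add: C)
    have "2 * q - 1 \<noteq> 0" using q(3) by simp
    then show "C * (2 * q - 1) = 2" unfolding C by (rule nonzero_eq_divide_eq[THEN iffD1, OF _ refl])
  qed
  show ?thesis unfolding bellman_fun_def
  proof (intro conjI allI impI)
    fix X Y :: real assume X: "0 \<le> X" and Y: "0 \<le> Y"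
    define A where "A = 1 * (2 * q * (\<epsilon> + X + Y) powr (q-1)) - C * (2 * q * (\<epsilon> + X) powr (q - 1))"
    define B where "B = 1 * (2 * q * (\<epsilon> + X + Y) powr (q-1))"
    show "\<exists>A B. \<forall>b c b' c'. b\<^sup>2 \<le> X * c \<longrightarrow> b'\<^sup>2 \<le> Y * c' \<longrightarrow> 0 \<le> c' \<longrightarrow> c' \<le> 1 * c \<longrightarrow>
        1 * (\<epsilon> + (X + 2 * b + c) + (Y + 2 * b' + c')) powr q - C * (\<epsilon> + (X + 2 * b + c)) powr q
        \<le> 1 * (\<epsilon> + X + Y) powr q - C * (\<epsilon> + X) powr q + A * b + B * b'"
    proof (intro exI allI impI)
      fix b c b' c' :: real
      assume b: "b\<^sup>2 \<le> X * c" and b': "b'\<^sup>2 \<le> Y * c'" and c': "0 \<le> c'" "c' \<le> 1 * c"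
      then have c: "0 \<le> c" by simp
      note pair = quad_pair[OF b b' X Y c c'(1) eps]
      note pos1 = pair(1) and le = pair(2) and disc1 = pair(3) and disc2 = pair(4)
      have pos2: "0 < \<epsilon> + X + Y + 2 * (b + b') * t + (c + c') * t\<^sup>2" for t
        using le[of t] pos1[of t] by linarith
      have "1 * (\<epsilon> + X + Y + 2 * (b + b') + (c + c')) powr q - C * (\<epsilon> + X + 2 * b + c) powr q
        \<le> 1 * (\<epsilon> + X + Y) powr q - C * (\<epsilon> + X) powr q
        + (1 * (2 * q * (\<epsilon> + X + Y) powr (q - 1)) * (b + b') - C * (2 * q * (\<epsilon> + X) powr (q - 1)) * b)"
      proof (rule quad_powr_tangent[OF pos1 pos2])
        fix t
        let ?A = "\<epsilon> + X + 2 * b * t + c * t\<^sup>2" and ?D = "\<epsilon> + X + Y + 2 * (b + b') * t + (c + c') * t\<^sup>2"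
        have "quad_powr_deriv2 q ?D (b + b' + (c + c') * t) (c + c') \<le> 2 * q * ?D powr (q - 1) * (c + c')"
          by (rule quad_powr_deriv2_bounds(1)) (use pos2 q c c' quad_discriminant[OF disc2] in auto)
        also have "\<dots> \<le> 2 * q * ?A powr (q - 1) * (2 * c)"
          using q c c' pos1[of t] le[of t]
          by (intro mult_mono powr_mono2') auto
        also have "\<dots> = (C * (2 * q - 1)) * (2 * q * ?A powr (q - 1) * c)"
          unfolding C(2) by simp
        also have "\<dots> = C * (2 * q * ?A powr (q - 1) * ((2 * q - 1) * c))"
          by (simp only: mult_ac)
        also have "\<dots> \<le> C * quad_powr_deriv2 q ?A (b + c * t) c"
          by (intro mult_left_mono quad_powr_deriv2_bounds(2))
             (use pos1 q c C quad_discriminant[OF disc1] in auto)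
        finally show "1 * quad_powr_deriv2 q ?D (b + b' + (c + c') * t) (c + c')
            \<le> C * quad_powr_deriv2 q ?A (b + c * t) c" by simp
      qed
      then show "1 * (\<epsilon> + (X + 2 * b + c) + (Y + 2 * b' + c')) powr q - C * (\<epsilon> + (X + 2 * b + c)) powr q
        \<le> 1 * (\<epsilon> + X + Y) powr q - C * (\<epsilon> + X) powr q + A * b + B * b'"
        unfolding A_def B_def by (simp add: algebra_simps)
    qed
  next
    fix X Y :: real assume X: "0 \<le> X" and Y: "0 \<le> Y"
    have "Y powr q \<le> (\<epsilon> + X + Y) powr q" using q X Y eps by (intro powr_mono2) auto
    moreover have "0 \<le> (X + \<epsilon>) powr q"
      "(C + 1) * (X + \<epsilon>) powr q = C * (\<epsilon> + X) powr q + (X + \<epsilon>) powr q"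
      by (auto simp: algebra_simps)
    ultimately show "Y powr q \<le> (C + 1) * (X + \<epsilon>) powr q + (1 * (\<epsilon> + X + Y) powr q - C * (\<epsilon> + X) powr q)"
      by linarith
  next
    have "0 \<le> C * \<epsilon> powr q" using C by simp
    then show "1 * (\<epsilon> + 0 + 0) powr q - C * (\<epsilon> + 0) powr q \<le> (C + 1) * \<epsilon> powr q"
      by (simp add: distrib_right)
  qed
qed

text \<open>For \<open>q \<ge> 1\<close> the bounds of the second derivatives are interchanged: the positive term \<open>4 (\<epsilon> + Y)\<^sup>q\<close>
  is controlled because \<open>c'\<close> is a small multiple of \<open>c\<close>.\<close>

lemma bellman_fun_ge_1:
  assumes q: "1 \<le> q" and eps: "0 < \<epsilon>" and \<gamma>: "\<gamma> = 1 / (2 * (2 * q - 1))"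
    and K: "0 < K" "\<And>V Y. 0 \<le> V \<Longrightarrow> 0 \<le> Y \<Longrightarrow> (V + Y) powr q \<le> 3/2 * Y powr q + K * V powr q"
  shows "bellman_fun q \<gamma> (2 * K + 2) \<epsilon> (\<lambda>X Y. 4 * (\<epsilon> + Y) powr q - 2 * (\<epsilon> + X + Y) powr q)"
proof -
  have g: "\<gamma> > 0" "2 * (2 * q - 1) * \<gamma> = 1" using q by (auto simp: \<gamma>)
  show ?thesis unfolding bellman_fun_def
  proof (intro conjI allI impI)
    fix X Y :: real assume X: "0 \<le> X" and Y: "0 \<le> Y"
    define A where "A = - 2 * (2 * q * (\<epsilon> + X + Y) powr (q-1))"
    define B where "B = 4 * (2 * q * (\<epsilon> + Y) powr (q-1)) - 2 * (2 * q * (\<epsilon> + X + Y) powr (q-1))"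
    show "\<exists>A B. \<forall>b c b' c'. b\<^sup>2 \<le> X * c \<longrightarrow> b'\<^sup>2 \<le> Y * c' \<longrightarrow> 0 \<le> c' \<longrightarrow> c' \<le> \<gamma> * c \<longrightarrow>
        4 * (\<epsilon> + (Y + 2 * b' + c')) powr q - 2 * (\<epsilon> + (X + 2 * b + c) + (Y + 2 * b' + c')) powr q
        \<le> 4 * (\<epsilon> + Y) powr q - 2 * (\<epsilon> + X + Y) powr q + A * b + B * b'"
    proof (intro exI allI impI)
      fix b c b' c' :: real
      assume b: "b\<^sup>2 \<le> X * c" and b': "b'\<^sup>2 \<le> Y * c'" and c': "0 \<le> c'" "c' \<le> \<gamma> * c"
      then have "0 \<le> \<gamma> * c" by linarith
      then have c: "0 \<le> c" using g(1) by (simp add: zero_le_mult_iff)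
      note pair = quad_pair[OF b' b Y X c'(1) c eps]
      note pos1 = pair(1) and disc1 = pair(3)
      have le: "\<epsilon> + Y + 2 * b' * t + c' * t\<^sup>2 \<le> \<epsilon> + X + Y + 2 * (b + b') * t + (c + c') * t\<^sup>2" for t
        using pair(2)[of t] by (simp add: algebra_simps)
      have disc2: "(b + b')\<^sup>2 \<le> (\<epsilon> + X + Y) * (c + c')"
        using pair(4) by (simp add: ac_simps)
      have pos2: "0 < \<epsilon> + X + Y + 2 * (b + b') * t + (c + c') * t\<^sup>2" for t
        using le[of t] pos1[of t] by linarith
      have "4 * (\<epsilon> + Y + 2 * b' + c') powr q - 2 * (\<epsilon> + X + Y + 2 * (b + b') + (c + c')) powr q
        \<le> 4 * (\<epsilon> + Y) powr q - 2 * (\<epsilon> + X + Y) powr q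
        + (4 * (2 * q * (\<epsilon> + Y) powr (q - 1)) * b' - 2 * (2 * q * (\<epsilon> + X + Y) powr (q - 1)) * (b + b'))"
      proof (rule quad_powr_tangent[OF pos2 pos1])
        fix t
        let ?A = "\<epsilon> + Y + 2 * b' * t + c' * t\<^sup>2" and ?D = "\<epsilon> + X + Y + 2 * (b + b') * t + (c + c') * t\<^sup>2"
        have "4 * quad_powr_deriv2 q ?A (b' + c' * t) c' \<le> 4 * (2 * q * ?A powr (q - 1) * ((2 * q - 1) * c'))"
          by (intro mult_left_mono quad_powr_deriv2_bounds(4))
             (use pos1 q c c' quad_discriminant[OF disc1] in auto)
        also have "\<dots> \<le> 4 * (2 * q * ?A powr (q - 1) * ((2 * q - 1) * (\<gamma> * c)))"
          using q c' by (intro mult_left_mono) auto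
        also have "\<dots> = 2 * (2 * q * ?A powr (q - 1) * c) * (2 * (2 * q - 1) * \<gamma>)"
          by (simp only: numeral_Bit0 mult_ac) (simp add: algebra_simps)
        also have "\<dots> = 2 * (2 * q * ?A powr (q - 1) * c)" using g by simp
        also have "\<dots> \<le> 2 * (2 * q * ?D powr (q - 1) * (c + c'))"
          using q c c' pos1[of t] le[of t]
          by (intro mult_left_mono mult_mono powr_mono2) auto
        also have "\<dots> \<le> 2 * quad_powr_deriv2 q ?D (b + b' + (c + c') * t) (c + c')"
          by (intro mult_left_mono quad_powr_deriv2_bounds(3)) (use pos2 q c c' quad_discriminant[OF disc2] in auto)
        finally show "4 * quad_powr_deriv2 q ?A (b' + c' * t) c'
           \<le> 2 * quad_powr_deriv2 q ?D (b + b' + (c + c') * t) (c + c')" .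
      qed
      then show "4 * (\<epsilon> + (Y + 2 * b' + c')) powr q - 2 * (\<epsilon> + (X + 2 * b + c) + (Y + 2 * b' + c')) powr q
        \<le> 4 * (\<epsilon> + Y) powr q - 2 * (\<epsilon> + X + Y) powr q + A * b + B * b'"
        unfolding A_def B_def by (simp add: algebra_simps)
    qed
  next
    fix X Y :: real assume X: "0 \<le> X" and Y: "0 \<le> Y"
    have "Y powr q \<le> (\<epsilon> + Y) powr q" using q X Y eps by (intro powr_mono2) auto
    moreover have "((X + \<epsilon>) + Y) powr q \<le> 3/2 * Y powr q + K * (X + \<epsilon>) powr q"
      using K X Y eps by simp
    moreover have "0 \<le> (X + \<epsilon>) powr q"
      "(2 * K + 2) * (X + \<epsilon>) powr q = 2 * (K * (X + \<epsilon>) powr q) + 2 * (X + \<epsilon>) powr q"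
      "\<epsilon> + X + Y = X + \<epsilon> + Y"
      by (auto simp: algebra_simps)
    ultimately show "Y powr q \<le> (2 * K + 2) * (X + \<epsilon>) powr q + (4 * (\<epsilon> + Y) powr q - 2 * (\<epsilon> + X + Y) powr q)"
      by (simp only:)
  next
    have "0 \<le> K * \<epsilon> powr q" using K by simp
    then show "4 * (\<epsilon> + 0) powr q - 2 * (\<epsilon> + 0 + 0) powr q \<le> (2 * K + 2) * \<epsilon> powr q"
      by (simp add: distrib_right)
  qed
qed

lemma bellman_fun_exists:
  assumes p: "1 < p"
  obtains \<gamma> K where "0 < \<gamma>" "0 < K" "\<And>\<epsilon>. 0 < \<epsilon> \<Longrightarrow> \<exists>U. bellman_fun (p/2) \<gamma> K \<epsilon> U"
proof (cases "p \<le> 2")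
  case True
  have "\<exists>U. bellman_fun (p/2) 1 (2 / (2 * (p/2) - 1) + 1) \<epsilon> U" if "0 < \<epsilon>" for \<epsilon>
    by (rule exI, rule bellman_fun_le_1[OF _ _ that refl]) (use True p in auto)
  moreover have "0 < 2 / (2 * (p/2) - 1) + 1" using p by (simp add: add_pos_pos)
  ultimately show thesis using that[of 1] by simp
next
  case False
  then have q: "1 \<le> p/2" by simp
  obtain K where K: "0 < K"
    "\<And>V Y. 0 \<le> V \<Longrightarrow> 0 \<le> Y \<Longrightarrow> (V + Y) powr (p/2) \<le> 3/2 * Y powr (p/2) + K * V powr (p/2)"
    using powr_sum_split[OF q] by metis
  show thesis
  proof (rule that)
    show "0 < 1 / (2 * (2 * (p/2) - 1))" using q by simp
    show "0 < 2 * K + 2" using K by simp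
    show "\<exists>U. bellman_fun (p/2) (1 / (2 * (2 * (p/2) - 1))) (2 * K + 2) \<epsilon> U" if "0 < \<epsilon>" for \<epsilon>
      by (rule exI, rule bellman_fun_ge_1[OF q that refl K])
  qed
qed

section \<open>Walsh functions and the tree of dyadic cubes\<close>

definition walsh :: "('m::finite \<Rightarrow> bool) \<Rightarrow> ('m \<Rightarrow> bool) \<Rightarrow> real" where
  "walsh e \<delta> = (\<Prod>i\<in>UNIV. if e i \<and> \<delta> i then - 1 else 1)"

text \<open>Sums over the children of a cube factor over the coordinates.\<close>

lemma sum_prod_bool:
  fixes f :: "'m::finite \<Rightarrow> bool \<Rightarrow> real"
  shows "(\<Sum>\<delta>\<in>UNIV. \<Prod>i\<in>UNIV. f i (\<delta> i)) = (\<Prod>i\<in>UNIV. f i True + f i False)"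
proof -
  have P: "PiE (UNIV :: 'm set) (\<lambda>_. UNIV :: bool set) = UNIV"
    by (auto simp: PiE_def Pi_def extensional_def)
  have s: "(\<Sum>b\<in>UNIV. g b) = g True + g False" for g :: "bool \<Rightarrow> real"
    by (simp add: UNIV_bool)
  have "(\<Prod>i\<in>UNIV. \<Sum>b\<in>UNIV. f i b) = (\<Sum>\<delta>\<in>PiE UNIV (\<lambda>_. UNIV). \<Prod>i\<in>UNIV. f i (\<delta> i))"
    by (rule prod_sum_PiE) auto
  then show ?thesis unfolding P s by (rule sym)
qed

lemma walsh_mult: "walsh e \<delta> * walsh e' \<delta> = walsh (\<lambda>i. e i \<noteq> e' i) \<delta>"
  unfolding walsh_def prod.distrib[symmetric] by (rule prod.cong) auto

lemma walsh_sq: "(walsh e \<delta>)\<^sup>2 = 1"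
  unfolding walsh_def prod_power_distrib by (rule prod.neutral) auto

lemma walsh_cases: "walsh e \<delta> = 1 \<or> walsh e \<delta> = - 1"
  using walsh_sq[of e \<delta>] by (simp add: power2_eq_1_iff)

lemma sum_walsh:
  assumes "e \<in> haar_indices"
  shows "(\<Sum>\<delta>\<in>UNIV. walsh e \<delta>) = 0"
proof -
  obtain i where "e i" using assms by (auto simp: haar_indices_def fun_eq_iff)
  then show ?thesis unfolding walsh_def sum_prod_bool[where f = "\<lambda>i b. if e i \<and> b then - 1 else 1"]
    by (auto intro!: exI[of _ i])
qed

lemma sum_walsh_mult:
  assumes "e \<noteq> e'"
  shows "(\<Sum>\<delta>\<in>UNIV. walsh e \<delta> * walsh e' \<delta>) = 0"
  unfolding walsh_mult by (rule sum_walsh) (use assms in \<open>auto simp: haar_indices_def fun_eq_iff\<close>)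

text \<open>Dyadic cubes of a fixed level are indexed by lattice points, their lower left corners in units of the
  side length. Passing to the parent halves each coordinate and forgets the parities, which say which
  child of its parent the cube is.\<close>

definition ancestor :: "nat \<Rightarrow> ('m \<Rightarrow> int) \<Rightarrow> 'm \<Rightarrow> int" where
  "ancestor j n = (\<lambda>i. n i div 2 ^ j)"

definition bits :: "('m \<Rightarrow> int) \<Rightarrow> 'm \<Rightarrow> bool" where
  "bits n = (\<lambda>i. odd (n i))"

definition child :: "('m \<Rightarrow> int) \<Rightarrow> ('m \<Rightarrow> bool) \<Rightarrow> 'm \<Rightarrow> int" where
  "child n \<delta> = (\<lambda>i. 2 * n i + of_bool (\<delta> i))"

definition descendants :: "nat \<Rightarrow> ('m \<Rightarrow> int) \<Rightarrow> ('m \<Rightarrow> int) set" where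
  "descendants D n = {u. ancestor D u = n}"

lemma ancestor_0 [simp]: "ancestor 0 n = n"
  by (simp add: ancestor_def)

lemma ancestor_Suc: "ancestor (Suc j) n = ancestor j (ancestor 1 n)"
  by (simp add: ancestor_def fun_eq_iff zdiv_zmult2_eq)

lemma ancestor_child [simp]: "ancestor (Suc j) (child n \<delta>) = ancestor j n"
  by (subst ancestor_Suc) (auto simp: ancestor_def child_def fun_eq_iff)

lemma ancestor_1_child [simp]: "ancestor 1 (child n \<delta>) = n" "ancestor (Suc 0) (child n \<delta>) = n"
  by (auto simp: ancestor_def child_def fun_eq_iff)

lemma bits_child [simp]: "bits (child n \<delta>) = \<delta>"
  by (auto simp: bits_def child_def fun_eq_iff)

lemma child_ancestor: "child (ancestor 1 n) (bits n) = n"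
  by (auto simp: bits_def child_def ancestor_def fun_eq_iff of_bool_def odd_two_times_div_two_succ)

lemma descendants_0 [simp]: "descendants 0 n = {n}"
  by (simp add: descendants_def)

lemma bij_betw_child:
  "bij_betw (\<lambda>(v, \<delta>). child v \<delta>) (descendants D n \<times> UNIV) (descendants (Suc D) n)"
  by (rule bij_betw_byWitness[where f' = "\<lambda>u. (ancestor 1 u, bits u)"])
     (auto simp: descendants_def child_ancestor ancestor_Suc[of D] simp flip: One_nat_def)

lemma finite_descendants: "finite (descendants D (n :: 'm::finite \<Rightarrow> int))"
  by (induction D) (auto simp flip: bij_betw_finite[OF bij_betw_child])

lemma sum_descendants_Suc:
  fixes g :: "('m::finite \<Rightarrow> int) \<Rightarrow> real"
  shows "(\<Sum>u\<in>descendants (Suc D) n. g u) = (\<Sum>v\<in>descendants D n. \<Sum>\<delta>\<in>UNIV. g (child v \<delta>))"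
  unfolding sum.reindex_bij_betw[OF bij_betw_child, symmetric] sum.cartesian_product
  by (simp add: case_prod_unfold)

text \<open>This is the fact that the expectation of a supermartingale decreases, without normalization: each cube
  has \<open>2\<^sup>m\<close> children.\<close>

lemma supermartingale_sum_le:
  fixes z :: "nat \<Rightarrow> ('m::finite \<Rightarrow> int) \<Rightarrow> real"
  assumes "\<And>d n. (\<Sum>\<delta>\<in>UNIV. z (Suc d) (child n \<delta>)) \<le> 2 ^ CARD('m) * z d n"
  shows "(\<Sum>u\<in>descendants D n. z D u) \<le> (2 ^ CARD('m)) ^ D * z 0 n"
proof (induction D)
  case (Suc D)
  have "(\<Sum>u\<in>descendants (Suc D) n. z (Suc D) u) \<le> (\<Sum>v\<in>descendants D n. 2 ^ CARD('m) * z D v)"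
    unfolding sum_descendants_Suc by (intro sum_mono assms)
  also have "\<dots> = 2 ^ CARD('m) * (\<Sum>v\<in>descendants D n. z D v)" by (simp add: sum_distrib_left)
  also have "\<dots> \<le> 2 ^ CARD('m) * ((2 ^ CARD('m)) ^ D * z 0 n)" using Suc by (intro mult_left_mono) auto
  finally show ?case by (simp add: ac_simps)
qed simp

text \<open>At the leaves \<open>U\<close> majorizes \<open>Y\<^sup>q - K (X + \<epsilon>)\<^sup>q\<close>; the supermartingale property carries the sum of \<open>U\<close> over the
  leaves to the root, where \<open>U 0 0\<close> is of the order of \<open>\<epsilon>\<^sup>q\<close>. Let \<open>\<epsilon>\<close> tend to zero.\<close>

lemma bellman_transfer:
  fixes X Y :: "nat \<Rightarrow> ('m::finite \<Rightarrow> int) \<Rightarrow> real"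
  assumes q: "0 < q" and K: "0 < K" and ex: "\<And>\<epsilon>. 0 < \<epsilon> \<Longrightarrow> \<exists>U. bellman_fun q \<gamma> K \<epsilon> U"
    and X: "\<And>d n. 0 \<le> X d n" "\<And>n. X 0 n = 0" and Y: "\<And>d n. 0 \<le> Y d n" "\<And>n. Y 0 n = 0"
    and step: "\<And>\<epsilon> U d n. bellman_fun q \<gamma> K \<epsilon> U \<Longrightarrow>
      (\<Sum>\<delta>\<in>UNIV. U (X (Suc d) (child n \<delta>)) (Y (Suc d) (child n \<delta>))) \<le> 2 ^ CARD('m) * U (X d n) (Y d n)"
  shows "(\<Sum>u\<in>descendants D n. Y D u powr q) \<le> K * (\<Sum>u\<in>descendants D n. X D u powr q)"
proof -
  define R where "R = (\<lambda>\<epsilon>. K * (\<Sum>u\<in>descendants D n. (X D u + \<epsilon>) powr q) + (2 ^ CARD('m)) ^ D * (K * \<epsilon> powr q))"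
  have le: "(\<Sum>u\<in>descendants D n. Y D u powr q) \<le> R \<epsilon>" if eps: "0 < \<epsilon>" for \<epsilon>
  proof -
    obtain U where U: "bellman_fun q \<gamma> K \<epsilon> U" using ex[OF eps] by blast
    have "(\<Sum>u\<in>descendants D n. Y D u powr q)
        \<le> (\<Sum>u\<in>descendants D n. K * (X D u + \<epsilon>) powr q + U (X D u) (Y D u))"
      using U X Y by (intro sum_mono) (auto simp: bellman_fun_def)
    also have "\<dots> = K * (\<Sum>u\<in>descendants D n. (X D u + \<epsilon>) powr q) + (\<Sum>u\<in>descendants D n. U (X D u) (Y D u))"
      by (simp add: sum.distrib sum_distrib_left)
    also have "(\<Sum>u\<in>descendants D n. U (X D u) (Y D u)) \<le> (2 ^ CARD('m)) ^ D * U (X 0 n) (Y 0 n)"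
      by (rule supermartingale_sum_le[where z = "\<lambda>d n. U (X d n) (Y d n)"]) (rule step[OF U])
    also have "\<dots> \<le> (2 ^ CARD('m)) ^ D * (K * \<epsilon> powr q)"
      using U X Y by (intro mult_left_mono) (auto simp: bellman_fun_def)
    finally show ?thesis by (simp add: R_def)
  qed
  have t: "((\<lambda>\<epsilon>. (x + \<epsilon>) powr q) \<longlongrightarrow> x powr q) (at_right 0)" if "0 \<le> x" for x :: real
  proof (rule tendsto_powr2)
    show "((\<lambda>\<epsilon>. x + \<epsilon>) \<longlongrightarrow> x) (at_right 0)" by (auto intro!: tendsto_eq_intros)
    show "\<forall>\<^sub>F \<epsilon> in at_right 0. 0 \<le> x + \<epsilon>"
      using that by (intro eventually_mono[OF eventually_at_right_less[of 0]]) auto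
  qed (use q in auto)
  have t0: "((\<lambda>\<epsilon>::real. \<epsilon> powr q) \<longlongrightarrow> 0) (at_right 0)" using t[of 0] q by simp
  have "(R \<longlongrightarrow> K * (\<Sum>u\<in>descendants D n. X D u powr q) + (2 ^ CARD('m)) ^ D * (K * 0)) (at_right 0)"
    unfolding R_def by (intro tendsto_add tendsto_mult tendsto_const tendsto_sum t t0 X)
  then have "(R \<longlongrightarrow> K * (\<Sum>u\<in>descendants D n. X D u powr q)) (at_right 0)"
    by simp
  then show ?thesis
    by (rule tendsto_lowerbound) (auto intro!: eventually_mono[OF eventually_at_right_less[of 0]] le)
qed

section \<open>One-parameter square function estimates for finite Haar sums\<close>

text \<open>The value at the leaf \<open>n\<close> of a Haar sum on a tree of depth \<open>D\<close>. The cube at depth \<open>d\<close> above \<open>n\<close> is its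
  ancestor of order \<open>D - d\<close>, and the next ancestor towards \<open>n\<close> decides the sign. The absolute value of
  the Haar function is absorbed in the coefficient \<open>a\<close>.\<close>

definition haar_sum :: "(nat \<Rightarrow> ('m::finite \<Rightarrow> int) \<Rightarrow> ('m \<Rightarrow> bool) \<Rightarrow> real) \<Rightarrow> nat \<Rightarrow> ('m \<Rightarrow> int) \<Rightarrow> real" where
  "haar_sum a D n = (\<Sum>d<D. \<Sum>e\<in>haar_indices.
      a d (ancestor (D - d) n) e * walsh e (bits (ancestor (D - d - 1) n)))"

definition square_sum :: "('m \<Rightarrow> bool) set \<Rightarrow> 'b set \<Rightarrow>
    ('b \<Rightarrow> nat \<Rightarrow> ('m::finite \<Rightarrow> int) \<Rightarrow> ('m \<Rightarrow> bool) \<Rightarrow> real) \<Rightarrow> nat \<Rightarrow> ('m \<Rightarrow> int) \<Rightarrow> real" where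
  "square_sum E B a D n = (\<Sum>d<D. \<Sum>e\<in>E. \<Sum>b\<in>B. (a b d (ancestor (D - d) n) e)\<^sup>2)"

lemma haar_sum_0 [simp]: "haar_sum a 0 n = 0"
  by (simp add: haar_sum_def)

lemma square_sum_0 [simp]: "square_sum E B a 0 n = 0"
  by (simp add: square_sum_def)

lemma haar_sum_child:
  "haar_sum a (Suc D) (child n \<delta>) = haar_sum a D n + (\<Sum>e\<in>haar_indices. a D n e * walsh e \<delta>)"
  unfolding haar_sum_def sum.lessThan_Suc
  by (intro arg_cong2[where f = "(+)"] sum.cong refl)
     (auto simp: Suc_diff_le Suc_diff_Suc simp del: diff_Suc_Suc dest!: less_imp_Suc_add)

lemma square_sum_child:
  "square_sum E B a (Suc D) (child n \<delta>) = square_sum E B a D n + (\<Sum>e\<in>E. \<Sum>b\<in>B. (a b D n e)\<^sup>2)"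
  unfolding square_sum_def sum.lessThan_Suc
  by (intro arg_cong2[where f = "(+)"] sum.cong refl) (auto simp: Suc_diff_le)

lemma square_sum_nonneg: "0 \<le> square_sum E B a D n"
  unfolding square_sum_def by (intro sum_nonneg) auto

lemma sum_sq_add:
  fixes x h :: "'b \<Rightarrow> real"
  shows "(\<Sum>b\<in>B. (x b + h b)\<^sup>2) = (\<Sum>b\<in>B. (x b)\<^sup>2) + 2 * (\<Sum>b\<in>B. x b * h b) + (\<Sum>b\<in>B. (h b)\<^sup>2)"
  by (simp add: power2_sum sum.distrib sum_distrib_left algebra_simps)

text \<open>Cut the step into two: first move from \<open>x\<close> to \<open>x + \<sigma> \<alpha>\<close>, where \<open>\<alpha>\<close> is the coefficient with index \<open>e0\<close>
  and \<open>\<sigma> = \<plusminus>1\<close> its sign, and \<open>y\<close> gains an orthogonal component of squared norm \<open>\<gamma> |\<alpha>|\<^sup>2\<close>; then add the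
  remaining indices to \<open>x\<close> and leave \<open>y\<close> unchanged. In both parts the increment of \<open>y\<close> is dominated.
  The linear term of the second part depends on \<open>\<sigma>\<close>, but vanishes in the sum over the children since
  the other Walsh functions are orthogonal to every function of \<open>\<sigma>\<close>.\<close>

lemma haar_step_upper:
  fixes x :: "'b \<Rightarrow> real" and a :: "'b \<Rightarrow> ('m::finite \<Rightarrow> bool) \<Rightarrow> real"
  assumes U: "bellman_fun q \<gamma> K \<epsilon> U" and g: "0 < \<gamma>" and e0: "e0 \<in> haar_indices" and Y: "0 \<le> Y"
  shows "(\<Sum>\<delta>\<in>UNIV. U (\<Sum>b\<in>B. (x b + (\<Sum>e\<in>haar_indices. a b e * walsh e \<delta>))\<^sup>2) (Y + \<gamma> * (\<Sum>b\<in>B. (a b e0)\<^sup>2)))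
     \<le> 2 ^ CARD('m) * U (\<Sum>b\<in>B. (x b)\<^sup>2) Y"
proof -
  define \<sigma> where "\<sigma> = (\<lambda>\<delta>::'m \<Rightarrow> bool. walsh e0 \<delta>)"
  define h where "h = (\<lambda>\<delta> b. \<Sum>e\<in>haar_indices - {e0}. a b e * walsh e \<delta>)"
  define Y1 where "Y1 = Y + \<gamma> * (\<Sum>b\<in>B. (a b e0)\<^sup>2)"
  have Y1: "Y1 \<ge> 0" using Y g by (simp add: Y1_def sum_nonneg)
  have tang: "\<exists>A. \<forall>b c. b\<^sup>2 \<le> X * c \<longrightarrow> 0 \<le> c \<longrightarrow> U (X + 2 * b + c) Y \<le> U X Y + A * b"
    if "0 \<le> X" "0 \<le> Y" for X Y
  proof -
    obtain A B where AB: "\<And>b c b' c'. b\<^sup>2 \<le> X * c \<Longrightarrow> b'\<^sup>2 \<le> Y * c' \<Longrightarrow> 0 \<le> c' \<Longrightarrow> c' \<le> \<gamma> * c \<Longrightarrow>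
        U (X + 2 * b + c) (Y + 2 * b' + c') \<le> U X Y + A * b + B * b'"
      using U \<open>0 \<le> X\<close> \<open>0 \<le> Y\<close> unfolding bellman_fun_def by metis
    show ?thesis using AB[of _ _ 0 0] g by (intro exI[of _ A]) auto
  qed
  define X1 where "X1 = (\<lambda>s. \<Sum>b\<in>B. (x b + s * a b e0)\<^sup>2)"
  have "\<forall>s. \<exists>A. \<forall>b c. b\<^sup>2 \<le> X1 s * c \<longrightarrow> 0 \<le> c \<longrightarrow> U (X1 s + 2 * b + c) Y1 \<le> U (X1 s) Y1 + A * b"
  proof
    fix s
    have "0 \<le> X1 s" by (simp add: X1_def sum_nonneg)
    from tang[OF this Y1]
    show "\<exists>A. \<forall>b c. b\<^sup>2 \<le> X1 s * c \<longrightarrow> 0 \<le> c \<longrightarrow> U (X1 s + 2 * b + c) Y1 \<le> U (X1 s) Y1 + A * b" .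
  qed
  from choice[OF this] obtain A1 where
    "\<forall>s b c. b\<^sup>2 \<le> X1 s * c \<longrightarrow> 0 \<le> c \<longrightarrow> U (X1 s + 2 * b + c) Y1 \<le> U (X1 s) Y1 + A1 s * b" ..
  then have A1: "\<And>s b c. b\<^sup>2 \<le> X1 s * c \<Longrightarrow> 0 \<le> c \<Longrightarrow> U (X1 s + 2 * b + c) Y1 \<le> U (X1 s) Y1 + A1 s * b"
    by blast
  have "\<exists>A. \<forall>s\<in>{1, - 1}. U (X1 s) Y1 \<le> U (\<Sum>b\<in>B. (x b)\<^sup>2) Y + A * (s * (\<Sum>b\<in>B. x b * a b e0))"
  proof -
    let ?X = "\<Sum>b\<in>B. (x b)\<^sup>2" and ?c = "\<Sum>b\<in>B. (a b e0)\<^sup>2"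
    have X: "0 \<le> ?X" by (simp add: sum_nonneg)
    obtain A B' where AB: "\<And>b c b' c'. b\<^sup>2 \<le> ?X * c \<Longrightarrow> b'\<^sup>2 \<le> Y * c' \<Longrightarrow> 0 \<le> c' \<Longrightarrow> c' \<le> \<gamma> * c \<Longrightarrow>
        U (?X + 2 * b + c) (Y + 2 * b' + c') \<le> U ?X Y + A * b + B' * b'"
      using U X Y unfolding bellman_fun_def by metis
    have "U (X1 s) Y1 \<le> U ?X Y + A * (s * (\<Sum>b\<in>B. x b * a b e0))" if "s \<in> {1, - 1}" for s
    proof -
      have s2: "s\<^sup>2 = 1" using that by auto
      have "X1 s = ?X + 2 * (s * (\<Sum>b\<in>B. x b * a b e0)) + ?c"
        unfolding X1_def sum_sq_add by (simp add: sum_distrib_left power_mult_distrib s2 mult_ac)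
      moreover have "(s * (\<Sum>b\<in>B. x b * a b e0))\<^sup>2 \<le> ?X * ?c"
        unfolding power_mult_distrib s2 by (simp add: Cauchy_Schwarz_ineq_sum)
      ultimately show ?thesis
        using AB[of "s * (\<Sum>b\<in>B. x b * a b e0)" ?c 0 "\<gamma> * ?c"] g Y
        by (simp add: Y1_def sum_nonneg)
    qed
    then show ?thesis by blast
  qed
  then obtain A where A: "\<And>s. s \<in> {1, - 1} \<Longrightarrow>
      U (X1 s) Y1 \<le> U (\<Sum>b\<in>B. (x b)\<^sup>2) Y + A * (s * (\<Sum>b\<in>B. x b * a b e0))" by blast
  have sig: "\<sigma> \<delta> \<in> {1, - 1}" for \<delta> using walsh_cases[of e0 \<delta>] by (auto simp: \<sigma>_def)
  have pt: "U (\<Sum>b\<in>B. (x b + (\<Sum>e\<in>haar_indices. a b e * walsh e \<delta>))\<^sup>2) Y1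
     \<le> U (\<Sum>b\<in>B. (x b)\<^sup>2) Y + A * (\<Sum>b\<in>B. x b * a b e0) * \<sigma> \<delta>
       + (\<Sum>b\<in>B. A1 (\<sigma> \<delta>) * (x b + \<sigma> \<delta> * a b e0) * h \<delta> b)" for \<delta>
  proof -
    have split: "(\<Sum>e\<in>haar_indices. a b e * walsh e \<delta>) = \<sigma> \<delta> * a b e0 + h \<delta> b" for b
      using e0 by (subst sum.remove[of _ e0]) (auto simp: haar_indices_def \<sigma>_def h_def)
    have "(\<Sum>b\<in>B. (x b + (\<Sum>e\<in>haar_indices. a b e * walsh e \<delta>))\<^sup>2)
      = X1 (\<sigma> \<delta>) + 2 * (\<Sum>b\<in>B. (x b + \<sigma> \<delta> * a b e0) * h \<delta> b) + (\<Sum>b\<in>B. (h \<delta> b)\<^sup>2)"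
      unfolding split X1_def sum_sq_add[symmetric] by (simp add: add.assoc)
    also have "U \<dots> Y1 \<le> U (X1 (\<sigma> \<delta>)) Y1 + A1 (\<sigma> \<delta>) * (\<Sum>b\<in>B. (x b + \<sigma> \<delta> * a b e0) * h \<delta> b)"
      by (rule A1) (auto simp: X1_def Cauchy_Schwarz_ineq_sum sum_nonneg)
    also have "\<dots> \<le> U (\<Sum>b\<in>B. (x b)\<^sup>2) Y + A * (\<sigma> \<delta> * (\<Sum>b\<in>B. x b * a b e0))
        + A1 (\<sigma> \<delta>) * (\<Sum>b\<in>B. (x b + \<sigma> \<delta> * a b e0) * h \<delta> b)"
      using A[OF sig] by simp
    finally show ?thesis by (simp add: sum_distrib_left mult_ac)
  qed
  \<comment> \<open>Every function of the sign is a combination of \<open>1\<close> and \<open>\<sigma>\<close>.\<close>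
  have orth: "(\<Sum>\<delta>\<in>UNIV. \<phi> (\<sigma> \<delta>) * h \<delta> b) = 0" for \<phi> :: "real \<Rightarrow> real" and b
  proof -
    define c0 c1 where "c0 = (\<phi> 1 + \<phi> (- 1)) / 2" and "c1 = (\<phi> 1 - \<phi> (- 1)) / 2"
    have "\<phi> (\<sigma> \<delta>) = c0 + c1 * \<sigma> \<delta>" for \<delta> using sig[of \<delta>] by (auto simp: c0_def c1_def field_simps)
    then have "(\<Sum>\<delta>\<in>UNIV. \<phi> (\<sigma> \<delta>) * h \<delta> b)
      = (\<Sum>\<delta>\<in>UNIV. \<Sum>e\<in>haar_indices - {e0}. c0 * a b e * walsh e \<delta> + c1 * a b e * (walsh e0 \<delta> * walsh e \<delta>))"
      by (simp add: h_def sum_distrib_left \<sigma>_def algebra_simps)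
    also have "\<dots> = (\<Sum>e\<in>haar_indices - {e0}. c0 * a b e * (\<Sum>\<delta>\<in>UNIV. walsh e \<delta>)
        + c1 * a b e * (\<Sum>\<delta>\<in>UNIV. walsh e0 \<delta> * walsh e \<delta>))"
      by (subst sum.swap) (simp add: sum.distrib sum_distrib_left)
    also have "\<dots> = 0" by (rule sum.neutral) (auto simp: sum_walsh sum_walsh_mult)
    finally show ?thesis .
  qed
  have "(\<Sum>\<delta>\<in>UNIV. U (\<Sum>b\<in>B. (x b + (\<Sum>e\<in>haar_indices. a b e * walsh e \<delta>))\<^sup>2) Y1)
     \<le> (\<Sum>\<delta>\<in>UNIV. U (\<Sum>b\<in>B. (x b)\<^sup>2) Y + A * (\<Sum>b\<in>B. x b * a b e0) * \<sigma> \<delta>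
       + (\<Sum>b\<in>B. A1 (\<sigma> \<delta>) * (x b + \<sigma> \<delta> * a b e0) * h \<delta> b))"
    by (intro sum_mono pt)
  also have "\<dots> = (\<Sum>\<delta>\<in>(UNIV::('m\<Rightarrow>bool) set). U (\<Sum>b\<in>B. (x b)\<^sup>2) Y)
       + (A * (\<Sum>b\<in>B. x b * a b e0)) * (\<Sum>\<delta>\<in>UNIV. \<sigma> \<delta>)
       + (\<Sum>\<delta>\<in>UNIV. \<Sum>b\<in>B. A1 (\<sigma> \<delta>) * (x b + \<sigma> \<delta> * a b e0) * h \<delta> b)"
    by (simp only: sum.distrib sum_distrib_left[of "A * (\<Sum>b\<in>B. x b * a b e0)"])
  also have "(\<Sum>\<delta>\<in>UNIV. \<Sum>b\<in>B. A1 (\<sigma> \<delta>) * (x b + \<sigma> \<delta> * a b e0) * h \<delta> b)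
      = (\<Sum>b\<in>B. \<Sum>\<delta>\<in>UNIV. A1 (\<sigma> \<delta>) * (x b + \<sigma> \<delta> * a b e0) * h \<delta> b)"
    by (rule sum.swap)
  also have "\<dots> = 0"
    by (intro sum.neutral ballI orth[of "\<lambda>s. A1 s * (x _ + s * a _ e0)"])
  also have "(\<Sum>\<delta>\<in>UNIV. \<sigma> \<delta>) = 0" using sum_walsh[OF e0] by (simp add: \<sigma>_def)
  finally show ?thesis by (simp add: Y1_def card_fun)
qed

text \<open>Here \<open>X\<close> is the square function, a sum of orthogonal increments, so its linear term is zero. By the
  Cauchy--Schwarz inequality over the Haar indices the increment of the Haar sum has square at most
  \<open>2\<^sup>m\<close> times that of the square function; the factor \<open>\<kappa>\<close> absorbs this.\<close>

lemma haar_step_lower: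
  fixes y :: "'b \<Rightarrow> real" and a :: "'b \<Rightarrow> ('m::finite \<Rightarrow> bool) \<Rightarrow> real"
  assumes U: "bellman_fun q \<gamma> K \<epsilon> U" and g: "0 < \<gamma>" and X: "0 \<le> X" and \<kappa>: "\<kappa> = \<gamma> / 2 ^ CARD('m)"
  shows "(\<Sum>\<delta>\<in>UNIV. U (X + (\<Sum>e\<in>haar_indices. \<Sum>b\<in>B. (a b e)\<^sup>2))
             (\<kappa> * (\<Sum>b\<in>B. (y b + (\<Sum>e\<in>haar_indices. a b e * walsh e \<delta>))\<^sup>2)))
     \<le> 2 ^ CARD('m) * U X (\<kappa> * (\<Sum>b\<in>B. (y b)\<^sup>2))"
proof -
  define h where "h = (\<lambda>\<delta> b. \<Sum>e\<in>haar_indices. a b e * walsh e \<delta>)"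
  define c where "c = (\<Sum>e\<in>haar_indices. \<Sum>b\<in>B. (a b e)\<^sup>2)"
  let ?Y = "\<kappa> * (\<Sum>b\<in>B. (y b)\<^sup>2)"
  have k: "0 < \<kappa>" using g by (simp add: \<kappa>)
  have Y: "0 \<le> ?Y" using k by (simp add: sum_nonneg)
  obtain A B' where AB: "\<And>b c b' c'. b\<^sup>2 \<le> X * c \<Longrightarrow> b'\<^sup>2 \<le> ?Y * c' \<Longrightarrow> 0 \<le> c' \<Longrightarrow> c' \<le> \<gamma> * c \<Longrightarrow>
        U (X + 2 * b + c) (?Y + 2 * b' + c') \<le> U X ?Y + A * b + B' * b'"
    using U X Y unfolding bellman_fun_def by metis
  have c: "0 \<le> c" unfolding c_def by (intro sum_nonneg) auto
  have h2: "(\<Sum>b\<in>B. (h \<delta> b)\<^sup>2) \<le> 2 ^ CARD('m) * c" for \<delta>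
  proof -
    have "(h \<delta> b)\<^sup>2 \<le> 2 ^ CARD('m) * (\<Sum>e\<in>haar_indices. (a b e)\<^sup>2)" for b
    proof -
      have "(h \<delta> b)\<^sup>2 \<le> (\<Sum>e\<in>haar_indices. (a b e)\<^sup>2) * (\<Sum>e\<in>haar_indices. (walsh e \<delta>)\<^sup>2)"
        unfolding h_def by (rule Cauchy_Schwarz_ineq_sum)
      also have "\<dots> \<le> (\<Sum>e\<in>haar_indices. (a b e)\<^sup>2) * (\<Sum>e\<in>(UNIV :: ('m \<Rightarrow> bool) set). (walsh e \<delta>)\<^sup>2)"
        by (intro mult_left_mono sum_mono2 sum_nonneg) auto
      also have "\<dots> = 2 ^ CARD('m) * (\<Sum>e\<in>haar_indices. (a b e)\<^sup>2)" by (simp add: walsh_sq card_fun)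
      finally show ?thesis .
    qed
    then have "(\<Sum>b\<in>B. (h \<delta> b)\<^sup>2) \<le> (\<Sum>b\<in>B. 2 ^ CARD('m) * (\<Sum>e\<in>haar_indices. (a b e)\<^sup>2))"
      by (rule sum_mono)
    also have "\<dots> = 2 ^ CARD('m) * c"
      unfolding c_def sum_distrib_left[symmetric] by (subst sum.swap) simp
    finally show ?thesis .
  qed
  have pt: "U (X + c) (\<kappa> * (\<Sum>b\<in>B. (y b + h \<delta> b)\<^sup>2)) \<le> U X ?Y + (\<Sum>b\<in>B. B' * \<kappa> * y b * h \<delta> b)" for \<delta>
  proof -
    have "\<kappa> * (\<Sum>b\<in>B. (y b + h \<delta> b)\<^sup>2) = ?Y + 2 * (\<kappa> * (\<Sum>b\<in>B. y b * h \<delta> b)) + \<kappa> * (\<Sum>b\<in>B. (h \<delta> b)\<^sup>2)"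
      unfolding sum_sq_add by (simp add: algebra_simps)
    moreover have "(\<kappa> * (\<Sum>b\<in>B. y b * h \<delta> b))\<^sup>2 \<le> ?Y * (\<kappa> * (\<Sum>b\<in>B. (h \<delta> b)\<^sup>2))"
      using mult_left_mono[OF Cauchy_Schwarz_ineq_sum[of y "h \<delta>" B], of "\<kappa>\<^sup>2"]
      by (simp add: power_mult_distrib power2_eq_square[of \<kappa>] mult_ac)
    moreover have "\<kappa> * (\<Sum>b\<in>B. (h \<delta> b)\<^sup>2) \<le> \<gamma> * c"
      using mult_left_mono[OF h2, of \<kappa> \<delta>] k by (simp add: \<kappa>)
    moreover have "0 \<le> \<kappa> * (\<Sum>b\<in>B. (h \<delta> b)\<^sup>2)" using k by (simp add: sum_nonneg)
    ultimately have "U (X + c) (\<kappa> * (\<Sum>b\<in>B. (y b + h \<delta> b)\<^sup>2)) \<le> U X ?Y + B' * (\<kappa> * (\<Sum>b\<in>B. y b * h \<delta> b))"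
      using AB[of 0 c "\<kappa> * (\<Sum>b\<in>B. y b * h \<delta> b)" "\<kappa> * (\<Sum>b\<in>B. (h \<delta> b)\<^sup>2)"] X c by simp
    then show ?thesis by (simp add: sum_distrib_left mult_ac)
  qed
  have "(\<Sum>\<delta>\<in>UNIV. U (X + c) (\<kappa> * (\<Sum>b\<in>B. (y b + h \<delta> b)\<^sup>2)))
      \<le> (\<Sum>\<delta>\<in>(UNIV::('m\<Rightarrow>bool) set). U X ?Y + (\<Sum>b\<in>B. B' * \<kappa> * y b * h \<delta> b))"
    by (intro sum_mono pt)
  also have "\<dots> = 2 ^ CARD('m) * U X ?Y + (\<Sum>\<delta>\<in>UNIV. \<Sum>b\<in>B. B' * \<kappa> * y b * h \<delta> b)"
    by (simp add: sum.distrib card_fun)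
  also have "(\<Sum>\<delta>\<in>UNIV. \<Sum>b\<in>B. B' * \<kappa> * y b * h \<delta> b) = (\<Sum>b\<in>B. B' * \<kappa> * y b * (\<Sum>\<delta>\<in>UNIV. h \<delta> b))"
    by (subst sum.swap) (simp only: sum_distrib_left)
  also have "\<dots> = 0"
  proof -
    have "(\<Sum>\<delta>\<in>UNIV. h \<delta> b) = 0" for b
      unfolding h_def by (subst sum.swap) (simp add: sum_distrib_left[symmetric] sum_walsh)
    then show ?thesis by simp
  qed
  finally show ?thesis by (simp add: c_def h_def)
qed

lemma sum_powr_le:
  fixes s :: "'e \<Rightarrow> real"
  assumes "finite E" "\<And>e. e \<in> E \<Longrightarrow> 0 \<le> s e" "0 < q"
  shows "(\<Sum>e\<in>E. s e) powr q \<le> real (card E) powr q * (\<Sum>e\<in>E. s e powr q)"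
proof (cases "E = {}")
  case False
  define M where "M = Max (s ` E)"
  have "M \<in> s ` E" unfolding M_def using assms False by (intro Max_in) auto
  then obtain e where e: "e \<in> E" "M = s e" by blast
  have "(\<Sum>e\<in>E. s e) \<le> real (card E) * M"
    using assms by (intro sum_bounded_above) (auto simp: M_def)
  then have "(\<Sum>e\<in>E. s e) powr q \<le> (real (card E) * M) powr q"
    using assms by (intro powr_mono2) (auto intro: sum_nonneg)
  also have "\<dots> = real (card E) powr q * s e powr q" using e assms by (simp add: powr_mult)
  also have "\<dots> \<le> real (card E) powr q * (\<Sum>e\<in>E. s e powr q)"
    using e assms by (intro mult_left_mono member_le_sum) auto
  finally show ?thesis .
qed simp

definition comparable :: "'a::{times,ord} \<Rightarrow> 'a \<Rightarrow> 'a \<Rightarrow> bool" where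
  "comparable C x y \<longleftrightarrow> x \<le> C * y \<and> y \<le> C * x"

lemma comparable_sum:
  fixes f g :: "'i \<Rightarrow> real"
  assumes "\<And>i. i \<in> I \<Longrightarrow> comparable C (f i) (g i)"
  shows "comparable C (\<Sum>i\<in>I. f i) (\<Sum>i\<in>I. g i)"
  using assms unfolding comparable_def sum_distrib_left by (auto intro: sum_mono)

lemma comparable_trans:
  fixes x y z :: real
  assumes "comparable C x y" "comparable C' y z" "0 < C" "0 < C'"
  shows "comparable (C * C') x z"
  using assms order_trans[OF _ mult_left_mono, of x C y "C' * z"] order_trans[OF _ mult_left_mono, of z C' y "C * x"]
  by (simp add: comparable_def mult_ac)

theorem haar_sum_square_equiv:
  assumes p: "1 < p"
  obtains C where "0 < C"
    "\<And>(B :: 'b set) (a :: 'b \<Rightarrow> nat \<Rightarrow> ('m::finite \<Rightarrow> int) \<Rightarrow> ('m \<Rightarrow> bool) \<Rightarrow> real) D n. comparable C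
      (\<Sum>u\<in>descendants D n. square_sum haar_indices B a D u powr (p/2))
      (\<Sum>u\<in>descendants D n. (\<Sum>b\<in>B. (haar_sum (a b) D u)\<^sup>2) powr (p/2))"
proof -
  define q where "q = p / 2"
  have q: "0 < q" using p by (simp add: q_def)
  obtain \<gamma> K where g: "0 < \<gamma>" and K: "0 < K" and ex: "\<And>\<epsilon>. 0 < \<epsilon> \<Longrightarrow> \<exists>U. bellman_fun q \<gamma> K \<epsilon> U"
    using bellman_fun_exists[OF p] unfolding q_def by metis
  define N where "N = real (card (haar_indices :: ('m \<Rightarrow> bool) set))"
  define \<kappa> where "\<kappa> = \<gamma> / 2 ^ CARD('m)"
  have k: "0 < \<kappa>" using g by (simp add: \<kappa>_def)
  define C1 where "C1 = N powr q * (N * (K / \<gamma> powr q))"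
  define C2 where "C2 = K / \<kappa> powr q"
  have up1: "(\<Sum>u\<in>descendants D n. square_sum {e0} B a D u powr q)
        \<le> K / \<gamma> powr q * (\<Sum>u\<in>descendants D n. (\<Sum>b\<in>B. (haar_sum (a b) D u)\<^sup>2) powr q)"
    if e0: "e0 \<in> haar_indices" for B :: "'b set" and a :: "'b \<Rightarrow> nat \<Rightarrow> ('m \<Rightarrow> int) \<Rightarrow> ('m \<Rightarrow> bool) \<Rightarrow> real" and D n e0
  proof -
    have "(\<Sum>u\<in>descendants D n. (\<gamma> * square_sum {e0} B a D u) powr q)
        \<le> K * (\<Sum>u\<in>descendants D n. (\<Sum>b\<in>B. (haar_sum (a b) D u)\<^sup>2) powr q)"
    proof (rule bellman_transfer[OF q K ex])
      fix \<epsilon> U d n assume U: "bellman_fun q \<gamma> K \<epsilon> U"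
      show "(\<Sum>\<delta>\<in>UNIV. U (\<Sum>b\<in>B. (haar_sum (a b) (Suc d) (child n \<delta>))\<^sup>2) (\<gamma> * square_sum {e0} B a (Suc d) (child n \<delta>)))
        \<le> 2 ^ CARD('m) * U (\<Sum>b\<in>B. (haar_sum (a b) d n)\<^sup>2) (\<gamma> * square_sum {e0} B a d n)"
        using haar_step_upper[OF U g e0, where x = "\<lambda>b. haar_sum (a b) d n" and a = "\<lambda>b. a b d n"
            and Y = "\<gamma> * square_sum {e0} B a d n" and B = B] g
        by (simp add: haar_sum_child square_sum_child square_sum_nonneg distrib_left)
    qed (use g in \<open>auto intro!: sum_nonneg mult_nonneg_nonneg square_sum_nonneg\<close>)
    also have "(\<Sum>u\<in>descendants D n. (\<gamma> * square_sum {e0} B a D u) powr q)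
        = \<gamma> powr q * (\<Sum>u\<in>descendants D n. square_sum {e0} B a D u powr q)"
      using g square_sum_nonneg by (simp add: powr_mult sum_distrib_left)
    finally show ?thesis using g by (simp add: field_simps)
  qed
  have up: "(\<Sum>u\<in>descendants D n. square_sum haar_indices B a D u powr q)
        \<le> C1 * (\<Sum>u\<in>descendants D n. (\<Sum>b\<in>B. (haar_sum (a b) D u)\<^sup>2) powr q)"
    for B :: "'b set" and a :: "'b \<Rightarrow> nat \<Rightarrow> ('m \<Rightarrow> int) \<Rightarrow> ('m \<Rightarrow> bool) \<Rightarrow> real" and D n
  proof -
    let ?R = "\<Sum>u\<in>descendants D n. (\<Sum>b\<in>B. (haar_sum (a b) D u)\<^sup>2) powr q"
    have sp: "square_sum haar_indices B a D u = (\<Sum>e\<in>haar_indices. square_sum {e} B a D u)" for u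
      unfolding square_sum_def by (subst (2) sum.swap) simp
    have "(\<Sum>u\<in>descendants D n. square_sum haar_indices B a D u powr q)
       \<le> (\<Sum>u\<in>descendants D n. N powr q * (\<Sum>e\<in>haar_indices. square_sum {e} B a D u powr q))"
      unfolding sp N_def using q square_sum_nonneg
      by (intro sum_mono sum_powr_le) (auto simp: haar_indices_def)
    also have "\<dots> = N powr q * (\<Sum>e\<in>haar_indices. \<Sum>u\<in>descendants D n. square_sum {e} B a D u powr q)"
      by (subst sum.swap) (simp add: sum_distrib_left)
    also have "\<dots> \<le> N powr q * (\<Sum>e\<in>(haar_indices :: ('m \<Rightarrow> bool) set). K / \<gamma> powr q * ?R)"
      by (intro mult_left_mono sum_mono up1) auto
    also have "\<dots> = C1 * ?R" by (simp add: C1_def N_def)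
    finally show ?thesis .
  qed
  have low: "(\<Sum>u\<in>descendants D n. (\<Sum>b\<in>B. (haar_sum (a b) D u)\<^sup>2) powr q)
        \<le> C2 * (\<Sum>u\<in>descendants D n. square_sum haar_indices B a D u powr q)"
    for B :: "'b set" and a :: "'b \<Rightarrow> nat \<Rightarrow> ('m \<Rightarrow> int) \<Rightarrow> ('m \<Rightarrow> bool) \<Rightarrow> real" and D n
  proof -
    have "(\<Sum>u\<in>descendants D n. (\<kappa> * (\<Sum>b\<in>B. (haar_sum (a b) D u)\<^sup>2)) powr q)
        \<le> K * (\<Sum>u\<in>descendants D n. square_sum haar_indices B a D u powr q)"
    proof (rule bellman_transfer[OF q K ex])
      fix \<epsilon> U d n assume U: "bellman_fun q \<gamma> K \<epsilon> U"
      show "(\<Sum>\<delta>\<in>UNIV. U (square_sum haar_indices B a (Suc d) (child n \<delta>)) (\<kappa> * (\<Sum>b\<in>B. (haar_sum (a b) (Suc d) (child n \<delta>))\<^sup>2)))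
        \<le> 2 ^ CARD('m) * U (square_sum haar_indices B a d n) (\<kappa> * (\<Sum>b\<in>B. (haar_sum (a b) d n)\<^sup>2))"
        using haar_step_lower[OF U g square_sum_nonneg \<kappa>_def, where y = "\<lambda>b. haar_sum (a b) d n" and a = "\<lambda>b. a b d n"]
        by (simp add: haar_sum_child square_sum_child)
    qed (use k in \<open>auto intro!: sum_nonneg mult_nonneg_nonneg square_sum_nonneg\<close>)
    also have "(\<Sum>u\<in>descendants D n. (\<kappa> * (\<Sum>b\<in>B. (haar_sum (a b) D u)\<^sup>2)) powr q)
        = \<kappa> powr q * (\<Sum>u\<in>descendants D n. (\<Sum>b\<in>B. (haar_sum (a b) D u)\<^sup>2) powr q)"
      unfolding sum_distrib_left[of "\<kappa> powr q"]
      using k by (intro sum.cong refl powr_mult)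
    finally show ?thesis using k by (simp add: C2_def field_simps)
  qed
  define C where "C = max C1 C2"
  have C: "0 < C" using K k by (simp add: C_def C2_def less_max_iff_disj)
  have mono: "X \<le> C1 * s \<Longrightarrow> 0 \<le> s \<Longrightarrow> X \<le> C * s" "X \<le> C2 * s \<Longrightarrow> 0 \<le> s \<Longrightarrow> X \<le> C * s" for X s
    by (erule order_trans, intro mult_right_mono, auto simp: C_def)+
  show thesis
  proof (rule that[OF C], unfold comparable_def q_def[symmetric], intro conjI)
    fix B :: "'b set" and a :: "'b \<Rightarrow> nat \<Rightarrow> ('m \<Rightarrow> int) \<Rightarrow> ('m \<Rightarrow> bool) \<Rightarrow> real" and D n
    show "(\<Sum>u\<in>descendants D n. square_sum haar_indices B a D u powr q)
        \<le> C * (\<Sum>u\<in>descendants D n. (\<Sum>b\<in>B. (haar_sum (a b) D u)\<^sup>2) powr q)"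
      by (rule mono(1)[OF up]) (simp add: sum_nonneg)
    show "(\<Sum>u\<in>descendants D n. (\<Sum>b\<in>B. (haar_sum (a b) D u)\<^sup>2) powr q)
        \<le> C * (\<Sum>u\<in>descendants D n. square_sum haar_indices B a D u powr q)"
      by (rule mono(2)[OF low]) (simp add: sum_nonneg)
  qed
qed

section \<open>Two-parameter square function estimates for finite Haar sums\<close>

text \<open>The truth value selects the real or the imaginary part of the coefficient.\<close>

type_synonym 'm coeffs =
  "bool \<Rightarrow> nat \<Rightarrow> ('m \<Rightarrow> int) \<Rightarrow> ('m \<Rightarrow> bool) \<Rightarrow> nat \<Rightarrow> ('m \<Rightarrow> int) \<Rightarrow> ('m \<Rightarrow> bool) \<Rightarrow> real"

definition haar_sum2 :: "'m::finite coeffs \<Rightarrow> nat \<Rightarrow> bool \<Rightarrow> ('m \<Rightarrow> int) \<Rightarrow> ('m \<Rightarrow> int) \<Rightarrow> real" where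
  "haar_sum2 a D c u v = haar_sum (\<lambda>d n e. haar_sum (a c d n e) D v) D u"

definition square_sum2 :: "'m::finite coeffs \<Rightarrow> nat \<Rightarrow> ('m \<Rightarrow> int) \<Rightarrow> ('m \<Rightarrow> int) \<Rightarrow> real" where
  "square_sum2 a D u v = (\<Sum>d<D. \<Sum>d'<D. \<Sum>e\<in>haar_indices. \<Sum>e'\<in>haar_indices. \<Sum>c\<in>UNIV.
      (a c d (ancestor (D - d) u) e d' (ancestor (D - d') v) e')\<^sup>2)"

text \<open>The square function in the first variable only, \<open>mid\<close> below, is comparable to the sum when the second
  variable is fixed. When the first variable is fixed instead, it is the norm of a Haar sum in the
  second variable whose values are indexed by \<open>B D\<close>.\<close>

theorem haar_sum2_square_equiv:
  assumes p: "1 < p"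
  obtains C where "0 < C"
    "\<And>(a :: 'm::finite coeffs) D n n'. comparable C
      (\<Sum>u\<in>descendants D n. \<Sum>v\<in>descendants D n'. square_sum2 a D u v powr (p/2))
      (\<Sum>u\<in>descendants D n. \<Sum>v\<in>descendants D n'. (\<Sum>c\<in>UNIV. (haar_sum2 a D c u v)\<^sup>2) powr (p/2))"
proof -
  obtain C1 where C1: "0 < C1"
    "\<And>(B :: bool set) (a :: _ \<Rightarrow> nat \<Rightarrow> ('m \<Rightarrow> int) \<Rightarrow> ('m \<Rightarrow> bool) \<Rightarrow> real) D n. comparable C1
      (\<Sum>u\<in>descendants D n. square_sum haar_indices B a D u powr (p/2))
      (\<Sum>u\<in>descendants D n. (\<Sum>b\<in>B. (haar_sum (a b) D u)\<^sup>2) powr (p/2))"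
    using haar_sum_square_equiv[OF p, where 'b = bool and 'm = 'm] by blast
  obtain C2 where C2: "0 < C2"
    "\<And>(B :: (nat \<times> ('m \<Rightarrow> bool) \<times> bool) set) (a :: _ \<Rightarrow> nat \<Rightarrow> ('m \<Rightarrow> int) \<Rightarrow> ('m \<Rightarrow> bool) \<Rightarrow> real) D n. comparable C2
      (\<Sum>u\<in>descendants D n. square_sum haar_indices B a D u powr (p/2))
      (\<Sum>u\<in>descendants D n. (\<Sum>b\<in>B. (haar_sum (a b) D u)\<^sup>2) powr (p/2))"
    using haar_sum_square_equiv[OF p, where 'b = "nat \<times> ('m \<Rightarrow> bool) \<times> bool" and 'm = 'm] by blast
  define mid where "mid = (\<lambda>(a :: 'm coeffs) D u v.
      square_sum haar_indices UNIV (\<lambda>c d n e. haar_sum (a c d n e) D v) D u)"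
  define B where "B = (\<lambda>D :: nat. {..<D} \<times> (haar_indices :: ('m \<Rightarrow> bool) set) \<times> (UNIV :: bool set))"
  define b where "b = (\<lambda>(a :: 'm coeffs) D u. \<lambda>(d, e, c). a c d (ancestor (D - d) u) e)"
  have mid_eq: "mid a D u v = (\<Sum>i\<in>B D. (haar_sum (b a D u i) D v)\<^sup>2)" for a D u v
    by (simp add: mid_def square_sum_def B_def b_def sum.cartesian_product case_prod_unfold)
  have sq_eq: "square_sum2 a D u v = square_sum haar_indices (B D) (b a D u) D v" for a D u v
  proof -
    have "square_sum haar_indices (B D) (b a D u) D v
        = (\<Sum>d'<D. \<Sum>e'\<in>haar_indices. \<Sum>d<D. \<Sum>e\<in>haar_indices. \<Sum>c\<in>UNIV.
            (a c d (ancestor (D - d) u) e d' (ancestor (D - d') v) e')\<^sup>2)"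
      by (simp add: square_sum_def B_def b_def sum.cartesian_product case_prod_unfold)
    also have "\<dots> = (\<Sum>d'<D. \<Sum>d<D. \<Sum>e'\<in>haar_indices. \<Sum>e\<in>haar_indices. \<Sum>c\<in>UNIV.
            (a c d (ancestor (D - d) u) e d' (ancestor (D - d') v) e')\<^sup>2)"
      by (intro sum.cong refl sum.swap)
    also have "\<dots> = (\<Sum>d'<D. \<Sum>d<D. \<Sum>e\<in>haar_indices. \<Sum>e'\<in>haar_indices. \<Sum>c\<in>UNIV.
            (a c d (ancestor (D - d) u) e d' (ancestor (D - d') v) e')\<^sup>2)"
      by (intro sum.cong refl sum.swap)
    also have "\<dots> = square_sum2 a D u v"
      unfolding square_sum2_def by (rule sum.swap)
    finally show ?thesis ..
  qed
  show thesis
  proof (rule that)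
    show "0 < C2 * C1" using C1(1) C2(1) by simp
    fix a :: "'m coeffs" and D n n'
    have 1: "comparable C2 (\<Sum>u\<in>descendants D n. \<Sum>v\<in>descendants D n'. square_sum2 a D u v powr (p/2))
        (\<Sum>u\<in>descendants D n. \<Sum>v\<in>descendants D n'. mid a D u v powr (p/2))"
      unfolding mid_eq sq_eq by (intro comparable_sum C2(2))
    have 2: "comparable C1 (\<Sum>u\<in>descendants D n. \<Sum>v\<in>descendants D n'. mid a D u v powr (p/2))
        (\<Sum>u\<in>descendants D n. \<Sum>v\<in>descendants D n'. (\<Sum>c\<in>UNIV. (haar_sum2 a D c u v)\<^sup>2) powr (p/2))"
      unfolding sum.swap[of _ "descendants D n'" "descendants D n"] mid_def haar_sum2_def
      by (intro comparable_sum C1(2))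
    show "comparable (C2 * C1) (\<Sum>u\<in>descendants D n. \<Sum>v\<in>descendants D n'. square_sum2 a D u v powr (p/2))
        (\<Sum>u\<in>descendants D n. \<Sum>v\<in>descendants D n'. (\<Sum>c\<in>UNIV. (haar_sum2 a D c u v)\<^sup>2) powr (p/2))"
      by (rule comparable_trans[OF 1 2 C2(1) C1(1)])
  qed
qed

section \<open>Dyadic cubes and their Haar functions\<close>

definition cube_index :: "int \<Rightarrow> real ^ 'm \<Rightarrow> 'm::finite \<Rightarrow> int" where
  "cube_index k x = (\<lambda>i. \<lfloor>x $ i / 2 powi k\<rfloor>)"

definition cube :: "int \<Rightarrow> ('m::finite \<Rightarrow> int) \<Rightarrow> (real ^ 'm) set" where
  "cube k n = {x. cube_index k x = n}"

lemma powi_pos [simp]: "0 < (2::real) powi k"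
  by (simp add: zero_less_power_int)

lemma mem_cube_iff:
  "x \<in> cube k n \<longleftrightarrow> (\<forall>i. x $ i \<in> {of_int (n i) * 2 powi k ..< (of_int (n i) + 1) * 2 powi k})"
  by (auto simp: cube_def cube_index_def fun_eq_iff floor_eq_iff pos_le_divide_eq pos_divide_less_eq)

lemma dyadic_cubes_eq: "dyadic_cubes = {cube k n | k (n :: 'm::finite \<Rightarrow> int). True}"
proof (intro set_eqI iffI)
  fix Q :: "(real ^ 'm) set" assume "Q \<in> dyadic_cubes"
  then obtain K k where Q: "Q = {x. \<forall>i. x $ i \<in> K i}" and "\<And>i. K i \<in> dyadic_intervals_of_level k"
    by (auto simp: dyadic_cubes_def)
  then have "\<forall>i. \<exists>n. K i = {of_int n * 2 powi k ..< (of_int n + 1) * 2 powi k}"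
    by (auto simp: dyadic_intervals_of_level_def)
  then obtain n where "\<And>i. K i = {of_int (n i) * 2 powi k ..< (of_int (n i) + 1) * 2 powi k}"
    by metis
  then have "Q = cube k n" by (simp add: set_eq_iff mem_cube_iff Q)
  then show "Q \<in> {cube k n | k (n :: 'm::finite \<Rightarrow> int). True}" by blast
next
  fix Q :: "(real ^ 'm) set" assume "Q \<in> {cube k n | k (n :: 'm::finite \<Rightarrow> int). True}"
  then obtain k n where Q: "Q = cube k n" by blast
  show "Q \<in> dyadic_cubes" unfolding dyadic_cubes_def mem_Collect_eq
  proof (intro exI conjI allI)
    show "Q = {x. \<forall>i. x $ i \<in> {of_int (n i) * 2 powi k ..< (of_int (n i) + 1) * 2 powi k}}"
      by (simp only: set_eq_iff mem_cube_iff Q mem_Collect_eq) simp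
    show "{of_int (n i) * 2 powi k ..< (of_int (n i) + 1) * 2 powi k} \<in> dyadic_intervals_of_level k" for i
      by (auto simp: dyadic_intervals_of_level_def)
  qed
qed

lemma cube_proj:
  "(\<lambda>y. y $ i) ` cube k n = {of_int (n i) * 2 powi k ..< (of_int (n i) + 1) * 2 powi k}"
proof (intro equalityI subsetI)
  fix t assume t: "t \<in> {real_of_int (n i) * 2 powi k ..< (of_int (n i) + 1) * 2 powi k}"
  define y :: "real ^ 'a" where "y = (\<chi> j. if j = i then t else of_int (n j) * 2 powi k)"
  have "y \<in> cube k n" using t by (auto simp: mem_cube_iff y_def)
  moreover have "t = y $ i" by (simp add: y_def)
  ultimately show "t \<in> (\<lambda>y. y $ i) ` cube k n" by blast
qed (auto simp: mem_cube_iff)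

lemma cube_nonempty: "cube k n \<noteq> {}"
  using cube_proj[of undefined k n] by (auto simp: distrib_right)

lemma cube_inj:
  assumes "cube k n = cube k' n'"
  shows "k = k' \<and> n = n'"
proof -
  have eq: "{real_of_int (n i) * 2 powi k ..< (of_int (n i) + 1) * 2 powi k}
     = {real_of_int (n' i) * 2 powi k' ..< (of_int (n' i) + 1) * 2 powi k'}" for i
    using assms cube_proj[of i k n] cube_proj[of i k' n'] by simp
  have "real_of_int (n i) * 2 powi k < (of_int (n i) + 1) * 2 powi k"
    "real_of_int (n' i) * 2 powi k' < (of_int (n' i) + 1) * 2 powi k'" for i
    by (auto simp: distrib_right)
  with eq have e: "real_of_int (n i) * 2 powi k = real_of_int (n' i) * 2 powi k'"
    "(real_of_int (n i) + 1) * 2 powi k = (real_of_int (n' i) + 1) * 2 powi k'" for i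
    by (metis atLeastLessThan_inj)+
  from e[of undefined] have p: "(2::real) powi k = 2 powi k'" by (simp add: distrib_right)
  then have "k = k'"
    using power_int_strict_increasing[of k k' "2::real"] power_int_strict_increasing[of k' k "2::real"]
    by (cases k k' rule: linorder_cases) auto
  moreover have "n i = n' i" for i using e(1)[of i] \<open>k = k'\<close> by simp
  ultimately show ?thesis by auto
qed

lemma mem_cube_index: "x \<in> cube k (cube_index k x)"
  by (simp add: cube_def)

lemma cube_index_ancestor: "cube_index (k + int j) x = ancestor j (cube_index k x)"
proof (rule ext)
  fix i
  have "x $ i / 2 powi (k + int j) = (x $ i / 2 powi k) / of_int (2 ^ j)"
    by (simp add: power_int_add)
  moreover have "\<lfloor>(x $ i / 2 powi k) / of_int (2 ^ j)\<rfloor> = \<lfloor>x $ i / 2 powi k\<rfloor> div 2 ^ j"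
    by (rule floor_divide_real_eq_div) simp
  ultimately show "cube_index (k + int j) x i = ancestor j (cube_index k x) i"
    by (simp only: cube_index_def ancestor_def)
qed

text \<open>The parity of the index at the next finer level tells the right half from the left one.\<close>

lemma haar1_dyadic:
  fixes n k :: int
  defines "K \<equiv> {of_int n * 2 powi k ..< (of_int n + 1) * 2 powi k}"
  shows "haar1 b K t = (if t \<in> K then (if b \<and> odd \<lfloor>t / 2 powi (k - 1)\<rfloor> then - 1 else 1) else 0) / sqrt (2 powi k)"
proof -
  define w :: real where "w = 2 powi (k - 1)"
  have w: "w > 0" "2 powi k = 2 * w" by (auto simp: w_def power_int_diff)
  have K: "K = {of_int n * (2 * w) ..< (of_int n + 1) * (2 * w)}" by (simp add: K_def w)
  have lt: "of_int n * (2 * w) < (of_int n + 1) * (2 * w)" using w(1) by (simp add: distrib_right)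
  have mid: "(Inf K + Sup K) / 2 = (2 * of_int n + 1) * w"
    unfolding K cInf_atLeastLessThan[OF lt] cSup_atLeastLessThan[OF lt] by (simp add: algebra_simps)
  have meas: "measure lborel K = 2 * w"
    using lt unfolding K by (simp add: distrib_right)
  have "odd \<lfloor>t / w\<rfloor> \<longleftrightarrow> (2 * of_int n + 1) * w \<le> t" if "t \<in> K"
  proof (cases "(2 * of_int n + 1) * w \<le> t")
    case True
    then have "\<lfloor>t / w\<rfloor> = 2 * n + 1" using that w(1) unfolding K
      by (intro floor_unique) (auto simp: field_simps)
    then show ?thesis using True by simp
  next
    case False
    then have "\<lfloor>t / w\<rfloor> = 2 * n" using that w(1) unfolding K
      by (intro floor_unique) (auto simp: field_simps)
    then show ?thesis using False by simp
  qed
  then show ?thesis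
    unfolding haar1_def left_half_def right_half_def mid meas w(2) w_def[symmetric]
    by (auto simp: indicator_def)
qed

lemma haar_cube:
  fixes x :: "real ^ 'm::finite"
  shows "haar e (cube k n) x =
    indicator (cube k n) x * (walsh e (bits (cube_index (k - 1) x)) / sqrt ((2 powi k) ^ CARD('m)))"
proof (cases "x \<in> cube k n")
  case True
  then have "haar e (cube k n) x = (\<Prod>i\<in>UNIV. (if e i \<and> odd \<lfloor>x $ i / 2 powi (k - 1)\<rfloor> then - 1 else 1) / sqrt (2 powi k))"
    unfolding haar_def cube_proj haar1_dyadic by (intro prod.cong refl) (auto simp: mem_cube_iff)
  also have "\<dots> = walsh e (bits (cube_index (k - 1) x)) / sqrt ((2 powi k) ^ CARD('m))"
    unfolding prod_dividef walsh_def bits_def cube_index_def by (simp add: real_sqrt_power)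
  finally show ?thesis using True by simp
next
  case False
  then obtain i where "x $ i \<notin> {real_of_int (n i) * 2 powi k..<(real_of_int (n i) + 1) * 2 powi k}"
    by (auto simp: mem_cube_iff)
  then have "haar e (cube k n) x = 0"
    unfolding haar_def cube_proj haar1_dyadic by (intro prod_zero) (auto intro!: bexI[of _ i])
  then show ?thesis using False by simp
qed

lemma cube_borel [measurable]: "cube k n \<in> sets borel"
proof -
  have "cube k n = (\<Inter>i. (\<lambda>x. x $ i) -` {real_of_int (n i) * 2 powi k..<(real_of_int (n i) + 1) * 2 powi k} \<inter> space borel)"
    by (auto simp: mem_cube_iff)
  also have "\<dots> \<in> sets borel"
    by (intro sets.countable_INT'' measurable_sets[OF borel_measurable_continuous_onI]) (auto intro!: continuous_intros)
  finally show ?thesis .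
qed

text \<open>A half-open cube lies between an open and a closed box with the same volume.\<close>

lemma emeasure_cube:
  "emeasure lborel (cube k (n :: 'm::finite \<Rightarrow> int)) = ennreal ((2 powi k) ^ CARD('m))"
proof -
  define l u :: "real ^ 'm" where "l = (\<chi> i. of_int (n i) * 2 powi k)" and "u = (\<chi> i. (of_int (n i) + 1) * 2 powi k)"
  have comp: "(u - l) \<bullet> b = 2 powi k" "l \<bullet> b \<le> u \<bullet> b" if "b \<in> Basis" for b
    using that by (auto simp: Basis_vec_def inner_axis l_def u_def algebra_simps)
  have pr: "(\<Prod>b\<in>Basis. (u - l) \<bullet> b) = (2 powi k) ^ CARD('m)"
    using comp by simp
  have sub: "box l u \<subseteq> cube k n" "cube k n \<subseteq> cbox l u"
    by (auto simp: mem_cube_iff mem_box_cart l_def u_def less_imp_le)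
  have "emeasure lborel (box l u) = ennreal ((2 powi k) ^ CARD('m))"
    using comp pr by (subst emeasure_lborel_box) auto
  moreover have "emeasure lborel (cbox l u) = ennreal ((2 powi k) ^ CARD('m))"
    using comp pr by (subst emeasure_lborel_cbox) auto
  ultimately show ?thesis
    using emeasure_mono[OF sub(1), of lborel] emeasure_mono[OF sub(2), of lborel]
    by (intro antisym) (auto simp: sets_lborel)
qed

lemma cube_index_measurable [measurable]: "cube_index k \<in> measurable borel (count_space UNIV)"
proof (rule measurableI)
  fix A :: "('a \<Rightarrow> int) set"
  have "cube_index k -` A \<inter> space borel = (\<Union>n\<in>A. cube k n)" by (auto simp: cube_def)
  also have "\<dots> \<in> sets borel" by (intro sets.countable_UN'' countableI_type) auto
  finally show "cube_index k -` A \<inter> space borel \<in> sets borel" .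
qed simp

section \<open>The reproducing kernel of the Haar functions of one cube\<close>

text \<open>Walsh functions are symmetric in index and child, so the orthogonality of rows is one of columns. The
  constant Walsh function does not belong to \<^const>\<open>haar_indices\<close>, whence the \<open>- 1\<close>.\<close>

lemma sum_walsh_dual:
  fixes \<delta> \<delta>' :: "'m::finite \<Rightarrow> bool"
  shows "(\<Sum>e\<in>haar_indices. walsh e \<delta> * walsh e \<delta>') = (if \<delta> = \<delta>' then 2 ^ CARD('m) else 0) - 1"
proof -
  have sym: "walsh e \<delta> = walsh \<delta> e" for e \<delta> :: "'m \<Rightarrow> bool"
    unfolding walsh_def by (intro prod.cong) auto
  have "(\<Sum>e\<in>UNIV. walsh e \<delta> * walsh e \<delta>') = (if \<delta> = \<delta>' then 2 ^ CARD('m) else 0)"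
    unfolding sym[of _ \<delta>] sym[of _ \<delta>']
    using sum_walsh_mult[of \<delta> \<delta>'] walsh_sq[of \<delta>'] by (auto simp: power2_eq_square card_fun)
  moreover have "walsh (\<lambda>_. False) \<delta> = 1" for \<delta> :: "'m \<Rightarrow> bool"
    by (simp add: walsh_def)
  ultimately show ?thesis
    unfolding haar_indices_def by (subst sum_diff) auto
qed

definition averaging_kernel :: "int \<Rightarrow> real ^ 'm::finite \<Rightarrow> real ^ 'm \<Rightarrow> real" where
  "averaging_kernel k x y = indicator (cube k (cube_index k x)) y / (2 powi k) ^ CARD('m)"

text \<open>The Haar functions of a cube are an orthonormal basis of the functions that are constant on the children
  and have mean zero.\<close>

lemma haar_kernel:
  fixes x y :: "real ^ 'm::finite"
  shows "(\<Sum>e\<in>haar_indices. haar e (cube k (cube_index k x)) x * haar e (cube k (cube_index k x)) y)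
    = averaging_kernel (k - 1) x y - averaging_kernel k x y"
proof -
  let ?V = "((2::real) powi k) ^ CARD('m)"
  let ?V1 = "((2::real) powi (k - 1)) ^ CARD('m)"
  have V: "?V = 2 ^ CARD('m) * ?V1" "?V > 0" "?V1 > 0"
    by (auto simp: power_int_diff power_divide)
  have up: "cube_index k z = ancestor 1 (cube_index (k - 1) z)" for z :: "real ^ 'm"
    using cube_index_ancestor[of "k - 1" 1 z] by simp
  have idx: "cube_index (k - 1) y = cube_index (k - 1) x \<longleftrightarrow> cube_index k y = cube_index k x \<and>
      bits (cube_index (k - 1) x) = bits (cube_index (k - 1) y)"
    by (metis up child_ancestor)
  have "(\<Sum>e\<in>haar_indices. haar e (cube k (cube_index k x)) x * haar e (cube k (cube_index k x)) y)
    = (\<Sum>e\<in>haar_indices. indicator (cube k (cube_index k x)) y / ?V *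
        (walsh e (bits (cube_index (k - 1) x)) * walsh e (bits (cube_index (k - 1) y))))"
    unfolding haar_cube using V by (intro sum.cong refl) (simp add: mem_cube_index field_simps)
  also have "\<dots> = indicator (cube k (cube_index k x)) y / ?V *
     ((if bits (cube_index (k - 1) x) = bits (cube_index (k - 1) y) then 2 ^ CARD('m) else 0) - 1)"
    unfolding sum_distrib_left[symmetric] sum_walsh_dual ..
  also have "\<dots> = averaging_kernel (k - 1) x y - averaging_kernel k x y"
    using idx V by (auto simp: averaging_kernel_def indicator_def cube_def field_simps)
  finally show ?thesis .
qed

lemma haar_kernel_telescope:
  fixes x y :: "real ^ 'm::finite"
  shows "(\<Sum>d<D. \<Sum>e\<in>haar_indices. haar e (cube (N - int d) (cube_index (N - int d) x)) x
            * haar e (cube (N - int d) (cube_index (N - int d) x)) y)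
    = averaging_kernel (N - int D) x y - averaging_kernel N x y"
proof -
  have "(\<Sum>d<D. averaging_kernel (N - int (Suc d)) x y - averaging_kernel (N - int d) x y)
      = averaging_kernel (N - int D) x y - averaging_kernel (N - int 0) x y"
    by (rule sum_lessThan_telescope)
  then show ?thesis unfolding haar_kernel by (simp add: algebra_simps)
qed

section \<open>Averages over dyadic rectangles\<close>

text \<open>The \<open>p\<close>-th power of the norm, unlike the norm itself, can be added up over the cells of a partition.\<close>

definition Lp_mass :: "real \<Rightarrow> ('a::euclidean_space \<Rightarrow> complex) \<Rightarrow> ennreal" where
  "Lp_mass p f = (\<integral>\<^sup>+ x. ennreal (cmod (f x) powr p) \<partial>lborel)"

type_synonym 'm bispace = "(real, 'm) vec \<times> (real, 'm) vec"

definition rect :: "int \<Rightarrow> int \<Rightarrow> ('m::finite \<Rightarrow> int) \<times> ('m \<Rightarrow> int) \<Rightarrow> ('m bispace) set" where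
  "rect k l i = cube k (fst i) \<times> cube l (snd i)"

definition rect_index :: "int \<Rightarrow> int \<Rightarrow> 'm::finite bispace \<Rightarrow> ('m \<Rightarrow> int) \<times> ('m \<Rightarrow> int)" where
  "rect_index k l x = (cube_index k (fst x), cube_index l (snd x))"

lemma mem_rect_iff: "x \<in> rect k l i \<longleftrightarrow> rect_index k l x = i"
  by (cases i; cases x) (auto simp: rect_def rect_index_def cube_def)

lemma rect_borel [measurable]: "rect k l i \<in> sets borel"
  unfolding rect_def by (intro borel_Times cube_borel)

lemma rect_index_measurable [measurable]:
  "rect_index k l \<in> measurable borel (count_space UNIV)"
proof (rule measurableI)
  fix A :: "(('a \<Rightarrow> int) \<times> ('a \<Rightarrow> int)) set"
  have "rect_index k l -` A \<inter> space borel = (\<Union>i\<in>A. rect k l i)" by (auto simp: mem_rect_iff)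
  also have "\<dots> \<in> sets borel" by (intro sets.countable_UN'' countableI_type) auto
  finally show "rect_index k l -` A \<inter> space borel \<in> sets borel" .
qed simp

text \<open>The type argument supplies the dimension, which the two levels do not determine.\<close>

definition rect_volume :: "'m::finite itself \<Rightarrow> int \<Rightarrow> int \<Rightarrow> real" where
  "rect_volume _ k l = (2 powi k) ^ CARD('m) * (2 powi l) ^ CARD('m)"

lemma rect_volume_pos [simp]: "0 < rect_volume TYPE('m::finite) k l"
  by (simp add: rect_volume_def)

lemma emeasure_rect: "emeasure lborel (rect k l (i :: ('m::finite \<Rightarrow> int) \<times> _)) = ennreal (rect_volume TYPE('m) k l)"
proof -
  have "emeasure (lborel \<Otimes>\<^sub>M lborel) (rect k l i) = emeasure lborel (cube k (fst i)) * emeasure lborel (cube l (snd i))"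
    unfolding rect_def by (rule lborel.emeasure_pair_measure_Times) auto
  then show ?thesis by (simp add: lborel_prod emeasure_cube rect_volume_def ennreal_mult)
qed

lemma measure_rect: "measure lborel (rect k l (i :: ('m::finite \<Rightarrow> int) \<times> _)) = rect_volume TYPE('m) k l"
  using less_imp_le[OF rect_volume_pos[where 'm = 'm, of k l]] by (simp add: measure_def emeasure_rect)

lemma nn_integral_rects:
  fixes G :: "'m::finite bispace \<Rightarrow> ennreal"
  assumes [measurable]: "G \<in> borel_measurable borel"
  shows "(\<integral>\<^sup>+ x. G x \<partial>lborel) = (\<integral>\<^sup>+ i. \<integral>\<^sup>+ x. G x * indicator (rect k l i) x \<partial>lborel \<partial>count_space UNIV)"
proof -
  have "G x = (\<integral>\<^sup>+ i. G x * indicator (rect k l i) x \<partial>count_space UNIV)" for x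
  proof -
    have "(\<integral>\<^sup>+ i. G x * indicator (rect k l i) x \<partial>count_space UNIV)
        = (\<integral>\<^sup>+ i. G x * indicator {rect_index k l x} i \<partial>count_space UNIV)"
      by (intro nn_integral_cong) (auto simp: indicator_def mem_rect_iff)
    also have "\<dots> = G x" by (simp add: nn_integral_cmult)
    finally show ?thesis ..
  qed
  then have "(\<integral>\<^sup>+ x. G x \<partial>lborel) = (\<integral>\<^sup>+ x. \<integral>\<^sup>+ i. G x * indicator (rect k l i) x \<partial>count_space UNIV \<partial>lborel)"
    by simp
  also have "\<dots> = (\<integral>\<^sup>+ i. \<integral>\<^sup>+ x. G x * indicator (rect k l i) x \<partial>lborel \<partial>count_space UNIV)"
    by (rule nn_integral_count_space_nn_integral) auto
  finally show ?thesis .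
qed

lemma nn_integral_le_rects:
  fixes G G' :: "'m::finite bispace \<Rightarrow> ennreal"
  assumes [measurable]: "G \<in> borel_measurable borel" "G' \<in> borel_measurable borel"
    and le: "\<And>i. (\<integral>\<^sup>+ x. G x * indicator (rect k l i) x \<partial>lborel)
                \<le> C * (\<integral>\<^sup>+ x. G' x * indicator (rect k l i) x \<partial>lborel)"
  shows "(\<integral>\<^sup>+ x. G x \<partial>lborel) \<le> C * (\<integral>\<^sup>+ x. G' x \<partial>lborel)"
  unfolding nn_integral_rects[where k = k and l = l, OF assms(1)] nn_integral_rects[where k = k and l = l, OF assms(2)]
  by (subst nn_integral_cmult[symmetric]) (auto intro!: nn_integral_mono le)

lemma le_one_plus_powr: "0 \<le> a \<Longrightarrow> 1 \<le> p \<Longrightarrow> a \<le> 1 + a powr p" for a p :: real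
proof (cases "a \<le> 1")
  case False
  assume "1 \<le> p"
  with False have "a powr 1 \<le> a powr p" by (intro powr_mono) auto
  then show ?thesis using False by simp
qed (use powr_ge_zero[of a p] in linarith)

lemma powr_above_tangent:
  fixes a s p :: real
  assumes "0 \<le> a" "0 < s" "1 \<le> p"
  shows "s powr p + p * s powr (p - 1) * (a - s) \<le> a powr p"
proof (cases "a = 0")
  case True
  have "p * s powr (p - 1) * s = p * s powr p" using assms by (simp add: powr_diff)
  moreover have "1 * s powr p \<le> p * s powr p" using assms by (intro mult_right_mono) auto
  ultimately show ?thesis using True assms by (simp add: algebra_simps)
next
  case False
  have "a powr p - s powr p \<ge> p * s powr (p - 1) * (a - s)"
  proof (rule convex_on_imp_above_tangent[where A = "{0<..}"])
    show "convex_on {0<..} (\<lambda>x. x powr p)" using assms by (intro powr_convex)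
    show "((\<lambda>x. x powr p) has_real_derivative p * s powr (p - 1)) (at s within {0<..})"
      using assms by (auto intro!: derivative_eq_intros)
  qed (use assms False in \<open>auto simp: interior_open\<close>)
  then show ?thesis by linarith
qed

lemma integrable_mult_bounded:
  fixes f :: "'a::euclidean_space \<Rightarrow> complex" and g :: "'a \<Rightarrow> real"
  assumes [measurable]: "f \<in> borel_measurable borel" "g \<in> borel_measurable borel" "A \<in> sets borel"
    and p: "1 \<le> p" and f: "Lp_mass p f < \<infinity>" and A: "emeasure lborel A < \<infinity>"
    and g: "\<And>x. \<bar>g x\<bar> \<le> M * indicator A x"
  shows "integrable lborel (\<lambda>x. f x * of_real (g x))"
proof (rule integrableI_bounded)
  have M: "0 \<le> M * indicator A x" for x using g[of x] by linarith
  have pt: "cmod (f x) * \<bar>g x\<bar> \<le> \<bar>M\<bar> * indicator A x + \<bar>M\<bar> * (cmod (f x) powr p)" for x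
  proof -
    have "cmod (f x) * \<bar>g x\<bar> \<le> (1 + cmod (f x) powr p) * (\<bar>M\<bar> * indicator A x)"
      using le_one_plus_powr[of "cmod (f x)" p] p g[of x]
      by (intro mult_mono) (auto simp: indicator_def split: if_splits)
    also have "\<dots> \<le> \<bar>M\<bar> * indicator A x + \<bar>M\<bar> * (cmod (f x) powr p)"
      by (auto simp: indicator_def algebra_simps)
    finally show ?thesis .
  qed
  have "(\<integral>\<^sup>+ x. ennreal (norm (f x * of_real (g x))) \<partial>lborel)
      \<le> (\<integral>\<^sup>+ x. ennreal \<bar>M\<bar> * indicator A x + ennreal \<bar>M\<bar> * ennreal (cmod (f x) powr p) \<partial>lborel)"
  proof (intro nn_integral_mono)
    fix x
    have "ennreal (norm (f x * of_real (g x))) \<le> ennreal (\<bar>M\<bar> * indicator A x + \<bar>M\<bar> * (cmod (f x) powr p))"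
      using pt[of x] by (intro ennreal_leI) (simp add: norm_mult)
    also have "\<dots> = ennreal \<bar>M\<bar> * indicator A x + ennreal \<bar>M\<bar> * ennreal (cmod (f x) powr p)"
      by (simp add: ennreal_mult ennreal_plus ennreal_indicator)
    finally show "ennreal (norm (f x * of_real (g x))) \<le> ennreal \<bar>M\<bar> * indicator A x + ennreal \<bar>M\<bar> * ennreal (cmod (f x) powr p)" .
  qed
  also have "\<dots> = ennreal \<bar>M\<bar> * emeasure lborel A + ennreal \<bar>M\<bar> * Lp_mass p f"
    unfolding Lp_mass_def by (subst nn_integral_add) (auto simp: nn_integral_cmult)
  also have "\<dots> < \<infinity>" using f A by (simp add: ennreal_mult_less_top)
  finally show "(\<integral>\<^sup>+ x. ennreal (norm (f x * of_real (g x))) \<partial>lborel) < \<infinity>" .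
qed measurable

definition dyadic_avg :: "int \<Rightarrow> int \<Rightarrow> ('m::finite bispace \<Rightarrow> complex)
    \<Rightarrow> 'm bispace \<Rightarrow> complex" where
  "dyadic_avg k l f x =
    (LINT y|lborel. f y * of_real (averaging_kernel k (fst x) (fst y) * averaging_kernel l (snd x) (snd y)))"

lemma averaging_kernel_prod:
  "averaging_kernel k (fst x) (fst y) * averaging_kernel l (snd x) (snd y)
    = indicator (rect k l (rect_index k l x)) y / rect_volume TYPE('m) k l"
  for x y :: "'m::finite bispace"
  by (cases y) (auto simp: averaging_kernel_def rect_def rect_index_def rect_volume_def indicator_def)

lemma dyadic_avg_measurable [measurable]: "dyadic_avg k l f \<in> borel_measurable borel"
proof -
  have "dyadic_avg k l f x = (\<lambda>i. LINT y|lborel. f y * of_real (indicator (rect k l i) y / rect_volume TYPE('a) k l)) (rect_index k l x)" for x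
    unfolding dyadic_avg_def averaging_kernel_prod ..
  then have "dyadic_avg k l f = (\<lambda>x. (\<lambda>i. LINT y|lborel. f y * of_real (indicator (rect k l i) y / rect_volume TYPE('a) k l)) (rect_index k l x))"
    by blast
  also have "\<dots> \<in> borel_measurable borel"
    by (rule measurable_compose[OF rect_index_measurable]) simp
  finally show ?thesis .
qed

text \<open>Jensen's inequality: integrate the tangent of \<open>a \<mapsto> a\<^sup>p\<close> at the mean value \<open>s\<close> of \<open>|f|\<close> over the
  rectangle.\<close>

lemma dyadic_avg_powr_le:
  fixes f :: "'m::finite bispace \<Rightarrow> complex"
  assumes f [measurable]: "f \<in> borel_measurable borel" and p: "1 \<le> p" and fin: "Lp_mass p f < \<infinity>"
  shows "ennreal (cmod (dyadic_avg k l f x) powr p) * ennreal (rect_volume TYPE('m) k l)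
    \<le> (\<integral>\<^sup>+ y. ennreal (cmod (f y) powr p) * indicator (rect k l (rect_index k l x)) y \<partial>lborel)"
proof -
  define Q where "Q = rect k l (rect_index k l x)"
  define v where "v = rect_volume TYPE('m) k l"
  have v: "v > 0" by (simp add: v_def)
  have Q [measurable]: "Q \<in> sets borel" by (simp add: Q_def)
  have eQ: "emeasure lborel Q = ennreal v" by (simp add: Q_def v_def emeasure_rect)
  have mQ: "measure lborel Q = v" by (simp add: Q_def v_def measure_rect)
  define s where "s = (LINT y|lborel. cmod (f y) * indicator Q y) / v"
  have "integrable lborel (\<lambda>y. f y * of_real (indicator Q y))"
    using fin eQ p by (intro integrable_mult_bounded[where A = Q and M = 1 and p = p]) auto
  from integrable_norm[OF this] have i1: "integrable lborel (\<lambda>y. cmod (f y) * indicator Q y)"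
    by (simp add: norm_mult)
  have i0: "integrable lborel (indicator Q :: _ \<Rightarrow> real)"
    using eQ by (intro integrable_real_indicator) auto
  have ip: "integrable lborel (\<lambda>y. cmod (f y) powr p * indicator Q y)"
  proof (rule integrableI_bounded)
    have "(\<integral>\<^sup>+ y. ennreal (norm (cmod (f y) powr p * indicator Q y)) \<partial>lborel) \<le> Lp_mass p f"
      unfolding Lp_mass_def by (intro nn_integral_mono) (auto simp: indicator_def)
    then show "(\<integral>\<^sup>+ y. ennreal (norm (cmod (f y) powr p * indicator Q y)) \<partial>lborel) < \<infinity>"
      using fin by (rule le_less_trans)
  qed measurable
  have s0: "0 \<le> s" using v unfolding s_def by (intro divide_nonneg_nonneg integral_nonneg_AE) auto
  have "cmod (dyadic_avg k l f x) \<le> (LINT y|lborel. norm (f y * of_real (indicator Q y / v)))"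
    unfolding dyadic_avg_def averaging_kernel_prod Q_def[symmetric] v_def[symmetric] by (rule integral_norm_bound)
  also have "\<dots> = (LINT y|lborel. (cmod (f y) * indicator Q y) / v)"
    using v by (intro Bochner_Integration.integral_cong) (auto simp: norm_mult norm_divide indicator_def)
  also have "\<dots> = s" by (simp add: s_def)
  finally have le: "cmod (dyadic_avg k l f x) powr p \<le> s powr p" using p by (intro powr_mono2) auto
  have "s powr p * v \<le> (LINT y|lborel. cmod (f y) powr p * indicator Q y)"
  proof (cases "s = 0")
    case False
    then have s: "s > 0" using s0 by simp
    have "(LINT y|lborel. (s powr p - p * s powr (p - 1) * s) * indicator Q y + p * s powr (p - 1) * (cmod (f y) * indicator Q y))
       \<le> (LINT y|lborel. cmod (f y) powr p * indicator Q y)"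
    proof (rule integral_mono)
      fix y
      show "(s powr p - p * s powr (p - 1) * s) * indicator Q y + p * s powr (p - 1) * (cmod (f y) * indicator Q y)
        \<le> cmod (f y) powr p * indicator Q y"
        using powr_above_tangent[of "cmod (f y)" s p] s p by (auto simp: indicator_def algebra_simps)
    qed (use i0 i1 ip in auto)
    also have "(LINT y|lborel. (s powr p - p * s powr (p - 1) * s) * indicator Q y + p * s powr (p - 1) * (cmod (f y) * indicator Q y))
      = (s powr p - p * s powr (p - 1) * s) * v + p * s powr (p - 1) * (s * v)"
      using i0 i1 v mQ by (simp add: s_def)
    also have "\<dots> = s powr p * v" by (simp add: algebra_simps)
    finally show ?thesis .
  qed (auto intro!: integral_nonneg_AE)
  then have "ennreal (s powr p * v) \<le> (\<integral>\<^sup>+ y. ennreal (cmod (f y) powr p * indicator Q y) \<partial>lborel)"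
    by (subst nn_integral_eq_integral[OF ip]) (auto intro: ennreal_leI)
  also have "\<dots> = (\<integral>\<^sup>+ y. ennreal (cmod (f y) powr p) * indicator Q y \<partial>lborel)"
    by (intro nn_integral_cong) (auto simp: indicator_def)
  finally have "ennreal (s powr p) * ennreal v \<le> \<dots>" using v by (simp add: ennreal_mult')
  moreover have "ennreal (cmod (dyadic_avg k l f x) powr p) * ennreal v \<le> ennreal (s powr p) * ennreal v"
    using le by (intro mult_right_mono ennreal_leI) auto
  ultimately show ?thesis unfolding Q_def v_def by (rule order_trans[rotated])
qed

lemma dyadic_avg_contraction:
  fixes f :: "'m::finite bispace \<Rightarrow> complex"
  assumes f [measurable]: "f \<in> borel_measurable borel" and p: "1 \<le> p" and fin: "Lp_mass p f < \<infinity>"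
  shows "Lp_mass p (dyadic_avg k l f) \<le> Lp_mass p f"
proof -
  have "(\<integral>\<^sup>+ x. ennreal (cmod (dyadic_avg k l f x) powr p) \<partial>lborel)
     \<le> 1 * (\<integral>\<^sup>+ x. ennreal (cmod (f x) powr p) \<partial>lborel)"
  proof (rule nn_integral_le_rects[where k = k and l = l])
    fix i :: "('m \<Rightarrow> int) \<times> ('m \<Rightarrow> int)"
    obtain a b where "a \<in> cube k (fst i)" "b \<in> cube l (snd i)"
      using cube_nonempty[of k "fst i"] cube_nonempty[of l "snd i"] by auto
    then obtain z where z: "z \<in> rect k l i" unfolding rect_def by blast
    then have i: "rect_index k l z = i" by (simp add: mem_rect_iff)
    have "(\<integral>\<^sup>+ x. ennreal (cmod (dyadic_avg k l f x) powr p) * indicator (rect k l i) x \<partial>lborel)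
      = (\<integral>\<^sup>+ x. ennreal (cmod (dyadic_avg k l f z) powr p) * indicator (rect k l i) x \<partial>lborel)"
      by (intro nn_integral_cong)
         (auto simp: indicator_def dyadic_avg_def averaging_kernel_prod mem_rect_iff i)
    also have "\<dots> = ennreal (cmod (dyadic_avg k l f z) powr p) * ennreal (rect_volume TYPE('m) k l)"
      by (simp add: nn_integral_cmult emeasure_rect)
    also have "\<dots> \<le> (\<integral>\<^sup>+ y. ennreal (cmod (f y) powr p) * indicator (rect k l i) y \<partial>lborel)"
      using dyadic_avg_powr_le[OF f p fin, of k l z] by (simp add: i)
    finally show "(\<integral>\<^sup>+ x. ennreal (cmod (dyadic_avg k l f x) powr p) * indicator (rect k l i) x \<partial>lborel)
      \<le> 1 * (\<integral>\<^sup>+ y. ennreal (cmod (f y) powr p) * indicator (rect k l i) y \<partial>lborel)" by simp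
  qed measurable
  then show ?thesis by (simp add: Lp_mass_def)
qed

lemma Lp_mass_add_le:
  fixes f g :: "'a::euclidean_space \<Rightarrow> complex"
  assumes [measurable]: "f \<in> borel_measurable borel" "g \<in> borel_measurable borel" and p: "0 < p"
  shows "Lp_mass p (\<lambda>x. f x + g x) \<le> ennreal (2 powr p) * (Lp_mass p f + Lp_mass p g)"
proof -
  have pt: "cmod (f x + g x) powr p \<le> 2 powr p * (cmod (f x) powr p + cmod (g x) powr p)" for x
  proof -
    have "cmod (f x + g x) powr p \<le> (2 * max (cmod (f x)) (cmod (g x))) powr p"
      using norm_triangle_ineq[of "f x" "g x"] p by (intro powr_mono2) auto
    also have "\<dots> = 2 powr p * max (cmod (f x)) (cmod (g x)) powr p"
      by (subst powr_mult) auto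
    also have "\<dots> \<le> 2 powr p * (cmod (f x) powr p + cmod (g x) powr p)"
      by (intro mult_left_mono) (auto simp: max_def)
    finally show ?thesis .
  qed
  have "Lp_mass p (\<lambda>x. f x + g x) \<le> (\<integral>\<^sup>+ x. ennreal (2 powr p) * (ennreal (cmod (f x) powr p) + ennreal (cmod (g x) powr p)) \<partial>lborel)"
    unfolding Lp_mass_def
  proof (intro nn_integral_mono)
    fix x
    have "ennreal (cmod (f x + g x) powr p) \<le> ennreal (2 powr p * (cmod (f x) powr p + cmod (g x) powr p))"
      by (intro ennreal_leI pt)
    then show "ennreal (cmod (f x + g x) powr p) \<le> ennreal (2 powr p) * (ennreal (cmod (f x) powr p) + ennreal (cmod (g x) powr p))"
      by (simp add: ennreal_mult ennreal_plus)
  qed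
  also have "\<dots> = ennreal (2 powr p) * (Lp_mass p f + Lp_mass p g)"
    unfolding Lp_mass_def by (simp add: nn_integral_cmult nn_integral_add)
  finally show ?thesis .
qed

lemma Lp_mass_uminus: "Lp_mass p (\<lambda>x. - f x) = Lp_mass p f"
  by (simp add: Lp_mass_def)

lemma Lp_mass_diff_le:
  fixes f g :: "'a::euclidean_space \<Rightarrow> complex"
  assumes [measurable]: "f \<in> borel_measurable borel" "g \<in> borel_measurable borel" and p: "0 < p"
  shows "Lp_mass p (\<lambda>x. f x - g x) \<le> ennreal (2 powr p) * (Lp_mass p f + Lp_mass p g)"
  using Lp_mass_add_le[of f "\<lambda>x. - g x" p] p by (simp add: Lp_mass_uminus)

section \<open>Truncations\<close>

text \<open>This is \<open>(E\<^sub>-\<^sub>N - E\<^sub>N) \<otimes> (E\<^sub>-\<^sub>N - E\<^sub>N) f\<close>, where \<open>E\<^sub>k\<close> averages over the cubes of level \<open>k\<close>.\<close>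

definition truncation :: "nat \<Rightarrow> ('m::finite bispace \<Rightarrow> complex) \<Rightarrow> 'm bispace \<Rightarrow> complex" where
  "truncation N f x =
    (dyadic_avg (- int N) (- int N) f x - dyadic_avg (int N) (- int N) f x)
    - (dyadic_avg (- int N) (int N) f x - dyadic_avg (int N) (int N) f x)"

lemma truncation_measurable [measurable]: "truncation N f \<in> borel_measurable borel"
  unfolding truncation_def[abs_def] by measurable

lemma Lp_mass_truncation_le:
  fixes f :: "'m::finite bispace \<Rightarrow> complex"
  assumes f [measurable]: "f \<in> borel_measurable borel" and p: "1 \<le> p" and fin: "Lp_mass p f < \<infinity>"
  shows "Lp_mass p (truncation N f) \<le> ennreal (4 * 4 powr p) * Lp_mass p f"
proof -
  let ?A = "\<lambda>k l. dyadic_avg k l f" and ?c = "ennreal (2 powr p)" and ?n = "int N"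
  have two: "Lp_mass p (\<lambda>x. ?A k l x - ?A k' l x) \<le> ?c * (2 * Lp_mass p f)" for k k' l
  proof -
    have "Lp_mass p (\<lambda>x. ?A k l x - ?A k' l x) \<le> ?c * (Lp_mass p (?A k l) + Lp_mass p (?A k' l))"
      using p by (intro Lp_mass_diff_le) auto
    also have "\<dots> \<le> ?c * (Lp_mass p f + Lp_mass p f)"
      by (intro mult_left_mono add_mono dyadic_avg_contraction f p fin) auto
    finally show ?thesis by (simp add: mult_2)
  qed
  have "Lp_mass p (truncation N f) \<le> ?c * (Lp_mass p (\<lambda>x. ?A (- ?n) (- ?n) x - ?A ?n (- ?n) x)
      + Lp_mass p (\<lambda>x. ?A (- ?n) ?n x - ?A ?n ?n x))"
    unfolding truncation_def[abs_def] using p by (intro Lp_mass_diff_le) auto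
  also have "\<dots> \<le> ?c * (?c * (2 * Lp_mass p f) + ?c * (2 * Lp_mass p f))"
    by (intro mult_left_mono add_mono two) auto
  also have "\<dots> = 4 * (?c * ?c) * Lp_mass p f" by (simp add: algebra_simps flip: mult_2)
  also have "?c * ?c = ennreal (4 powr p)"
    using powr_mult[of 2 2 p] by (simp add: ennreal_mult[symmetric])
  also have "4 * ennreal (4 powr p) = ennreal (4 * 4 powr p)"
    by (subst ennreal_mult) auto
  finally show ?thesis .
qed

section \<open>Haar expansions and dyadic averages\<close>

definition haar_coeff :: "('m::finite bispace \<Rightarrow> complex) \<Rightarrow>
    int \<Rightarrow> ('m \<Rightarrow> int) \<Rightarrow> ('m \<Rightarrow> bool) \<Rightarrow> int \<Rightarrow> ('m \<Rightarrow> int) \<Rightarrow> ('m \<Rightarrow> bool) \<Rightarrow> complex" where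
  "haar_coeff f k n e l n' e' =
    (LINT y|lborel. f y * of_real (haar e (cube k n) (fst y) * haar e' (cube l n') (snd y)))"

text \<open>The value at \<open>x\<close> of the Haar function of the cube of level \<open>k\<close> that contains \<open>x\<close>.\<close>

definition haar_at :: "('m::finite \<Rightarrow> bool) \<Rightarrow> int \<Rightarrow> real ^ 'm \<Rightarrow> real" where
  "haar_at e k x = walsh e (bits (cube_index (k - 1) x)) / sqrt ((2 powi k) ^ CARD('m))"

abbreviation haar_term :: "('m::finite bispace \<Rightarrow> complex) \<Rightarrow>
    int \<Rightarrow> ('m \<Rightarrow> bool) \<Rightarrow> int \<Rightarrow> ('m \<Rightarrow> bool) \<Rightarrow> 'm bispace \<Rightarrow> complex" where
  "haar_term f k e l e' x \<equiv> haar_coeff f k (cube_index k (fst x)) e l (cube_index l (snd x)) e'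
      * of_real (haar_at e k (fst x) * haar_at e' l (snd x))"

lemma haar_at: "haar e (cube k (cube_index k x)) x = haar_at e k x"
  by (simp add: haar_cube haar_at_def mem_cube_index)

lemma haar_at_sq: "(haar_at e k x)\<^sup>2 = 1 / (2 powi k) ^ CARD('m)" for x :: "real ^ 'm::finite"
proof -
  have "0 \<le> ((2::real) powi k) ^ CARD('m)" by simp
  then show ?thesis by (simp add: haar_at_def power_divide walsh_sq)
qed

lemma haar_abs_le: "\<bar>haar e (cube k n) x\<bar> \<le> 1 / sqrt ((2 powi k) ^ CARD('m)) * indicator (cube k n) x"
  for x :: "real ^ 'm::finite"
  using walsh_cases[of e "bits (cube_index (k - 1) x)"] by (auto simp: haar_cube indicator_def abs_mult)

lemma haar_measurable [measurable]: "haar e (cube k n) \<in> borel_measurable borel"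
proof -
  have "haar e (cube k n) = (\<lambda>x. indicator (cube k n) x *
      (\<lambda>u. walsh e (bits u) / sqrt ((2 powi k) ^ CARD('a))) (cube_index (k - 1) x))"
    by (rule ext) (rule haar_cube)
  moreover have "(\<lambda>x. (\<lambda>u. walsh e (bits u) / sqrt ((2 powi k) ^ CARD('a))) (cube_index (k - 1) x)) \<in> borel_measurable borel"
    by (rule measurable_compose[OF cube_index_measurable]) simp
  ultimately show ?thesis by simp
qed

lemma fst_snd_measurable [measurable]:
  fixes g :: "real ^ 'm::finite \<Rightarrow> 'b::topological_space"
  assumes "g \<in> borel_measurable borel"
  shows "(\<lambda>x :: 'm bispace. g (fst x)) \<in> borel_measurable borel"
    and "(\<lambda>x :: 'm bispace. g (snd x)) \<in> borel_measurable borel"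
  by (rule measurable_compose[OF borel_measurable_continuous_onI assms], intro continuous_intros)+

lemma integrable_haar_coeff:
  fixes f :: "'m::finite bispace \<Rightarrow> complex"
  assumes f [measurable]: "f \<in> borel_measurable borel" and p: "1 \<le> p" and fin: "Lp_mass p f < \<infinity>"
  shows "integrable lborel (\<lambda>y. f y * of_real (haar e (cube k n) (fst y) * haar e' (cube l n') (snd y)))"
proof (rule integrable_mult_bounded[OF f _ rect_borel p fin])
  show "emeasure lborel (rect k l (n, n')) < \<infinity>" by (simp add: emeasure_rect)
  let ?c = "1 / sqrt ((2 powi k) ^ CARD('m))" and ?c' = "1 / sqrt ((2 powi l) ^ CARD('m))"
  fix y :: "'m bispace"
  have ind: "indicator (rect k l (n, n')) y = (indicator (cube k n) (fst y) * indicator (cube l n') (snd y) :: real)"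
    by (cases y) (auto simp: rect_def indicator_def)
  have "\<bar>haar e (cube k n) (fst y)\<bar> * \<bar>haar e' (cube l n') (snd y)\<bar>
      \<le> (?c * indicator (cube k n) (fst y)) * (?c' * indicator (cube l n') (snd y))"
    by (intro mult_mono haar_abs_le) auto
  then show "\<bar>haar e (cube k n) (fst y) * haar e' (cube l n') (snd y)\<bar> \<le> (?c * ?c') * indicator (rect k l (n, n')) y"
    unfolding ind by (simp add: abs_mult mult_ac)
qed measurable

lemma integrable_averaging:
  fixes f :: "'m::finite bispace \<Rightarrow> complex"
  assumes f [measurable]: "f \<in> borel_measurable borel" and p: "1 \<le> p" and fin: "Lp_mass p f < \<infinity>"
  shows "integrable lborel (\<lambda>y. f y * of_real (averaging_kernel k (fst x) (fst y) * averaging_kernel l (snd x) (snd y)))"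
  unfolding averaging_kernel_prod
proof (rule integrable_mult_bounded[OF f _ rect_borel p fin])
  show "emeasure lborel (rect k l (rect_index k l x)) < \<infinity>" by (simp add: emeasure_rect)
  show "\<bar>indicator (rect k l (rect_index k l x)) y / rect_volume TYPE('m) k l\<bar>
      \<le> (1 / rect_volume TYPE('m) k l) * indicator (rect k l (rect_index k l x)) y" for y
    using rect_volume_pos[where 'm = 'm, of k l] by (simp add: indicator_def abs_of_pos)
qed measurable

lemma double_sum_product:
  fixes A B :: "'a \<Rightarrow> 'b \<Rightarrow> real"
  shows "(\<Sum>d\<in>I. \<Sum>e\<in>J. A d e) * (\<Sum>d'\<in>I. \<Sum>e'\<in>J. B d' e')
    = (\<Sum>d\<in>I. \<Sum>e\<in>J. \<Sum>d'\<in>I. \<Sum>e'\<in>J. A d e * B d' e')"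
proof -
  define Q where "Q = (\<Sum>d'\<in>I. \<Sum>e'\<in>J. B d' e')"
  have "(\<Sum>d\<in>I. \<Sum>e\<in>J. A d e) * Q = (\<Sum>d\<in>I. \<Sum>e\<in>J. A d e * Q)"
    by (simp only: sum_distrib_right)
  also have "\<dots> = (\<Sum>d\<in>I. \<Sum>e\<in>J. \<Sum>d'\<in>I. \<Sum>e'\<in>J. A d e * B d' e')"
    unfolding Q_def by (simp only: sum_distrib_left)
  finally show ?thesis unfolding Q_def .
qed

text \<open>Multiply the telescoped kernels of the two variables and integrate term by term.\<close>

lemma truncation_eq_haar_sum:
  fixes f :: "'m::finite bispace \<Rightarrow> complex"
  assumes f: "f \<in> borel_measurable borel" and p: "1 \<le> p" and fin: "Lp_mass p f < \<infinity>"
  shows "truncation N f x = (\<Sum>d<2*N. \<Sum>e\<in>haar_indices. \<Sum>d'<2*N. \<Sum>e'\<in>haar_indices.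
      haar_term f (int N - int d) e (int N - int d') e' x)"
proof -
  note int = integrable_averaging[OF f p fin]
  let ?K = "averaging_kernel"
  define k where "k = (\<lambda>d. int N - int d)"
  let ?h = "\<lambda>e d z. haar e (cube (k d) (cube_index (k d) (fst x))) z"
  let ?h' = "\<lambda>e d z. haar e (cube (k d) (cube_index (k d) (snd x))) z"
  define T where "T = (\<lambda>d e d' e' y. (f y * of_real (?h e d (fst y) * ?h' e' d' (snd y)))
      * complex_of_real (haar_at e (k d) (fst x) * haar_at e' (k d') (snd x)))"
  have intT: "integrable lborel (T d e d' e')" for d e d' e'
    unfolding T_def by (intro integrable_mult_left integrable_haar_coeff[OF f p fin])
  have tel: "?K (- int N) z w - ?K (int N) z w
     = (\<Sum>d<2*N. \<Sum>e\<in>haar_indices. haar e (cube (k d) (cube_index (k d) z)) z * haar e (cube (k d) (cube_index (k d) z)) w)"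
    for z w :: "real ^ 'm"
    using haar_kernel_telescope[of "int N" z w "2 * N"] by (simp add: k_def)
  have "truncation N f x = (LINT y|lborel. f y * of_real
      ((?K (- int N) (fst x) (fst y) - ?K (int N) (fst x) (fst y)) * (?K (- int N) (snd x) (snd y) - ?K (int N) (snd x) (snd y))))"
    unfolding truncation_def dyadic_avg_def
      Bochner_Integration.integral_diff[OF int int, symmetric]
      Bochner_Integration.integral_diff[OF Bochner_Integration.integrable_diff[OF int int]
        Bochner_Integration.integrable_diff[OF int int], symmetric]
    by (intro Bochner_Integration.integral_cong refl) (simp add: algebra_simps)
  also have "\<dots> = (LINT y|lborel. (\<Sum>d<2*N. \<Sum>e\<in>haar_indices. \<Sum>d'<2*N. \<Sum>e'\<in>haar_indices. T d e d' e' y))"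
    unfolding tel haar_at T_def
    unfolding double_sum_product
    unfolding of_real_sum sum_distrib_left
    by (intro Bochner_Integration.integral_cong refl sum.cong) (simp add: mult_ac)
  also have "\<dots> = (\<Sum>d<2*N. \<Sum>e\<in>haar_indices. \<Sum>d'<2*N. \<Sum>e'\<in>haar_indices. (LINT y|lborel. T d e d' e' y))"
    using intT by (simp add: Bochner_Integration.integral_sum)
  also have "\<dots> = (\<Sum>d<2*N. \<Sum>e\<in>haar_indices. \<Sum>d'<2*N. \<Sum>e'\<in>haar_indices.
      haar_term f (k d) e (k d') e' x)"
    unfolding T_def haar_coeff_def by (simp only: integral_mult_left_zero)
  finally show ?thesis unfolding k_def .
qed

definition square_trunc :: "nat \<Rightarrow> ('m::finite bispace \<Rightarrow> complex) \<Rightarrow> 'm bispace \<Rightarrow> real" where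
  "square_trunc N f x = (\<Sum>d<2*N. \<Sum>d'<2*N. \<Sum>e\<in>haar_indices. \<Sum>e'\<in>haar_indices.
      (cmod (haar_term f (int N - int d) e (int N - int d') e' x))\<^sup>2)"

abbreviation square_mass :: "real \<Rightarrow> nat \<Rightarrow> ('m::finite bispace \<Rightarrow> complex) \<Rightarrow> ennreal" where
  "square_mass p N f \<equiv> \<integral>\<^sup>+ x. ennreal (square_trunc N f x powr (p/2)) \<partial>lborel"

text \<open>Depth \<open>d\<close> in the tree below a cube of level \<open>N\<close> is level \<open>N - d\<close>; the leaves, at depth \<open>2 N\<close>, have
  level \<open>- N\<close>.\<close>

definition tree_coeffs :: "nat \<Rightarrow> ('m::finite bispace \<Rightarrow> complex) \<Rightarrow> 'm coeffs" where
  "tree_coeffs N f c d n e d' n' e' =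
     (if c then Im else Re) (haar_coeff f (int N - int d) n e (int N - int d') n' e')
     / (sqrt ((2 powi (int N - int d)) ^ CARD('m)) * sqrt ((2 powi (int N - int d')) ^ CARD('m)))"

lemma ancestor_fine:
  assumes "d \<le> 2 * N"
  shows "ancestor (2 * N - d) (cube_index (- int N) x) = cube_index (int N - int d) x"
proof -
  have "- int N + int (2 * N - d) = int N - int d" using assms by (simp add: of_nat_diff)
  then show ?thesis using cube_index_ancestor[of "- int N" "2 * N - d" x] by simp
qed

lemma bits_ancestor_fine:
  assumes "d < 2 * N"
  shows "bits (ancestor (2 * N - d - 1) (cube_index (- int N) x)) = bits (cube_index (int N - int d - 1) x)"
  using ancestor_fine[of "Suc d" N x] assms by (simp add: algebra_simps)

lemma haar_sum2_tree_coeffs: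
  fixes f :: "'m::finite bispace \<Rightarrow> complex"
  assumes f: "f \<in> borel_measurable borel" and p: "1 \<le> p" and fin: "Lp_mass p f < \<infinity>"
  shows "haar_sum2 (tree_coeffs N f) (2 * N) c (cube_index (- int N) (fst x)) (cube_index (- int N) (snd x))
    = (if c then Im else Re) (truncation N f x)"
proof -
  have "haar_sum2 (tree_coeffs N f) (2 * N) c (cube_index (- int N) (fst x)) (cube_index (- int N) (snd x))
    = (\<Sum>d<2*N. \<Sum>e\<in>haar_indices. \<Sum>d'<2*N. \<Sum>e'\<in>haar_indices.
        (if c then Im else Re) (haar_term f (int N - int d) e (int N - int d') e' x))"
    unfolding haar_sum2_def haar_sum_def sum_distrib_right
  proof (intro sum.cong refl)
    fix d e d' e' assume "d \<in> {..<2 * N}" "d' \<in> {..<2 * N}"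
    then have d: "d \<le> 2 * N" "d < 2 * N" "d' \<le> 2 * N" "d' < 2 * N" by auto
    have "(if c then Im else Re) (z * of_real r) = (if c then Im else Re) z * r" for z r by simp
    then show "tree_coeffs N f c d (ancestor (2 * N - d) (cube_index (- int N) (fst x))) e d'
          (ancestor (2 * N - d') (cube_index (- int N) (snd x))) e' *
        walsh e' (bits (ancestor (2 * N - d' - 1) (cube_index (- int N) (snd x)))) *
        walsh e (bits (ancestor (2 * N - d - 1) (cube_index (- int N) (fst x))))
      = (if c then Im else Re) (haar_term f (int N - int d) e (int N - int d') e' x)"
      unfolding ancestor_fine[OF d(1)] ancestor_fine[OF d(3)] bits_ancestor_fine[OF d(2)] bits_ancestor_fine[OF d(4)]
        tree_coeffs_def haar_at_def
      by simp
  qed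
  also have "\<dots> = (if c then Im else Re) (truncation N f x)"
    unfolding truncation_eq_haar_sum[OF f p fin] by simp
  finally show ?thesis .
qed

lemma square_sum2_tree_coeffs:
  "square_sum2 (tree_coeffs N f) (2 * N) (cube_index (- int N) (fst x)) (cube_index (- int N) (snd x)) = square_trunc N f x"
  for f :: "'m::finite bispace \<Rightarrow> complex"
  unfolding square_sum2_def square_trunc_def
proof (intro sum.cong refl)
  fix d d' e e' assume "d \<in> {..<2 * N}" "d' \<in> {..<2 * N}"
  then have d: "d \<le> 2 * N" "d' \<le> 2 * N" by auto
  let ?V = "\<lambda>d. ((2::real) powi (int N - int d)) ^ CARD('m)"
  let ?z = "haar_coeff f (int N - int d) (cube_index (int N - int d) (fst x)) e
                   (int N - int d') (cube_index (int N - int d') (snd x)) e'"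
  have V: "0 \<le> ?V d" for d by simp
  have "(\<Sum>c\<in>UNIV. (tree_coeffs N f c d (ancestor (2 * N - d) (cube_index (- int N) (fst x))) e d'
        (ancestor (2 * N - d') (cube_index (- int N) (snd x))) e')\<^sup>2)
      = ((Re ?z)\<^sup>2 + (Im ?z)\<^sup>2) / (?V d * ?V d')"
    by (simp add: ancestor_fine d tree_coeffs_def UNIV_bool power_divide power_mult_distrib V add_divide_distrib)
  also have "\<dots> = (cmod ?z)\<^sup>2 * ((haar_at e (int N - int d) (fst x))\<^sup>2 * (haar_at e' (int N - int d') (snd x))\<^sup>2)"
    unfolding cmod_power2 haar_at_sq by simp
  also have "\<dots> = (cmod (?z * of_real (haar_at e (int N - int d) (fst x) * haar_at e' (int N - int d') (snd x))))\<^sup>2"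
    by (simp add: norm_mult power_mult_distrib)
  finally show "(\<Sum>c\<in>UNIV. (tree_coeffs N f c d (ancestor (2 * N - d) (cube_index (- int N) (fst x))) e d'
        (ancestor (2 * N - d') (cube_index (- int N) (snd x))) e')\<^sup>2)
     = (cmod (?z * of_real (haar_at e (int N - int d) (fst x) * haar_at e' (int N - int d') (snd x))))\<^sup>2" .
qed

lemma square_trunc_nonneg: "0 \<le> square_trunc N f x"
  unfolding square_trunc_def by (intro sum_nonneg) auto

lemma square_trunc_measurable [measurable]: "square_trunc N f \<in> borel_measurable borel"
proof -
  have "square_trunc N f = (\<lambda>x. (\<lambda>i. square_sum2 (tree_coeffs N f) (2 * N) (fst i) (snd i)) (rect_index (- int N) (- int N) x))"
    by (rule ext) (simp add: rect_index_def square_sum2_tree_coeffs)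
  also have "\<dots> \<in> borel_measurable borel"
    by (rule measurable_compose[OF rect_index_measurable]) simp
  finally show ?thesis .
qed

lemma nn_integral_rect_descendants:
  fixes g :: "('m::finite \<Rightarrow> int) \<Rightarrow> ('m \<Rightarrow> int) \<Rightarrow> real"
  assumes g: "\<And>u v. 0 \<le> g u v"
  shows "(\<integral>\<^sup>+ x. ennreal (g (cube_index (- int N) (fst x)) (cube_index (- int N) (snd x)))
            * indicator (rect (int N) (int N) i) x \<partial>lborel)
    = ennreal (rect_volume TYPE('m) (- int N) (- int N)) *
      ennreal (\<Sum>u\<in>descendants (2 * N) (fst i). \<Sum>v\<in>descendants (2 * N) (snd i). g u v)"
proof -
  define I where "I = descendants (2 * N) (fst i) \<times> descendants (2 * N) (snd i)"
  have I: "finite I" by (simp add: I_def finite_descendants)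
  define r where "r = rect_index (- int N) (- int N) \<circ> (id :: 'm bispace \<Rightarrow> _)"
  have mem: "x \<in> rect (int N) (int N) i \<longleftrightarrow> r x \<in> I" for x
    using ancestor_fine[of 0 N "fst x"] ancestor_fine[of 0 N "snd x"]
    by (cases i) (auto simp: mem_rect_iff rect_index_def r_def I_def descendants_def)
  have "ennreal (g (cube_index (- int N) (fst x)) (cube_index (- int N) (snd x))) * indicator (rect (int N) (int N) i) x
      = (\<Sum>j\<in>I. ennreal (g (fst j) (snd j)) * indicator (rect (- int N) (- int N) j) x)" for x
  proof -
    have "(\<Sum>j\<in>I. ennreal (g (fst j) (snd j)) * indicator (rect (- int N) (- int N) j) x)
       = (\<Sum>j\<in>I. if r x = j then ennreal (g (fst j) (snd j)) else 0)"
      by (intro sum.cong refl) (auto simp: mem_rect_iff r_def indicator_def)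
    also have "\<dots> = (if r x \<in> I then ennreal (g (fst (r x)) (snd (r x))) else 0)"
      using I by simp
    finally show ?thesis by (simp add: mem indicator_def) (simp add: r_def rect_index_def)
  qed
  then have "(\<integral>\<^sup>+ x. ennreal (g (cube_index (- int N) (fst x)) (cube_index (- int N) (snd x)))
            * indicator (rect (int N) (int N) i) x \<partial>lborel)
     = (\<integral>\<^sup>+ x. (\<Sum>j\<in>I. ennreal (g (fst j) (snd j)) * indicator (rect (- int N) (- int N) j) x) \<partial>lborel)"
    by simp
  also have "\<dots> = (\<Sum>j\<in>I. ennreal (g (fst j) (snd j)) * ennreal (rect_volume TYPE('m) (- int N) (- int N)))"
    by (subst nn_integral_sum) (auto simp: nn_integral_cmult emeasure_rect)
  also have "\<dots> = ennreal (rect_volume TYPE('m) (- int N) (- int N)) * ennreal (\<Sum>j\<in>I. g (fst j) (snd j))"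
    using g by (simp add: sum_ennreal sum_distrib_right[symmetric] mult.commute)
  finally show ?thesis by (simp add: I_def sum.cartesian_product case_prod_unfold)
qed

lemma nn_integral_le_of_descendants:
  fixes g g' :: "('m::finite \<Rightarrow> int) \<Rightarrow> ('m \<Rightarrow> int) \<Rightarrow> real"
  assumes g: "\<And>u v. 0 \<le> g u v" and g': "\<And>u v. 0 \<le> g' u v" and C: "0 < C"
    and le: "\<And>n n'. (\<Sum>u\<in>descendants (2 * N) n. \<Sum>v\<in>descendants (2 * N) n'. g u v)
        \<le> C * (\<Sum>u\<in>descendants (2 * N) n. \<Sum>v\<in>descendants (2 * N) n'. g' u v)"
  shows "(\<integral>\<^sup>+ x. ennreal (g (cube_index (- int N) (fst x)) (cube_index (- int N) (snd x))) \<partial>lborel)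
    \<le> ennreal C * (\<integral>\<^sup>+ x. ennreal (g' (cube_index (- int N) (fst x)) (cube_index (- int N) (snd x))) \<partial>lborel)"
proof (rule nn_integral_le_rects[where k = "int N" and l = "int N"])
  have meas: "(\<lambda>x. ennreal (h (cube_index (- int N) (fst x)) (cube_index (- int N) (snd x)))) \<in> borel_measurable borel"
    for h :: "('m \<Rightarrow> int) \<Rightarrow> ('m \<Rightarrow> int) \<Rightarrow> real"
    using measurable_compose[OF rect_index_measurable[of "- int N" "- int N"], of "\<lambda>i. ennreal (h (fst i) (snd i))" borel]
    by (simp add: rect_index_def)
  show "(\<lambda>x. ennreal (g (cube_index (- int N) (fst x)) (cube_index (- int N) (snd x)))) \<in> borel_measurable borel"
    "(\<lambda>x. ennreal (g' (cube_index (- int N) (fst x)) (cube_index (- int N) (snd x)))) \<in> borel_measurable borel"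
    by (rule meas)+
  fix i :: "('m \<Rightarrow> int) \<times> ('m \<Rightarrow> int)"
  let ?s = "\<lambda>h. \<Sum>u\<in>descendants (2 * N) (fst i). \<Sum>v\<in>descendants (2 * N) (snd i). h u v"
  have "ennreal (?s g) \<le> ennreal (C * ?s g')" by (intro ennreal_leI le)
  also have "\<dots> = ennreal C * ennreal (?s g')" using C by (intro ennreal_mult) (auto intro!: sum_nonneg g')
  finally have le': "ennreal (?s g) \<le> ennreal C * ennreal (?s g')" .
  show "(\<integral>\<^sup>+ x. ennreal (g (cube_index (- int N) (fst x)) (cube_index (- int N) (snd x)))
            * indicator (rect (int N) (int N) i) x \<partial>lborel)
      \<le> ennreal C * (\<integral>\<^sup>+ x. ennreal (g' (cube_index (- int N) (fst x)) (cube_index (- int N) (snd x)))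
            * indicator (rect (int N) (int N) i) x \<partial>lborel)"
    using mult_left_mono[OF le', of "ennreal (rect_volume TYPE('m) (- int N) (- int N))"]
    unfolding nn_integral_rect_descendants[of g N i, OF g] nn_integral_rect_descendants[of g' N i, OF g']
    by (simp only: mult.left_commute[of "ennreal C"]) simp
qed

lemma nn_integral_comparable_of_descendants:
  fixes g g' :: "('m::finite \<Rightarrow> int) \<Rightarrow> ('m \<Rightarrow> int) \<Rightarrow> real"
  assumes g: "\<And>u v. 0 \<le> g u v" and g': "\<And>u v. 0 \<le> g' u v" and C: "0 < C"
    and cmp: "\<And>n n'. comparable C (\<Sum>u\<in>descendants (2 * N) n. \<Sum>v\<in>descendants (2 * N) n'. g u v)
        (\<Sum>u\<in>descendants (2 * N) n. \<Sum>v\<in>descendants (2 * N) n'. g' u v)"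
  shows "comparable (ennreal C)
    (\<integral>\<^sup>+ x. ennreal (g (cube_index (- int N) (fst x)) (cube_index (- int N) (snd x))) \<partial>lborel)
    (\<integral>\<^sup>+ x. ennreal (g' (cube_index (- int N) (fst x)) (cube_index (- int N) (snd x))) \<partial>lborel)"
  unfolding comparable_def
  using nn_integral_le_of_descendants[where g = g and g' = g', OF g g' C cmp[unfolded comparable_def, THEN conjunct1]]
    nn_integral_le_of_descendants[where g = g' and g' = g, OF g' g C cmp[unfolded comparable_def, THEN conjunct2]]
  by (rule conjI)

text \<open>Both functions are constant on the rectangles of level \<open>- N\<close>, so that on each rectangle of level \<open>N\<close>
  this is the estimate for finite trees, with the same constant on every rectangle.\<close>

theorem truncation_square_equiv:
  assumes p: "1 < p"
  obtains C where "0 < C"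
    "\<And>N (f :: 'm::finite bispace \<Rightarrow> complex). f \<in> borel_measurable borel \<Longrightarrow> Lp_mass p f < \<infinity> \<Longrightarrow>
      comparable (ennreal C) (square_mass p N f) (Lp_mass p (truncation N f))"
proof -
  obtain C where C: "0 < C"
    "\<And>(a :: 'm coeffs) D n n'. comparable C
      (\<Sum>u\<in>descendants D n. \<Sum>v\<in>descendants D n'. square_sum2 a D u v powr (p/2))
      (\<Sum>u\<in>descendants D n. \<Sum>v\<in>descendants D n'. (\<Sum>c\<in>UNIV. (haar_sum2 a D c u v)\<^sup>2) powr (p/2))"
    using haar_sum2_square_equiv[OF p, where 'm = 'm] by blast
  show thesis
  proof (rule that[OF C(1)])
    fix N and f :: "'m bispace \<Rightarrow> complex"
    assume f: "f \<in> borel_measurable borel" and fin: "Lp_mass p f < \<infinity>"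
    let ?a = "tree_coeffs N f" and ?i = "\<lambda>x. cube_index (- int N) x"
    have sq: "square_trunc N f x powr (p/2) = square_sum2 ?a (2 * N) (?i (fst x)) (?i (snd x)) powr (p/2)" for x
      by (simp add: square_sum2_tree_coeffs)
    have tr: "cmod (truncation N f x) powr p = (\<Sum>c\<in>UNIV. (haar_sum2 ?a (2 * N) c (?i (fst x)) (?i (snd x)))\<^sup>2) powr (p/2)" for x
    proof -
      have "(\<Sum>c\<in>UNIV. (haar_sum2 ?a (2 * N) c (?i (fst x)) (?i (snd x)))\<^sup>2) = (cmod (truncation N f x))\<^sup>2"
        using p by (simp add: haar_sum2_tree_coeffs[OF f _ fin] UNIV_bool cmod_power2)
      also have "\<dots> powr (p/2) = cmod (truncation N f x) powr p"
        by (cases "truncation N f x = 0") (auto simp: powr_powr simp flip: powr_numeral)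
      finally show ?thesis ..
    qed
    show "comparable (ennreal C) (square_mass p N f) (Lp_mass p (truncation N f))"
      unfolding Lp_mass_def sq tr
      by (rule nn_integral_comparable_of_descendants[where g = "\<lambda>u v. square_sum2 ?a (2 * N) u v powr (p/2)"
            and g' = "\<lambda>u v. (\<Sum>c\<in>UNIV. (haar_sum2 ?a (2 * N) c u v)\<^sup>2) powr (p/2)"]) (auto intro: C)
  qed
qed

section \<open>Convergence of truncated Haar expansions\<close>

lemma dyadic_avg_add:
  fixes f g :: "'m::finite bispace \<Rightarrow> complex"
  assumes "f \<in> borel_measurable borel" "g \<in> borel_measurable borel" "1 \<le> p" "Lp_mass p f < \<infinity>" "Lp_mass p g < \<infinity>"
  shows "dyadic_avg k l (\<lambda>x. f x + g x) x = dyadic_avg k l f x + dyadic_avg k l g x"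
  unfolding dyadic_avg_def distrib_right using assms
  by (intro Bochner_Integration.integral_add integrable_averaging) auto

lemma dyadic_avg_cmult:
  "dyadic_avg k l (\<lambda>x. c * f x) x = c * dyadic_avg k l f x"
  unfolding dyadic_avg_def by (simp add: mult.assoc)

lemma truncation_add:
  fixes f g :: "'m::finite bispace \<Rightarrow> complex"
  assumes "f \<in> borel_measurable borel" "g \<in> borel_measurable borel" "1 \<le> p" "Lp_mass p f < \<infinity>" "Lp_mass p g < \<infinity>"
  shows "truncation N (\<lambda>x. f x + g x) x = truncation N f x + truncation N g x"
  unfolding truncation_def by (simp add: dyadic_avg_add[OF assms])

lemma truncation_cmult: "truncation N (\<lambda>x. c * f x) x = c * truncation N f x"
  unfolding truncation_def by (simp add: dyadic_avg_cmult algebra_simps)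

lemma Lp_mass_cmult:
  fixes f :: "'a::euclidean_space \<Rightarrow> complex"
  assumes [measurable]: "f \<in> borel_measurable borel"
  shows "Lp_mass p (\<lambda>x. c * f x) = ennreal (cmod c powr p) * Lp_mass p f"
  unfolding Lp_mass_def
  by (simp add: norm_mult powr_mult ennreal_mult nn_integral_cmult)

definition approximable :: "real \<Rightarrow> ('m::finite bispace \<Rightarrow> complex) \<Rightarrow> bool" where
  "approximable p f \<longleftrightarrow> f \<in> borel_measurable borel \<and> Lp_mass p f < \<infinity> \<and>
     (\<lambda>N. Lp_mass p (\<lambda>x. f x - truncation N f x)) \<longlonglongrightarrow> 0"

lemma approximable_add:
  fixes f g :: "'m::finite bispace \<Rightarrow> complex"
  assumes p: "1 \<le> p" and "approximable p f" "approximable p g"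
  shows "approximable p (\<lambda>x. f x + g x)"
proof -
  have f [measurable]: "f \<in> borel_measurable borel" and g [measurable]: "g \<in> borel_measurable borel"
    and fin: "Lp_mass p f < \<infinity>" "Lp_mass p g < \<infinity>"
    and lim: "(\<lambda>N. Lp_mass p (\<lambda>x. f x - truncation N f x)) \<longlonglongrightarrow> 0"
      "(\<lambda>N. Lp_mass p (\<lambda>x. g x - truncation N g x)) \<longlonglongrightarrow> 0"
    using assms by (auto simp: approximable_def)
  have "(\<lambda>N. ennreal (2 powr p) * (Lp_mass p (\<lambda>x. f x - truncation N f x) + Lp_mass p (\<lambda>x. g x - truncation N g x)))
      \<longlonglongrightarrow> ennreal (2 powr p) * (0 + 0)"
    by (intro tendsto_add lim ennreal_tendsto_cmult) auto
  then have l0: "(\<lambda>N. ennreal (2 powr p) * (Lp_mass p (\<lambda>x. f x - truncation N f x) + Lp_mass p (\<lambda>x. g x - truncation N g x)))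
      \<longlonglongrightarrow> 0" by simp
  have "(\<lambda>N. Lp_mass p (\<lambda>x. (f x + g x) - truncation N (\<lambda>x. f x + g x) x)) \<longlonglongrightarrow> 0"
  proof (rule tendsto_sandwich[OF _ _ tendsto_const l0])
    show "\<forall>\<^sub>F N in sequentially. Lp_mass p (\<lambda>x. (f x + g x) - truncation N (\<lambda>x. f x + g x) x)
       \<le> ennreal (2 powr p) * (Lp_mass p (\<lambda>x. f x - truncation N f x) + Lp_mass p (\<lambda>x. g x - truncation N g x))"
    proof (intro always_eventually allI)
      fix N
      have "(\<lambda>x. (f x + g x) - truncation N (\<lambda>x. f x + g x) x)
          = (\<lambda>x. (f x - truncation N f x) + (g x - truncation N g x))"
        by (simp add: truncation_add[OF f g p fin] fun_eq_iff)
      then show "Lp_mass p (\<lambda>x. (f x + g x) - truncation N (\<lambda>x. f x + g x) x)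
       \<le> ennreal (2 powr p) * (Lp_mass p (\<lambda>x. f x - truncation N f x) + Lp_mass p (\<lambda>x. g x - truncation N g x))"
        using p by (simp only:) (intro Lp_mass_add_le; simp)
    qed
  qed auto
  moreover have "Lp_mass p (\<lambda>x. f x + g x) < \<infinity>"
  proof -
    have "Lp_mass p (\<lambda>x. f x + g x) \<le> ennreal (2 powr p) * (Lp_mass p f + Lp_mass p g)"
      using p by (intro Lp_mass_add_le) auto
    also have "\<dots> < \<infinity>" using fin by (simp add: ennreal_mult_less_top)
    finally show ?thesis .
  qed
  ultimately show ?thesis by (simp add: approximable_def)
qed

lemma approximable_cmult:
  fixes f :: "'m::finite bispace \<Rightarrow> complex"
  assumes "approximable p f"
  shows "approximable p (\<lambda>x. c * f x)"
proof -
  have f [measurable]: "f \<in> borel_measurable borel" and fin: "Lp_mass p f < \<infinity>"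
    and lim: "(\<lambda>N. Lp_mass p (\<lambda>x. f x - truncation N f x)) \<longlonglongrightarrow> 0"
    using assms by (auto simp: approximable_def)
  have "(\<lambda>N. ennreal (cmod c powr p) * Lp_mass p (\<lambda>x. f x - truncation N f x)) \<longlonglongrightarrow> ennreal (cmod c powr p) * 0"
    by (intro lim ennreal_tendsto_cmult) auto
  moreover have "Lp_mass p (\<lambda>x. c * f x - truncation N (\<lambda>x. c * f x) x)
     = ennreal (cmod c powr p) * Lp_mass p (\<lambda>x. f x - truncation N f x)" for N
    by (subst Lp_mass_cmult[symmetric]) (auto simp: truncation_cmult right_diff_distrib)
  ultimately show ?thesis
    using fin by (simp add: approximable_def Lp_mass_cmult ennreal_mult_less_top)
qed

lemma Lp_mass_zero [simp]: "Lp_mass p (\<lambda>x. 0) = 0"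
  by (simp add: Lp_mass_def)

lemma approximable_zero: "approximable p (\<lambda>x. 0)"
  by (simp add: approximable_def truncation_def dyadic_avg_def)

lemma approximable_sum:
  assumes "1 \<le> p" "\<And>i. i \<in> I \<Longrightarrow> approximable p (f i)"
  shows "approximable p (\<lambda>x. \<Sum>i\<in>I. f i x)"
  using assms
  by (induction I rule: infinite_finite_induct) (auto intro: approximable_zero approximable_add)

text \<open>The truncations are bounded uniformly in \<open>N\<close>, so convergence passes to limits in \<open>L\<^sup>p\<close>.\<close>

lemma approximable_closed:
  fixes f :: "'m::finite bispace \<Rightarrow> complex"
  assumes p: "1 \<le> p" and f [measurable]: "f \<in> borel_measurable borel" and fin: "Lp_mass p f < \<infinity>"
    and ex: "\<And>\<epsilon>. 0 < \<epsilon> \<Longrightarrow> \<exists>g. approximable p g \<and> Lp_mass p (\<lambda>x. f x - g x) < ennreal \<epsilon>"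
  shows "approximable p f"
proof -
  define c where "c = 2 powr p"
  define b where "b = 4 * 4 powr p"
  have c: "0 < c" and b: "0 < b" by (auto simp: c_def b_def)
  have "(\<lambda>N. Lp_mass p (\<lambda>x. f x - truncation N f x)) \<longlonglongrightarrow> 0"
  proof (rule order_tendstoI)
    fix \<epsilon>' :: ennreal assume "0 < \<epsilon>'"
    then obtain \<epsilon> where e: "0 < \<epsilon>" "ennreal \<epsilon> \<le> \<epsilon>'"
      by (metis ennreal_cases ennreal_less_zero_iff less_eq_ennreal.abs_eq less_imp_le order_refl top_greatest zero_less_one)
    \<comment> \<open>Chosen for the final estimate \<open>c (\<delta> + c (\<delta> + b \<delta>)) < \<epsilon>\<close>; \<open>c\<close> is the quasi-norm constant, \<open>b\<close> bounds the truncations.\<close>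
    define \<delta> where "\<delta> = \<epsilon> / (c + c * c + c * c * b + 1)"
    have den: "0 < c + c * c + c * c * b + 1" using c b by (simp add: add_pos_pos)
    have d: "0 < \<delta>" using e den by (simp add: \<delta>_def)
    have dd: "c * (\<delta> + c * (\<delta> + b * \<delta>)) < \<epsilon>"
    proof -
      have "c * (\<delta> + c * (\<delta> + b * \<delta>)) < (c + c * c + c * c * b + 1) * \<delta>" using d by (simp add: algebra_simps)
      also have "\<dots> = \<epsilon>" using den by (simp add: \<delta>_def)
      finally show ?thesis .
    qed
    obtain g where g: "approximable p g" and fg: "Lp_mass p (\<lambda>x. f x - g x) < ennreal \<delta>" using ex[OF d] by blast
    have gm [measurable]: "g \<in> borel_measurable borel" and gfin: "Lp_mass p g < \<infinity>"
      and lim: "(\<lambda>N. Lp_mass p (\<lambda>x. g x - truncation N g x)) \<longlonglongrightarrow> 0"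
      using g by (auto simp: approximable_def)
    define r where "r = (\<lambda>x. g x - f x)"
    have r [measurable]: "r \<in> borel_measurable borel" by (simp add: r_def)
    have rm: "Lp_mass p r = Lp_mass p (\<lambda>x. f x - g x)"
      unfolding r_def by (simp add: Lp_mass_def norm_minus_commute)
    have rfin: "Lp_mass p r < \<infinity>" using fg unfolding rm by (rule less_trans) simp
    have tr: "truncation N g x = truncation N f x + truncation N r x" for N x
      using truncation_add[OF f r p fin rfin, of N x] by (simp add: r_def)
    have "\<forall>\<^sub>F N in sequentially. Lp_mass p (\<lambda>x. g x - truncation N g x) < ennreal \<delta>"
      using lim d by (intro order_tendstoD(2)) auto
    then show "\<forall>\<^sub>F N in sequentially. Lp_mass p (\<lambda>x. f x - truncation N f x) < \<epsilon>'"
    proof (rule eventually_mono)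
      fix N assume N: "Lp_mass p (\<lambda>x. g x - truncation N g x) < ennreal \<delta>"
      have "Lp_mass p (\<lambda>x. f x - truncation N f x) = Lp_mass p (\<lambda>x. (f x - g x) + ((g x - truncation N g x) + truncation N r x))"
        by (simp add: tr algebra_simps)
      also have "\<dots> \<le> ennreal c * (Lp_mass p (\<lambda>x. f x - g x) + Lp_mass p (\<lambda>x. (g x - truncation N g x) + truncation N r x))"
        unfolding c_def using p by (intro Lp_mass_add_le) auto
      also have "\<dots> \<le> ennreal c * (ennreal \<delta> + ennreal c * (ennreal \<delta> + ennreal b * ennreal \<delta>))"
      proof (intro mult_left_mono add_mono)
        have "Lp_mass p (\<lambda>x. (g x - truncation N g x) + truncation N r x)
           \<le> ennreal c * (Lp_mass p (\<lambda>x. g x - truncation N g x) + Lp_mass p (truncation N r))"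
          unfolding c_def using p by (intro Lp_mass_add_le) auto
        also have "\<dots> \<le> ennreal c * (ennreal \<delta> + ennreal b * ennreal \<delta>)"
        proof (intro mult_left_mono add_mono)
          have "Lp_mass p (truncation N r) \<le> ennreal b * Lp_mass p r"
            unfolding b_def by (rule Lp_mass_truncation_le[OF r p rfin])
          also have "\<dots> \<le> ennreal b * ennreal \<delta>"
            using fg unfolding rm by (intro mult_left_mono) auto
          finally show "Lp_mass p (truncation N r) \<le> ennreal b * ennreal \<delta>" .
        qed (use N in auto)
        finally show "Lp_mass p (\<lambda>x. (g x - truncation N g x) + truncation N r x)
          \<le> ennreal c * (ennreal \<delta> + ennreal b * ennreal \<delta>)" .
      qed (use fg in auto)
      also have "\<dots> = ennreal (c * (\<delta> + c * (\<delta> + b * \<delta>)))"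
        using c b d by (simp add: ennreal_mult ennreal_plus del: ennreal_plus[symmetric])
      also have "\<dots> < ennreal \<epsilon>" using dd e by (intro ennreal_lessI) auto
      finally show "Lp_mass p (\<lambda>x. f x - truncation N f x) < \<epsilon>'" using e(2) by (rule less_le_trans)
    qed
  qed auto
  then show ?thesis using f fin by (simp add: approximable_def)
qed

lemma Lp_mass_indicator:
  fixes A :: "'a::euclidean_space set"
  assumes "A \<in> sets borel"
  shows "Lp_mass p (indicator A) = emeasure lborel A"
proof -
  have "Lp_mass p (indicator A) = (\<integral>\<^sup>+ x. indicator A x \<partial>lborel)"
    unfolding Lp_mass_def by (intro nn_integral_cong) (auto simp: indicator_def)
  then show ?thesis using assms by simp
qed

text \<open>Smallness of the supremum together with a bound in \<open>L\<^sup>1\<close> gives smallness in \<open>L\<^sup>p\<close>, as \<open>p > 1\<close>.\<close>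

lemma Lp_mass_le_bound:
  fixes g :: "'a::euclidean_space \<Rightarrow> complex"
  assumes [measurable]: "g \<in> borel_measurable borel" and p: "1 \<le> p" and B: "\<And>x. cmod (g x) \<le> B"
  shows "Lp_mass p g \<le> ennreal (B powr (p - 1)) * Lp_mass 1 g"
proof -
  have pt: "cmod (g x) powr p \<le> B powr (p - 1) * cmod (g x)" for x
  proof (cases "g x = 0")
    case False
    have "cmod (g x) powr p = cmod (g x) powr (p - 1) * cmod (g x)"
      using False by (simp add: powr_diff)
    also have "\<dots> \<le> B powr (p - 1) * cmod (g x)"
      using p B by (intro mult_right_mono powr_mono2) auto
    finally show ?thesis .
  qed (use p in auto)
  have "Lp_mass p g \<le> (\<integral>\<^sup>+ x. ennreal (B powr (p - 1)) * ennreal (cmod (g x) powr 1) \<partial>lborel)"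
    unfolding Lp_mass_def
    by (intro nn_integral_mono) (use pt in \<open>auto simp: ennreal_mult[symmetric] intro!: ennreal_leI\<close>)
  also have "\<dots> = ennreal (B powr (p - 1)) * Lp_mass 1 g"
    unfolding Lp_mass_def by (intro nn_integral_cmult) auto
  finally show ?thesis .
qed

lemma cube_nested:
  assumes "l \<le> k" "x \<in> cube k n"
  shows "cube l (cube_index l x) \<subseteq> cube k n"
proof
  fix y assume "y \<in> cube l (cube_index l x)"
  then have "cube_index l y = cube_index l x" by (simp add: cube_def)
  moreover have "k = l + int (nat (k - l))" using assms by simp
  ultimately have "cube_index k y = cube_index k x" by (metis cube_index_ancestor)
  then show "y \<in> cube k n" using assms by (simp add: cube_def)
qed

lemma rect_nested:
  assumes "l \<le> k" "l' \<le> k'" "x \<in> rect k k' i"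
  shows "rect l l' (rect_index l l' x) \<subseteq> rect k k' i"
  using assms cube_nested[of l k "fst x" "fst i"] cube_nested[of l' k' "snd x" "snd i"]
  unfolding rect_def rect_index_def by (cases x) auto

lemma dyadic_avg_indicator:
  fixes A :: "('m::finite bispace) set"
  shows "dyadic_avg k l (indicator A) x
    = of_real (measure lborel (A \<inter> rect k l (rect_index k l x)) / rect_volume TYPE('m) k l)"
proof -
  let ?R = "rect k l (rect_index k l x)"
  have "dyadic_avg k l (indicator A) x = (LINT y|lborel. complex_of_real (indicator (A \<inter> ?R) y / rect_volume TYPE('m) k l))"
    unfolding dyadic_avg_def averaging_kernel_prod
    by (intro Bochner_Integration.integral_cong) (auto simp: indicator_def)
  also have "\<dots> = of_real (LINT y|lborel. indicator (A \<inter> ?R) y / rect_volume TYPE('m) k l)"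
    by (rule integral_complex_of_real)
  finally show ?thesis by simp
qed

lemma rect_volume_ratio:
  "rect_volume TYPE('m::finite) k L / rect_volume TYPE('m) K L = (2 powi (k - K)) ^ CARD('m)"
  "rect_volume TYPE('m::finite) K l / rect_volume TYPE('m) K L = (2 powi (l - L)) ^ CARD('m)"
  by (auto simp: rect_volume_def power_int_diff power_divide)

lemma measure_Int_rect_le:
  fixes x :: "'m::finite bispace"
  shows "measure lborel (rect k l i \<inter> rect K L (rect_index K L x)) \<le> rect_volume TYPE('m) k L"
    and "measure lborel (rect k l i \<inter> rect K L (rect_index K L x)) \<le> rect_volume TYPE('m) K l"
proof -
  have fm: "rect k l (i :: ('m \<Rightarrow> int) \<times> ('m \<Rightarrow> int)) \<in> fmeasurable lborel" for k l i
    by (auto simp: fmeasurable_def emeasure_rect)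
  have "measure lborel (rect k l i \<inter> rect K L (rect_index K L x)) \<le> measure lborel (rect k L (fst i, snd (rect_index K L x)))"
    by (intro measure_mono_fmeasurable fm) (auto simp: rect_def intro!: borel_Times)
  then show "measure lborel (rect k l i \<inter> rect K L (rect_index K L x)) \<le> rect_volume TYPE('m) k L"
    by (simp add: measure_rect)
  have "measure lborel (rect k l i \<inter> rect K L (rect_index K L x)) \<le> measure lborel (rect K l (fst (rect_index K L x), snd i))"
    by (intro measure_mono_fmeasurable fm) (auto simp: rect_def intro!: borel_Times)
  then show "measure lborel (rect k l i \<inter> rect K L (rect_index K L x)) \<le> rect_volume TYPE('m) K l"
    by (simp add: measure_rect)
qed

text \<open>Averaging over a huge cube in at least one of the variables makes the supremum small and does not increase the
  \<open>L\<^sup>1\<close> norm.\<close>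

lemma Lp_mass_dyadic_avg_rect_le:
  fixes i :: "('m::finite \<Rightarrow> int) \<times> ('m \<Rightarrow> int)"
  assumes p: "1 \<le> p" and KL: "K = int N \<or> L = int N"
  shows "Lp_mass p (dyadic_avg K L (indicator (rect k k i)))
    \<le> ennreal (((2 powi (k - int N)) ^ CARD('m)) powr (p - 1)) * emeasure lborel (rect k k i)"
proof -
  let ?B = "((2::real) powi (k - int N)) ^ CARD('m)" and ?f = "indicator (rect k k i) :: _ \<Rightarrow> complex"
  have "cmod (dyadic_avg K L ?f x) \<le> ?B" for x
  proof -
    have "measure lborel (rect k k i \<inter> rect K L (rect_index K L x)) / rect_volume TYPE('m) K L \<le> ?B"
      using KL divide_right_mono[OF measure_Int_rect_le(1)[of k k i K L x], of "rect_volume TYPE('m) K L"]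
        divide_right_mono[OF measure_Int_rect_le(2)[of k k i K L x], of "rect_volume TYPE('m) K L"]
        less_imp_le[OF rect_volume_pos[where 'm = 'm, of K L]]
      by (auto simp: rect_volume_ratio)
    then show ?thesis unfolding dyadic_avg_indicator norm_of_real
      using less_imp_le[OF rect_volume_pos[where 'm = 'm, of K L]] by simp
  qed
  then have "Lp_mass p (dyadic_avg K L ?f) \<le> ennreal (?B powr (p - 1)) * Lp_mass 1 (dyadic_avg K L ?f)"
    using p by (intro Lp_mass_le_bound) auto
  also have "\<dots> \<le> ennreal (?B powr (p - 1)) * Lp_mass 1 ?f"
    by (intro mult_left_mono dyadic_avg_contraction) (auto simp: Lp_mass_indicator emeasure_rect)
  finally show ?thesis by (simp add: Lp_mass_indicator)
qed

text \<open>Averages over cubes that are small enough reproduce the indicator; the other three averages involve a huge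
  cube and tend to zero.\<close>

lemma approximable_rect:
  fixes i :: "('m::finite \<Rightarrow> int) \<times> ('m \<Rightarrow> int)"
  assumes p: "1 < p"
  shows "approximable p (indicator (rect k k i))"
proof -
  let ?f = "indicator (rect k k i) :: _ \<Rightarrow> complex"
  let ?b = "\<lambda>N::nat. ennreal (((2 powi (k - int N)) ^ CARD('m)) powr (p - 1)) * emeasure lborel (rect k k i)"
  let ?c = "ennreal (2 powr p)"
  have bound: "Lp_mass p (\<lambda>x. ?f x - truncation N ?f x) \<le> ?c * (?b N + ?c * (?b N + ?b N))" if N: "- k \<le> int N" for N
  proof -
    have fine: "dyadic_avg (- int N) (- int N) ?f x = ?f x" for x
    proof (cases "x \<in> rect k k i")
      case True
      then have "rect k k i \<inter> rect (- int N) (- int N) (rect_index (- int N) (- int N) x) = rect (- int N) (- int N) (rect_index (- int N) (- int N) x)"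
        using rect_nested[of "- int N" k "- int N" k x i] N by auto
      then show ?thesis using True less_imp_neq[OF rect_volume_pos[where 'm = 'm, of "- int N" "- int N"]]
        by (simp add: dyadic_avg_indicator measure_rect)
    next
      case False
      have "y \<notin> rect k k i" if "y \<in> rect (- int N) (- int N) (rect_index (- int N) (- int N) x)" for y
      proof
        assume y: "y \<in> rect k k i"
        have "rect_index (- int N) (- int N) y = rect_index (- int N) (- int N) x" using that by (simp add: mem_rect_iff)
        then have "x \<in> rect (- int N) (- int N) (rect_index (- int N) (- int N) y)" by (simp add: mem_rect_iff)
        then show False using rect_nested[of "- int N" k "- int N" k y i] N y False by auto
      qed
      then have "rect k k i \<inter> rect (- int N) (- int N) (rect_index (- int N) (- int N) x) = {}" by blast
      then show ?thesis using False by (simp add: dyadic_avg_indicator)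
    qed
    let ?n = "int N"
    have "Lp_mass p (\<lambda>x. ?f x - truncation N ?f x)
       = Lp_mass p (\<lambda>x. dyadic_avg ?n (- ?n) ?f x + (dyadic_avg (- ?n) ?n ?f x - dyadic_avg ?n ?n ?f x))"
      by (simp add: truncation_def fine algebra_simps)
    also have "\<dots> \<le> ?c * (Lp_mass p (dyadic_avg ?n (- ?n) ?f) + Lp_mass p (\<lambda>x. dyadic_avg (- ?n) ?n ?f x - dyadic_avg ?n ?n ?f x))"
      using p by (intro Lp_mass_add_le) auto
    also have "\<dots> \<le> ?c * (?b N + ?c * (?b N + ?b N))"
    proof (intro mult_left_mono add_mono)
      show "Lp_mass p (dyadic_avg ?n (- ?n) ?f) \<le> ?b N"
        using p by (intro Lp_mass_dyadic_avg_rect_le) auto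
      have "Lp_mass p (\<lambda>x. dyadic_avg (- ?n) ?n ?f x - dyadic_avg ?n ?n ?f x)
          \<le> ?c * (Lp_mass p (dyadic_avg (- ?n) ?n ?f) + Lp_mass p (dyadic_avg ?n ?n ?f))"
        using p by (intro Lp_mass_diff_le) auto
      also have "\<dots> \<le> ?c * (?b N + ?b N)"
        using p by (intro mult_left_mono add_mono Lp_mass_dyadic_avg_rect_le) auto
      finally show "Lp_mass p (\<lambda>x. dyadic_avg (- ?n) ?n ?f x - dyadic_avg ?n ?n ?f x) \<le> ?c * (?b N + ?b N)" .
    qed auto
    finally show ?thesis .
  qed
  have "(\<lambda>N. ((2 powi (k - int N)) ^ CARD('m)) powr (p - 1)) \<longlonglongrightarrow> 0"
  proof -
    have "(\<lambda>N. (2::real) powi (k - int N)) = (\<lambda>N. 2 powi k * (1/2) ^ N)"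
      by (auto simp: power_int_diff power_divide)
    moreover have "(\<lambda>N. (2::real) powi k * (1/2) ^ N) \<longlonglongrightarrow> 2 powi k * 0"
      by (intro tendsto_mult tendsto_const LIMSEQ_power_zero) auto
    ultimately have "(\<lambda>N. (2::real) powi (k - int N)) \<longlonglongrightarrow> 0" by simp
    then have "(\<lambda>N. ((2::real) powi (k - int N)) ^ CARD('m)) \<longlonglongrightarrow> 0 ^ CARD('m)" by (rule tendsto_power)
    moreover have "(0::real) ^ CARD('m) = 0" by simp
    ultimately have l: "(\<lambda>N. ((2::real) powi (k - int N)) ^ CARD('m)) \<longlonglongrightarrow> 0" by (simp only:)
    have "(\<lambda>N. (((2::real) powi (k - int N)) ^ CARD('m)) powr (p - 1)) \<longlonglongrightarrow> 0 powr (p - 1)"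
      by (rule tendsto_powr2[OF l tendsto_const]) (use p in auto)
    then show ?thesis by simp
  qed
  then have "(\<lambda>N. ennreal (((2 powi (k - int N)) ^ CARD('m)) powr (p - 1))) \<longlonglongrightarrow> ennreal 0"
    by (rule tendsto_ennrealI)
  then have "(\<lambda>N. emeasure lborel (rect k k i) * ennreal (((2 powi (k - int N)) ^ CARD('m)) powr (p - 1)))
      \<longlonglongrightarrow> emeasure lborel (rect k k i) * ennreal 0"
    by (intro ennreal_tendsto_cmult) (auto simp: emeasure_rect)
  then have b0: "?b \<longlonglongrightarrow> 0 * emeasure lborel (rect k k i)"
    by (simp add: mult.commute)
  then have "(\<lambda>N. ?c * (?b N + ?c * (?b N + ?b N))) \<longlonglongrightarrow> ?c * (0 * emeasure lborel (rect k k i) + ?c * (0 * emeasure lborel (rect k k i) + 0 * emeasure lborel (rect k k i)))"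
    by (intro tendsto_add b0 ennreal_tendsto_cmult) auto
  then have l0: "(\<lambda>N. ?c * (?b N + ?c * (?b N + ?b N))) \<longlonglongrightarrow> 0" by simp
  have "(\<lambda>N. Lp_mass p (\<lambda>x. ?f x - truncation N ?f x)) \<longlonglongrightarrow> 0"
    by (rule tendsto_sandwich[OF _ _ tendsto_const l0])
       (auto intro!: eventually_mono[OF eventually_ge_at_top[of "nat (- k)"]] bound)
  then show ?thesis by (simp add: approximable_def Lp_mass_indicator emeasure_rect)
qed

lemma rect_dist_le:
  fixes x y :: "'m::finite bispace"
  assumes "y \<in> rect k k (rect_index k k x)"
  shows "dist y x \<le> 2 * real CARD('m) * 2 powi k"
proof -
  have comp: "\<bar>(b - a) $ j\<bar> \<le> 2 powi k" if "cube_index k b = cube_index k a" for a b :: "real ^ 'm" and j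
  proof -
    have "b \<in> cube k (cube_index k a)" "a \<in> cube k (cube_index k a)" using that by (auto simp: cube_def)
    then have "b $ j \<in> {of_int (cube_index k a j) * 2 powi k ..< (of_int (cube_index k a j) + 1) * 2 powi k}"
      "a $ j \<in> {of_int (cube_index k a j) * 2 powi k ..< (of_int (cube_index k a j) + 1) * 2 powi k}"
      by (auto simp: mem_cube_iff)
    then show ?thesis by (auto simp: distrib_right abs_le_iff)
  qed
  have nrm: "norm (b - a) \<le> real CARD('m) * 2 powi k" if "cube_index k b = cube_index k a" for a b :: "real ^ 'm"
  proof -
    have "norm (b - a) \<le> (\<Sum>j\<in>UNIV. \<bar>(b - a) $ j\<bar>)" by (rule norm_le_l1_cart)
    also have "\<dots> \<le> (\<Sum>j\<in>(UNIV :: 'm set). 2 powi k)" by (intro sum_mono comp that)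
    finally show ?thesis by simp
  qed
  have "norm (fst y - fst x) \<le> real CARD('m) * 2 powi k" "norm (snd y - snd x) \<le> real CARD('m) * 2 powi k"
    using assms by (auto intro!: nrm simp: mem_rect_iff rect_index_def)
  moreover have "dist y x \<le> norm (fst y - fst x) + norm (snd y - snd x)"
    unfolding dist_norm using norm_triangle_ineq[of "(fst y - fst x, 0)" "(0, snd y - snd x)"]
    by (cases x; cases y) (simp add: norm_Pair1 norm_Pair2)
  ultimately show ?thesis by simp
qed

lemma finite_rects_inside:
  fixes U :: "('m::finite bispace) set"
  assumes U: "U \<in> sets borel" and fin: "emeasure lborel U < \<infinity>"
  shows "finite {i. rect k k i \<subseteq> U}"
proof -
  let ?v = "rect_volume TYPE('m) k k"
  define M where "M = nat \<lceil>measure lborel U / ?v\<rceil>"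
  have "card G \<le> M" if G: "finite G" "G \<subseteq> {i. rect k k i \<subseteq> U}" for G
  proof -
    have disj: "disjoint_family_on (\<lambda>i. rect k k i) G"
      by (auto simp: disjoint_family_on_def mem_rect_iff)
    have "(\<Sum>i\<in>G. measure lborel (rect k k i)) = measure lborel (\<Union>i\<in>G. rect k k i)"
    proof (rule measure_finite_Union[symmetric, OF G(1) _ disj])
      show "(\<lambda>i. rect k k i) ` G \<subseteq> sets lborel" using rect_borel by auto
      show "emeasure lborel (rect k k i) \<noteq> \<infinity>" for i :: "('m \<Rightarrow> int) \<times> ('m \<Rightarrow> int)"
        by (simp add: emeasure_rect)
    qed
    also have "\<dots> \<le> measure lborel U"
    proof (rule measure_mono_fmeasurable)
      show "(\<Union>i\<in>G. rect k k i) \<subseteq> U" using G(2) by blast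
      show "(\<Union>i\<in>G. rect k k i) \<in> sets lborel" using G(1) by (intro sets.finite_UN) auto
      show "U \<in> fmeasurable lborel" using U fin by (simp add: fmeasurable_def)
    qed
    finally have "real (card G) * ?v \<le> measure lborel U" by (simp add: measure_rect)
    then have "real (card G) \<le> measure lborel U / ?v"
      by (simp add: pos_le_divide_eq)
    also have "\<dots> \<le> of_int \<lceil>measure lborel U / ?v\<rceil>" by (rule le_of_int_ceiling)
    finally have "real_of_int (int (card G)) \<le> of_int \<lceil>measure lborel U / ?v\<rceil>" by simp
    then have "int (card G) \<le> \<lceil>measure lborel U / ?v\<rceil>" by (simp only: of_int_le_iff)
    then show "card G \<le> M" unfolding M_def by (simp add: le_nat_iff)
  qed
  then show ?thesis by (intro conjunct1[OF finite_if_finite_subsets_card_bdd])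
qed

text \<open>Approximate the set from outside by an open set \<open>U\<close>, and \<open>U\<close> from inside by the union of the dyadic
  rectangles of a fine level that it contains. These are finitely many, because they are disjoint
  and have the same volume.\<close>

lemma approximable_indicator:
  fixes A :: "('m::finite bispace) set"
  assumes p: "1 < p" and A [measurable]: "A \<in> sets borel" and fin: "emeasure lborel A < \<infinity>"
  shows "approximable p (indicator A)"
proof (rule approximable_closed)
  fix \<epsilon> :: real assume e: "0 < \<epsilon>"
  define \<delta> where "\<delta> = \<epsilon> / (2 * 2 powr p)"
  have d: "0 < \<delta>" "2 powr p * (\<delta> + \<delta>) = \<epsilon>" using e by (auto simp: \<delta>_def)
  obtain U where U: "open U" "A \<subseteq> U" "emeasure lborel (U - A) < \<delta>"
    using outer_regular_lborel[OF A d(1)] by blast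
  have Um [measurable]: "U \<in> sets borel" using U by simp
  have Ufin: "emeasure lborel U < \<infinity>"
  proof -
    have "emeasure lborel U = emeasure lborel A + emeasure lborel (U - A)"
      using plus_emeasure[of A lborel "U - A"] U(2) by (simp add: Un_absorb1)
    moreover have "emeasure lborel (U - A) < \<infinity>" using U(3) by (rule less_trans) simp
    ultimately show ?thesis using fin by simp
  qed
  define I where "I = (\<lambda>j::nat. {i. rect (- int j) (- int j) i \<subseteq> U})"
  define V where "V = (\<lambda>j. \<Union>i\<in>I j. rect (- int j) (- int j) i)"
  have I: "finite (I j)" for j unfolding I_def by (rule finite_rects_inside[OF Um Ufin])
  have memV: "x \<in> V j \<longleftrightarrow> rect (- int j) (- int j) (rect_index (- int j) (- int j) x) \<subseteq> U" for x j
    by (auto simp: V_def I_def mem_rect_iff)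
  have Vm [measurable]: "V j \<in> sets borel" for j unfolding V_def by (intro sets.finite_UN I) auto
  have VU: "V j \<subseteq> U" for j by (auto simp: V_def I_def)
  have inc: "incseq V"
  proof (rule incseq_SucI, rule subsetI)
    fix j x assume "x \<in> V j"
    moreover have "rect (- int (Suc j)) (- int (Suc j)) (rect_index (- int (Suc j)) (- int (Suc j)) x)
      \<subseteq> rect (- int j) (- int j) (rect_index (- int j) (- int j) x)"
      by (rule rect_nested) (auto simp: mem_rect_iff)
    ultimately show "x \<in> V (Suc j)" unfolding memV by blast
  qed
  have union: "(\<Union>j. V j) = U"
  proof (intro equalityI subsetI)
    fix x assume "x \<in> U"
    then obtain r where r: "0 < r" "ball x r \<subseteq> U" using U(1) openE by blast
    have "(\<lambda>j. 2 * real CARD('m) * (1/2) ^ j) \<longlonglongrightarrow> 2 * real CARD('m) * 0"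
      by (intro tendsto_mult tendsto_const LIMSEQ_power_zero) auto
    then have "\<forall>\<^sub>F j in sequentially. 2 * real CARD('m) * (1/2) ^ j < r"
      using r by (intro order_tendstoD) auto
    then obtain j where j: "2 * real CARD('m) * (1/2) ^ j < r" by (auto simp: eventually_sequentially)
    have pw: "(2::real) powi (- int j) = (1/2) ^ j" by (simp add: power_int_minus power_one_over inverse_eq_divide)
    have "rect (- int j) (- int j) (rect_index (- int j) (- int j) x) \<subseteq> ball x r"
    proof
      fix y assume "y \<in> rect (- int j) (- int j) (rect_index (- int j) (- int j) x)"
      from rect_dist_le[OF this] have "dist y x < r"
        using j by (simp only: pw)
      then show "y \<in> ball x r" by (simp add: dist_commute)
    qed
    then have "x \<in> V j" unfolding memV using r(2) by (rule subset_trans)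
    then show "x \<in> (\<Union>j. V j)" by (rule UN_I[OF UNIV_I])
  qed (use VU in auto)
  have "(\<lambda>j. emeasure lborel (U - V j)) \<longlonglongrightarrow> emeasure lborel (\<Inter>j. U - V j)"
  proof (rule Lim_emeasure_decseq)
    show "decseq (\<lambda>j. U - V j)" using inc unfolding decseq_def incseq_def by blast
    show "emeasure lborel (U - V j) \<noteq> \<infinity>" for j
    proof -
      have "emeasure lborel (U - V j) \<le> emeasure lborel U" by (rule emeasure_mono) auto
      then have "emeasure lborel (U - V j) < \<infinity>" using Ufin by (rule le_less_trans)
      then show ?thesis by simp
    qed
  qed auto
  also have "(\<Inter>j. U - V j) = {}" using union by blast
  finally have "(\<lambda>j. emeasure lborel (U - V j)) \<longlonglongrightarrow> 0" by simp
  then have "\<forall>\<^sub>F j in sequentially. emeasure lborel (U - V j) < ennreal \<delta>"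
    using d by (intro order_tendstoD(2)) auto
  then obtain j where j: "emeasure lborel (U - V j) < ennreal \<delta>" by (auto simp: eventually_sequentially)
  have sum: "(indicator (V j) :: _ \<Rightarrow> complex) = (\<lambda>x. \<Sum>i\<in>I j. indicator (rect (- int j) (- int j) i) x)"
  proof
    fix x
    have "(\<Sum>i\<in>I j. indicator (rect (- int j) (- int j) i) x :: complex)
        = (\<Sum>i\<in>I j. if rect_index (- int j) (- int j) x = i then 1 else 0)"
      by (rule sum.cong[OF refl]) (simp add: indicator_def mem_rect_iff)
    also have "\<dots> = (if rect_index (- int j) (- int j) x \<in> I j then 1 else 0)"
      using I[of j] by simp
    also have "\<dots> = indicator (V j) x"
      by (simp only: indicator_def memV I_def mem_Collect_eq of_bool_def)
    finally show "indicator (V j) x = (\<Sum>i\<in>I j. indicator (rect (- int j) (- int j) i) x :: complex)" ..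
  qed
  have appr: "approximable p (indicator (V j) :: _ \<Rightarrow> complex)"
    unfolding sum using p by (intro approximable_sum approximable_rect) auto
  have "Lp_mass p (\<lambda>x. indicator A x - indicator (V j) x) \<le> emeasure lborel (U - A) + emeasure lborel (U - V j)"
  proof -
    have "Lp_mass p (\<lambda>x. indicator A x - indicator (V j) x) \<le> (\<integral>\<^sup>+ x. indicator (U - A) x + indicator (U - V j) x \<partial>lborel)"
      unfolding Lp_mass_def using U(2) VU[of j] by (intro nn_integral_mono) (auto simp: indicator_def)
    also have "\<dots> = emeasure lborel (U - A) + emeasure lborel (U - V j)"
      by (subst nn_integral_add) auto
    finally show ?thesis .
  qed
  also have "\<dots> < ennreal \<delta> + ennreal \<delta>" using U(3) j by (rule add_strict_mono)
  also have "\<dots> \<le> ennreal \<epsilon>"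
  proof -
    have "1 * (\<delta> + \<delta>) \<le> 2 powr p * (\<delta> + \<delta>)" using d p by (intro mult_right_mono) (auto simp: ge_one_powr_ge_zero)
    then have "\<delta> + \<delta> \<le> \<epsilon>" unfolding d(2) by simp
    then have "ennreal (\<delta> + \<delta>) \<le> ennreal \<epsilon>" by (rule ennreal_leI)
    moreover have "ennreal (\<delta> + \<delta>) = ennreal \<delta> + ennreal \<delta>" using d by (intro ennreal_plus) auto
    ultimately show ?thesis by (simp only:)
  qed
  finally show "\<exists>g. approximable p g \<and> Lp_mass p (\<lambda>x. indicator A x - g x) < ennreal \<epsilon>"
    using appr by blast
qed (use assms in \<open>auto simp: Lp_mass_indicator\<close>)

text \<open>Simple functions with \<open>|F| \<le> 2 |f|\<close> converge to \<open>f\<close> in \<open>L\<^sup>p\<close> by dominated convergence, and the bound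
  gives their nonzero level sets finite measure.\<close>

lemma approximable_Lp:
  fixes f :: "'m::finite bispace \<Rightarrow> complex"
  assumes p: "1 < p" and f [measurable]: "f \<in> borel_measurable borel" and fin: "Lp_mass p f < \<infinity>"
  shows "approximable p f"
proof (rule approximable_closed[OF _ f fin])
  fix \<epsilon> :: real assume e: "0 < \<epsilon>"
  have "f \<in> borel_measurable (lborel :: ('m bispace) measure)" by simp
  from borel_measurable_implies_sequence_metric[OF this, of 0] obtain F where
    F: "\<And>i. simple_function lborel (F i)" and lim: "\<And>x. (\<lambda>i. F i x) \<longlonglongrightarrow> f x"
    and le: "\<And>i x. cmod (F i x) \<le> 2 * cmod (f x)" by (auto simp: dist_norm)
  have Fm [measurable]: "F i \<in> borel_measurable borel" for i
    using borel_measurable_simple_function[OF F[of i]] by simp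
  have "(\<lambda>i. Lp_mass p (\<lambda>x. f x - F i x)) \<longlonglongrightarrow> (\<integral>\<^sup>+ x. 0 \<partial>(lborel :: ('m bispace) measure))"
    unfolding Lp_mass_def
  proof (rule nn_integral_dominated_convergence)
    show "AE x in lborel. ennreal (cmod (f x - F j x) powr p) \<le> ennreal (3 powr p) * ennreal (cmod (f x) powr p)" for j
    proof (rule AE_I2)
      fix x
      have "cmod (f x - F j x) \<le> 3 * cmod (f x)" using norm_triangle_ineq4[of "f x" "F j x"] le[of j x] by linarith
      then have "cmod (f x - F j x) powr p \<le> (3 * cmod (f x)) powr p" using p by (intro powr_mono2) auto
      then show "ennreal (cmod (f x - F j x) powr p) \<le> ennreal (3 powr p) * ennreal (cmod (f x) powr p)"
        by (simp add: powr_mult ennreal_mult[symmetric] ennreal_leI)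
    qed
    have "(\<integral>\<^sup>+ x. ennreal (3 powr p) * ennreal (cmod (f x) powr p) \<partial>lborel) = ennreal (3 powr p) * Lp_mass p f"
      unfolding Lp_mass_def by (intro nn_integral_cmult) auto
    also have "\<dots> < \<infinity>" using fin by (simp add: ennreal_mult_less_top)
    finally show "(\<integral>\<^sup>+ x. ennreal (3 powr p) * ennreal (cmod (f x) powr p) \<partial>lborel) < \<infinity>" .
    show "AE x in lborel. (\<lambda>i. ennreal (cmod (f x - F i x) powr p)) \<longlonglongrightarrow> 0"
    proof (rule AE_I2)
      fix x
      have l: "(\<lambda>i. cmod (f x - F i x)) \<longlonglongrightarrow> 0"
        using tendsto_norm[OF tendsto_diff[OF tendsto_const[of "f x"] lim[of x]]] by simp
      have "(\<lambda>i. cmod (f x - F i x) powr p) \<longlonglongrightarrow> 0 powr p"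
        by (rule tendsto_powr2[OF l tendsto_const]) (use p in auto)
      from tendsto_ennrealI[OF this] show "(\<lambda>i. ennreal (cmod (f x - F i x) powr p)) \<longlonglongrightarrow> 0" by simp
    qed
  qed auto
  then have "(\<lambda>i. Lp_mass p (\<lambda>x. f x - F i x)) \<longlonglongrightarrow> 0" by simp
  then have "\<forall>\<^sub>F i in sequentially. Lp_mass p (\<lambda>x. f x - F i x) < ennreal \<epsilon>"
    using e by (intro order_tendstoD(2)) auto
  then obtain i where i: "Lp_mass p (\<lambda>x. f x - F i x) < ennreal \<epsilon>" by (auto simp: eventually_sequentially)
  define R where "R = range (F i) - {0}"
  have R: "finite R" using simple_functionD(1)[OF F[of i]] by (simp add: R_def)
  have Fsum: "F i = (\<lambda>x. \<Sum>c\<in>R. c * indicator (F i -` {c}) x)"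
  proof
    fix x
    have "(\<Sum>c\<in>R. c * indicator (F i -` {c}) x) = (\<Sum>c\<in>R. if F i x = c then c else 0)"
      by (intro sum.cong) (auto simp: indicator_def)
    also have "\<dots> = F i x" using R by (auto simp: R_def)
    finally show "F i x = (\<Sum>c\<in>R. c * indicator (F i -` {c}) x)" ..
  qed
  have "approximable p (\<lambda>x. c * indicator (F i -` {c}) x)" if "c \<in> R" for c
  proof (intro approximable_cmult approximable_indicator p)
    have c: "c \<noteq> 0" using that by (simp add: R_def)
    show m: "F i -` {c} \<in> sets borel" using measurable_sets[OF Fm, of "{c}" i] by simp
    have "ennreal (cmod c powr p) * emeasure lborel (F i -` {c})
        = (\<integral>\<^sup>+ x. ennreal (cmod c powr p) * indicator (F i -` {c}) x \<partial>lborel)"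
      using m by (simp add: nn_integral_cmult)
    also have "\<dots> \<le> (\<integral>\<^sup>+ x. ennreal (2 powr p) * ennreal (cmod (f x) powr p) \<partial>lborel)"
    proof (intro nn_integral_mono)
      fix x
      have "cmod (F i x) powr p \<le> (2 * cmod (f x)) powr p" using p le[of i x] by (intro powr_mono2) auto
      then show "ennreal (cmod c powr p) * indicator (F i -` {c}) x \<le> ennreal (2 powr p) * ennreal (cmod (f x) powr p)"
        by (auto simp: indicator_def powr_mult ennreal_mult[symmetric] intro!: ennreal_leI)
    qed
    also have "\<dots> = ennreal (2 powr p) * Lp_mass p f"
      unfolding Lp_mass_def by (intro nn_integral_cmult) auto
    also have "\<dots> < \<infinity>" using fin by (simp add: ennreal_mult_less_top)
    finally show "emeasure lborel (F i -` {c}) < \<infinity>"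
      using c by (auto simp: ennreal_mult_less_top)
  qed
  then have "approximable p (F i)"
    by (subst Fsum) (use p in \<open>intro approximable_sum; simp\<close>)
  then show "\<exists>g. approximable p g \<and> Lp_mass p (\<lambda>x. f x - g x) < ennreal \<epsilon>" using i by blast
qed (use p in auto)

lemma Lp_mass_le_of_truncations:
  fixes f :: "'m::finite bispace \<Rightarrow> complex"
  assumes p: "1 < p" and f [measurable]: "f \<in> borel_measurable borel" and fin: "Lp_mass p f < \<infinity>"
    and B: "\<And>N. Lp_mass p (truncation N f) \<le> B"
  shows "Lp_mass p f \<le> ennreal (2 powr p) * B"
proof -
  have lim: "(\<lambda>N. Lp_mass p (\<lambda>x. f x - truncation N f x)) \<longlonglongrightarrow> 0"
    using approximable_Lp[OF p f fin] by (simp add: approximable_def)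
  have "Lp_mass p f \<le> ennreal (2 powr p) * (Lp_mass p (\<lambda>x. f x - truncation N f x) + B)" for N
  proof -
    have "Lp_mass p f = Lp_mass p (\<lambda>x. (f x - truncation N f x) + truncation N f x)" by simp
    also have "\<dots> \<le> ennreal (2 powr p) * (Lp_mass p (\<lambda>x. f x - truncation N f x) + Lp_mass p (truncation N f))"
      using p by (intro Lp_mass_add_le) auto
    also have "\<dots> \<le> ennreal (2 powr p) * (Lp_mass p (\<lambda>x. f x - truncation N f x) + B)"
      by (intro mult_left_mono add_left_mono B) auto
    finally show ?thesis .
  qed
  moreover have "(\<lambda>N. ennreal (2 powr p) * (Lp_mass p (\<lambda>x. f x - truncation N f x) + B)) \<longlonglongrightarrow> ennreal (2 powr p) * (0 + B)"
    by (intro ennreal_tendsto_cmult tendsto_add lim tendsto_const) auto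
  ultimately show ?thesis
    using tendsto_lowerbound[of "\<lambda>N. ennreal (2 powr p) * (Lp_mass p (\<lambda>x. f x - truncation N f x) + B)"
        "ennreal (2 powr p) * (0 + B)" sequentially "Lp_mass p f"] by simp
qed

section \<open>Powers of extended nonnegative reals\<close>

lemma ennpowr_ennreal: "0 \<le> a \<Longrightarrow> ennpowr (ennreal a) s = ennreal (a powr s)"
  by (simp add: ennpowr_def)

lemma ennpowr_top [simp]: "ennpowr \<infinity> s = \<infinity>" "ennpowr top s = top"
  by (simp_all add: ennpowr_def)

lemma ennpowr_mono:
  assumes "a \<le> b" "0 \<le> s"
  shows "ennpowr a s \<le> ennpowr b s"
proof (cases b)
  case (real r)
  then obtain q where q: "0 \<le> q" "a = ennreal q" using assms by (cases a) (auto simp: top_unique)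
  then show ?thesis using real assms by (auto simp: ennpowr_ennreal intro!: ennreal_leI powr_mono2)
qed simp

lemma ennpowr_cmult:
  assumes "0 < C"
  shows "ennpowr (ennreal C * a) s = ennreal (C powr s) * ennpowr a s"
proof (cases a)
  case (real r)
  then show ?thesis using assms by (simp add: ennpowr_ennreal ennreal_mult[symmetric] powr_mult)
next
  case top
  then show ?thesis using assms by (simp add: ennreal_mult_top)
qed

lemma ennpowr_ennpowr: "ennpowr (ennpowr a s) t = ennpowr a (s * t)"
  by (cases a) (auto simp: ennpowr_ennreal powr_powr)

text \<open>The power is continuous where the supremum is finite, and unbounded along the sequence otherwise.\<close>

lemma ennpowr_SUP:
  fixes a :: "nat \<Rightarrow> real"
  assumes a: "\<And>N. 0 \<le> a N" "incseq a" and q: "0 < q"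
  shows "ennpowr (SUP N. ennreal (a N)) q = (SUP N. ennreal (a N powr q))"
proof (cases "SUP N. ennreal (a N)")
  case (real r)
  have "incseq (\<lambda>N. ennreal (a N))" using a by (auto simp: incseq_def intro!: ennreal_leI)
  then have "(\<lambda>N. ennreal (a N)) \<longlonglongrightarrow> ennreal r" using LIMSEQ_SUP real by metis
  then have lim: "a \<longlonglongrightarrow> r" using real a by (auto intro: tendsto_ennrealD)
  have "(\<lambda>N. a N powr q) \<longlonglongrightarrow> r powr q"
    by (rule tendsto_powr2[OF lim tendsto_const]) (use a q in auto)
  then have "(\<lambda>N. ennreal (a N powr q)) \<longlonglongrightarrow> ennreal (r powr q)" by (rule tendsto_ennrealI)
  moreover have "incseq (\<lambda>N. ennreal (a N powr q))"
    using a q by (auto simp: incseq_def intro!: ennreal_leI powr_mono2)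
  ultimately have "(SUP N. ennreal (a N powr q)) = ennreal (r powr q)"
    using LIMSEQ_SUP LIMSEQ_unique by blast
  then show ?thesis using real by (simp add: ennpowr_ennreal)
next
  case top
  have top': "(SUP N. ennreal (a N powr q)) = top"
  proof (rule ccontr)
    assume "(SUP N. ennreal (a N powr q)) \<noteq> top"
    then obtain r where r: "0 \<le> r" "(SUP N. ennreal (a N powr q)) = ennreal r"
      by (cases "SUP N. ennreal (a N powr q)") auto
    have "a N \<le> r powr (1 / q)" for N
    proof -
      have "ennreal (a N powr q) \<le> ennreal r" unfolding r(2)[symmetric] by (rule SUP_upper) simp
      then have "a N powr q \<le> r" using r by simp
      then have "(a N powr q) powr (1 / q) \<le> r powr (1 / q)" using q by (intro powr_mono2) auto
      then show ?thesis using q a(1)[of N] by (simp add: powr_powr)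
    qed
    then have "(SUP N. ennreal (a N)) \<le> ennreal (r powr (1 / q))"
      by (intro SUP_least ennreal_leI)
    then show False using top by (simp add: top_unique)
  qed
  show ?thesis unfolding top top' by simp
qed

section \<open>Exhaustion of the levels\<close>

lemma infsum_Times_SUP:
  fixes g :: "int \<Rightarrow> int \<Rightarrow> ennreal"
  shows "(\<Sum>\<^sub>\<infinity>(k, l)\<in>UNIV. g k l) = (SUP N. \<Sum>d<2 * N. \<Sum>d'<2 * N. g (int N - int d) (int N - int d'))"
proof -
  define h where "h = (\<lambda>(k, l). g k l)"
  define J where "J = (\<lambda>N. {- int N <.. int N} \<times> {- int N <.. int N})"
  have bij: "bij_betw (\<lambda>d. int N - int d) {..<2 * N} {- int N <.. int N}" for N
    by (rule bij_betw_byWitness[where f' = "\<lambda>k. nat (int N - k)"]) auto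
  have box: "sum h (J N) = (\<Sum>d<2 * N. \<Sum>d'<2 * N. g (int N - int d) (int N - int d'))" for N
    unfolding J_def h_def sum.cartesian_product[symmetric]
    by (subst sum.reindex_bij_betw[OF bij, symmetric], intro sum.cong refl)
       (subst sum.reindex_bij_betw[OF bij, symmetric], rule refl)
  have "(\<Sum>\<^sub>\<infinity>x\<in>UNIV. h x) = (SUP F\<in>{F. finite F \<and> F \<subseteq> UNIV}. sum h F)"
    by (rule nonneg_infsum_complete) simp
  also have "\<dots> = (SUP N. sum h (J N))"
  proof (rule antisym)
    show "(SUP F\<in>{F. finite F \<and> F \<subseteq> UNIV}. sum h F) \<le> (SUP N. sum h (J N))"
    proof (rule SUP_least)
      fix F :: "(int \<times> int) set" assume "F \<in> {F. finite F \<and> F \<subseteq> UNIV}"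
      then have F: "finite F" by simp
      define N where "N = nat (Max (insert 0 ((\<lambda>(k, l). max \<bar>k\<bar> \<bar>l\<bar>) ` F))) + 1"
      have "F \<subseteq> J N"
      proof
        fix x assume x: "x \<in> F"
        obtain k l where kl: "x = (k, l)" by (cases x)
        have "max \<bar>k\<bar> \<bar>l\<bar> \<le> Max (insert 0 ((\<lambda>(k, l). max \<bar>k\<bar> \<bar>l\<bar>) ` F))"
          using F x kl by (intro Max_ge) (auto intro!: image_eqI[of _ _ x])
        then have "\<bar>k\<bar> < int N" "\<bar>l\<bar> < int N" unfolding N_def by auto
        then show "x \<in> J N" by (auto simp: J_def kl)
      qed
      then have "sum h F \<le> sum h (J N)" by (intro sum_mono2) (auto simp: J_def)
      also have "\<dots> \<le> (SUP N. sum h (J N))" by (rule SUP_upper) simp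
      finally show "sum h F \<le> (SUP N. sum h (J N))" .
    qed
    show "(SUP N. sum h (J N)) \<le> (SUP F\<in>{F. finite F \<and> F \<subseteq> UNIV}. sum h F)"
      by (intro SUP_least SUP_upper) (auto simp: J_def)
  qed
  finally show ?thesis by (simp add: h_def box[unfolded h_def])
qed

lemma square_trunc_incseq: "incseq (\<lambda>N. square_trunc N f x)"
  for f :: "'m::finite bispace \<Rightarrow> complex"
proof (rule incseq_SucI)
  fix N
  define g where "g = (\<lambda>k l. \<Sum>e\<in>haar_indices. \<Sum>e'\<in>haar_indices.
      (cmod (haar_term f k e l e' x))\<^sup>2)"
  have g: "0 \<le> g k l" for k l unfolding g_def by (intro sum_nonneg) auto
  have bij: "bij_betw (\<lambda>d. int N - int d) {..<2 * N} {- int N <.. int N}" for N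
    by (rule bij_betw_byWitness[where f' = "\<lambda>k. nat (int N - k)"]) auto
  have eq: "square_trunc N f x = (\<Sum>k\<in>{- int N <.. int N}. \<Sum>l\<in>{- int N <.. int N}. g k l)" for N
    unfolding square_trunc_def g_def
    by (subst sum.reindex_bij_betw[OF bij, symmetric], intro sum.cong refl)
       (subst sum.reindex_bij_betw[OF bij, symmetric], rule refl)
  have "(\<Sum>k\<in>{- int N <.. int N}. \<Sum>l\<in>{- int N <.. int N}. g k l)
      \<le> (\<Sum>k\<in>{- int N <.. int N}. \<Sum>l\<in>{- int (Suc N) <.. int (Suc N)}. g k l)"
    by (intro sum_mono sum_mono2) (auto simp: g)
  also have "\<dots> \<le> (\<Sum>k\<in>{- int (Suc N) <.. int (Suc N)}. \<Sum>l\<in>{- int (Suc N) <.. int (Suc N)}. g k l)"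
    by (intro sum_mono2) (auto intro!: sum_nonneg g)
  finally show "square_trunc N f x \<le> square_trunc (Suc N) f x" unfolding eq .
qed

section \<open>Measure preserving changes of variables\<close>

text \<open>The inverse \<open>S\<close> is kept as an argument because the square function for \<open>T\<close> of \<open>f\<close> is expressed through
  \<open>f \<circ> S\<close>.\<close>

definition measure_iso :: "('a::euclidean_space \<Rightarrow> 'a) \<Rightarrow> ('a \<Rightarrow> 'a) \<Rightarrow> bool" where
  "measure_iso T S \<longleftrightarrow> T \<in> borel_measurable borel \<and> S \<in> borel_measurable borel \<and>
     (\<forall>x. S (T x) = x) \<and> (\<forall>x. T (S x) = x) \<and> distr lborel borel T = lborel"

lemma measure_iso_nn_integral:
  assumes "measure_iso T S" "g \<in> borel_measurable borel"
  shows "(\<integral>\<^sup>+ x. g (T x) \<partial>lborel) = (\<integral>\<^sup>+ x. g x \<partial>lborel)"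
proof -
  have "(\<integral>\<^sup>+ x. g x \<partial>lborel) = (\<integral>\<^sup>+ x. g x \<partial>distr lborel borel T)"
    using assms by (simp add: measure_iso_def)
  also have "\<dots> = (\<integral>\<^sup>+ x. g (T x) \<partial>lborel)"
    using assms by (intro nn_integral_distr) (auto simp: measure_iso_def)
  finally show ?thesis ..
qed

lemma measure_iso_integral:
  fixes g :: "'a::euclidean_space \<Rightarrow> complex"
  assumes "measure_iso T S" "g \<in> borel_measurable borel"
  shows "(LINT x|lborel. g (T x)) = (LINT x|lborel. g x)"
proof -
  have "(LINT x|lborel. g x) = (LINT x|distr lborel borel T. g x)"
    using assms by (simp add: measure_iso_def)
  also have "\<dots> = (LINT x|lborel. g (T x))"
    using assms by (intro integral_distr) (auto simp: measure_iso_def)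
  finally show ?thesis ..
qed

lemma measure_iso_id: "measure_iso id id"
  by (simp add: measure_iso_def id_def distr_id2)

lemma nn_integral_lborel_translate:
  fixes g :: "'a::euclidean_space \<Rightarrow> ennreal"
  assumes [measurable]: "g \<in> borel_measurable borel"
  shows "(\<integral>\<^sup>+ x. g (x - c) \<partial>lborel) = (\<integral>\<^sup>+ x. g x \<partial>lborel)"
proof -
  have "(\<integral>\<^sup>+ x. g x \<partial>lborel) = (\<integral>\<^sup>+ x. g x \<partial>distr lborel borel ((+) (- c)))"
    by (simp only: lborel_distr_plus)
  also have "\<dots> = (\<integral>\<^sup>+ x. g (- c + x) \<partial>lborel)"
    by (rule nn_integral_distr) auto
  finally show ?thesis by simp
qed

lemma measure_iso_T2: "measure_iso T2 (\<lambda>(x1, x2). (x1 + x2, x2) :: 'm::finite bispace)"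
proof -
  have T2 [measurable]: "(T2 :: 'm bispace \<Rightarrow> _) \<in> borel_measurable borel"
    unfolding T2_def case_prod_unfold by (intro borel_measurable_continuous_onI continuous_intros)
  have "distr lborel borel (T2 :: 'm bispace \<Rightarrow> _) = lborel"
  proof (rule measure_eqI)
    fix A :: "('m bispace) set" assume "A \<in> sets (distr lborel borel T2)"
    then have A [measurable]: "A \<in> sets borel" by simp
    have ind: "indicator A \<in> borel_measurable (lborel \<Otimes>\<^sub>M lborel :: ('m bispace) measure)"
      "(\<lambda>x. indicator A (T2 x) :: ennreal) \<in> borel_measurable (lborel \<Otimes>\<^sub>M lborel :: ('m bispace) measure)"
      unfolding lborel_prod by measurable
    have sec: "(\<lambda>x1. indicator A (x1, x2) :: ennreal) \<in> borel_measurable borel" for x2 :: "real ^ 'm"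
    proof -
      have "(\<lambda>x1 :: real ^ 'm. (x1, x2)) \<in> borel_measurable borel"
        by (intro borel_measurable_continuous_onI continuous_intros)
      from measurable_compose[OF this, of "indicator A" borel] show ?thesis by simp
    qed
    have "emeasure (distr lborel borel T2) A = (\<integral>\<^sup>+ x. indicator A x \<partial>distr lborel borel T2)" by simp
    also have "\<dots> = (\<integral>\<^sup>+ x. indicator A (T2 x) \<partial>lborel)" by (rule nn_integral_distr) auto
    also have "\<dots> = (\<integral>\<^sup>+ x2. \<integral>\<^sup>+ x1. indicator A (T2 (x1, x2)) \<partial>lborel \<partial>lborel)"
      unfolding lborel_prod[symmetric] by (rule lborel_pair.nn_integral_snd[symmetric]) (rule ind)
    also have "\<dots> = (\<integral>\<^sup>+ x2. \<integral>\<^sup>+ x1. indicator A (x1, x2) \<partial>lborel \<partial>lborel)"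
      unfolding T2_def case_prod_conv by (rule nn_integral_cong) (rule nn_integral_lborel_translate[OF sec])
    also have "\<dots> = (\<integral>\<^sup>+ x. indicator A x \<partial>lborel)"
      unfolding lborel_prod[symmetric] by (rule lborel_pair.nn_integral_snd) (rule ind)
    finally show "emeasure (distr lborel borel T2) A = emeasure lborel A" by simp
  qed simp
  moreover have "(\<lambda>(x1, x2). (x1 + x2, x2) :: 'm bispace) \<in> borel_measurable borel"
    unfolding case_prod_unfold by (intro borel_measurable_continuous_onI continuous_intros)
  ultimately show ?thesis using T2 unfolding measure_iso_def by (simp add: T2_def split_beta)
qed

lemma measure_iso_T3: "measure_iso T3 (\<lambda>(x1, x2). (x1, x2 + x1) :: 'm::finite bispace)"
proof -
  have T3 [measurable]: "(T3 :: 'm bispace \<Rightarrow> _) \<in> borel_measurable borel"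
    unfolding T3_def case_prod_unfold by (intro borel_measurable_continuous_onI continuous_intros)
  have "distr lborel borel (T3 :: 'm bispace \<Rightarrow> _) = lborel"
  proof (rule measure_eqI)
    fix A :: "('m bispace) set" assume "A \<in> sets (distr lborel borel T3)"
    then have A [measurable]: "A \<in> sets borel" by simp
    have ind: "indicator A \<in> borel_measurable (lborel \<Otimes>\<^sub>M lborel :: ('m bispace) measure)"
      "(\<lambda>x. indicator A (T3 x) :: ennreal) \<in> borel_measurable (lborel \<Otimes>\<^sub>M lborel :: ('m bispace) measure)"
      unfolding lborel_prod by measurable
    have sec: "(\<lambda>x2. indicator A (x1, x2) :: ennreal) \<in> borel_measurable borel" for x1 :: "real ^ 'm"
    proof -
      have "(\<lambda>x2 :: real ^ 'm. (x1, x2)) \<in> borel_measurable borel"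
        by (intro borel_measurable_continuous_onI continuous_intros)
      from measurable_compose[OF this, of "indicator A" borel] show ?thesis by simp
    qed
    have "emeasure (distr lborel borel T3) A = (\<integral>\<^sup>+ x. indicator A x \<partial>distr lborel borel T3)" by simp
    also have "\<dots> = (\<integral>\<^sup>+ x. indicator A (T3 x) \<partial>lborel)" by (rule nn_integral_distr) auto
    also have "\<dots> = (\<integral>\<^sup>+ x1. \<integral>\<^sup>+ x2. indicator A (T3 (x1, x2)) \<partial>lborel \<partial>lborel)"
      unfolding lborel_prod[symmetric] by (rule lborel.nn_integral_fst[symmetric]) (rule ind)
    also have "\<dots> = (\<integral>\<^sup>+ x1. \<integral>\<^sup>+ x2. indicator A (x1, x2) \<partial>lborel \<partial>lborel)"
      unfolding T3_def case_prod_conv by (rule nn_integral_cong) (rule nn_integral_lborel_translate[OF sec])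
    also have "\<dots> = (\<integral>\<^sup>+ x. indicator A x \<partial>lborel)"
      unfolding lborel_prod[symmetric] by (rule lborel.nn_integral_fst) (rule ind)
    finally show "emeasure (distr lborel borel T3) A = emeasure lborel A" by simp
  qed simp
  moreover have "(\<lambda>(x1, x2). (x1, x2 + x1) :: 'm bispace) \<in> borel_measurable borel"
    unfolding case_prod_unfold by (intro borel_measurable_continuous_onI continuous_intros)
  ultimately show ?thesis using T3 unfolding measure_iso_def by (simp add: T3_def split_beta)
qed

section \<open>Reduction of the square functions to finite sums\<close>

lemma haar_prod_rect:
  "haar_prod (e, e') (cube k n \<times> cube l n') z = haar e (cube k n) (fst z) * haar e' (cube l n') (snd z)"
  using cube_nonempty[of k n] cube_nonempty[of l n'] by (cases z) (simp add: haar_prod_def)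

lemma haar_outside: "x \<notin> cube k n \<Longrightarrow> haar e (cube k n) x = 0"
  by (simp add: haar_cube)

lemma pairing_haar_rect:
  fixes f :: "'m::finite bispace \<Rightarrow> complex"
  assumes T: "measure_iso T S" and f: "f \<in> borel_measurable borel"
  shows "pairing f (haar_rect T (e, e') (T -` (cube k n \<times> cube l n'))) = haar_coeff (f \<circ> S) k n e l n' e'"
proof -
  have S: "\<And>x. S (T x) = x" "\<And>x. T (S x) = x" and m [measurable]: "T \<in> borel_measurable borel" "S \<in> borel_measurable borel"
    using T by (auto simp: measure_iso_def)
  note f [measurable]
  have im: "T ` (T -` Q) = Q" for Q using S(2) by (metis surj_image_vimage_eq surj_def)
  define g where "g = (\<lambda>y. f (S y) * of_real (haar e (cube k n) (fst y) * haar e' (cube l n') (snd y)))"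
  have g: "g \<in> borel_measurable borel" unfolding g_def by measurable
  have "pairing f (haar_rect T (e, e') (T -` (cube k n \<times> cube l n'))) = (LINT x|lebesgue. g (T x))"
    unfolding pairing_def haar_rect_def im by (simp add: g_def haar_prod_rect S)
  also have "\<dots> = (LINT x|lborel. g (T x))"
    using measurable_compose[OF m(1) g] by (intro integral_completion) simp
  also have "\<dots> = (LINT x|lborel. g x)" by (rule measure_iso_integral[OF T g])
  finally show ?thesis by (simp add: g_def haar_coeff_def)
qed

text \<open>At a given point only the rectangles that contain it contribute, and there is exactly one for each pair of
  levels.\<close>

lemma square_fun_eq_SUP:
  fixes f :: "'m::finite bispace \<Rightarrow> complex"
  assumes T: "measure_iso T S" and f: "f \<in> borel_measurable borel"
  shows "square_fun T f x = ennpowr (SUP N. ennreal (square_trunc N (f \<circ> S) (T x))) (1 / 2)"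
proof -
  have S: "\<And>x. S (T x) = x" "\<And>x. T (S x) = x" using T by (auto simp: measure_iso_def)
  have im: "T ` (T -` Q) = Q" for Q using S(2) by (metis surj_image_vimage_eq surj_def)
  define trm where "trm = (\<lambda>R. \<Sum>e\<in>haar_indices \<times> haar_indices.
          ennreal ((cmod (pairing f (haar_rect T e R) * complex_of_real (haar_rect T e R x)))\<^sup>2))"
  define z where "z = T x"
  define \<rho> where "\<rho> = (\<lambda>(k, l). T -` (cube k (cube_index k (fst z)) \<times> cube l (cube_index l (snd z))))"
  define g where "g = (\<lambda>k l. \<Sum>e\<in>haar_indices. \<Sum>e'\<in>haar_indices.
      (cmod (haar_term (f \<circ> S) k e l e' z))\<^sup>2)"
  have val: "trm (T -` (cube k n \<times> cube l n')) = (\<Sum>e\<in>haar_indices. \<Sum>e'\<in>haar_indices. ennreal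
     ((cmod (haar_coeff (f \<circ> S) k n e l n' e' * of_real (haar e (cube k n) (fst z) * haar e' (cube l n') (snd z))))\<^sup>2))"
    for k n l n'
  proof -
    have "haar_rect T (e, e') (T -` (cube k n \<times> cube l n')) x = haar e (cube k n) (fst z) * haar e' (cube l n') (snd z)" for e e'
      unfolding haar_rect_def im by (simp add: haar_prod_rect z_def)
    then show ?thesis
      unfolding trm_def sum.cartesian_product
      by (intro sum.cong refl) (auto simp: pairing_haar_rect[OF T f] simp del: of_real_mult)
  qed
  have inj: "inj \<rho>"
  proof (rule injI)
    fix i j assume "\<rho> i = \<rho> j"
    then have "T ` \<rho> i = T ` \<rho> j" by simp
    then have "cube (fst i) (cube_index (fst i) (fst z)) \<times> cube (snd i) (cube_index (snd i) (snd z))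
       = cube (fst j) (cube_index (fst j) (fst z)) \<times> cube (snd j) (cube_index (snd j) (snd z))"
      by (simp only: \<rho>_def im case_prod_unfold)
    then have "cube (fst i) (cube_index (fst i) (fst z)) = cube (fst j) (cube_index (fst j) (fst z))"
      "cube (snd i) (cube_index (snd i) (snd z)) = cube (snd j) (cube_index (snd j) (snd z))"
      using cube_nonempty by (auto simp: times_eq_iff)
    then show "i = j" using cube_inj by (metis prod.expand)
  qed
  have sub: "range \<rho> \<subseteq> dyadic_rects T"
    unfolding \<rho>_def dyadic_rects_def dyadic_cubes_eq by (auto simp: case_prod_unfold)
  have zero: "trm R = 0" if R: "R \<in> dyadic_rects T - range \<rho>" for R
  proof -
    obtain k n l n' where Req: "R = T -` (cube k n \<times> cube l n')"
      using R unfolding dyadic_rects_def dyadic_cubes_eq by auto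
    have "\<not> (fst z \<in> cube k n \<and> snd z \<in> cube l n')"
    proof
      assume "fst z \<in> cube k n \<and> snd z \<in> cube l n'"
      then have "R = \<rho> (k, l)" by (simp add: Req \<rho>_def cube_def)
      then show False using R by auto
    qed
    then have z0: "haar e (cube k n) (fst z) * haar e' (cube l n') (snd z) = 0" for e e'
      using haar_outside by auto
    show ?thesis unfolding Req val z0 by simp
  qed
  have "(\<Sum>\<^sub>\<infinity>R\<in>dyadic_rects T. trm R) = (\<Sum>\<^sub>\<infinity>R\<in>range \<rho>. trm R)"
    using zero sub by (intro infsum_cong_neutral) auto
  also have "\<dots> = (\<Sum>\<^sub>\<infinity>i\<in>UNIV. trm (\<rho> i))"
    using infsum_reindex[OF inj, of trm] by (simp add: comp_def)
  also have "\<dots> = (\<Sum>\<^sub>\<infinity>(k, l)\<in>UNIV. ennreal (g k l))"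
  proof (rule infsum_cong)
    fix i :: "int \<times> int"
    obtain k l where i: "i = (k, l)" by (cases i)
    show "trm (\<rho> i) = (case i of (k, l) \<Rightarrow> ennreal (g k l))"
      unfolding i \<rho>_def case_prod_conv val haar_at g_def by (simp add: sum_nonneg flip: sum_ennreal)
  qed
  also have "\<dots> = (SUP N. \<Sum>d<2 * N. \<Sum>d'<2 * N. ennreal (g (int N - int d) (int N - int d')))"
    by (rule infsum_Times_SUP)
  also have "\<dots> = (SUP N. ennreal (square_trunc N (f \<circ> S) z))"
  proof (intro SUP_cong refl)
    fix N
    have g0: "0 \<le> g k l" for k l unfolding g_def by (intro sum_nonneg) auto
    have "(\<Sum>d<2 * N. \<Sum>d'<2 * N. ennreal (g (int N - int d) (int N - int d')))
        = ennreal (\<Sum>d<2 * N. \<Sum>d'<2 * N. g (int N - int d) (int N - int d'))"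
      by (simp add: sum_ennreal g0 sum_nonneg)
    then show "(\<Sum>d<2 * N. \<Sum>d'<2 * N. ennreal (g (int N - int d) (int N - int d'))) = ennreal (square_trunc N (f \<circ> S) z)"
      unfolding g_def square_trunc_def .
  qed
  finally show ?thesis unfolding square_fun_def trm_def z_def by simp
qed

lemma Lp_norm_complex_eq: "Lp_norm_complex p f = ennpowr (Lp_mass p f) (1 / p)"
  unfolding Lp_norm_def Lp_mass_def by (simp add: ennpowr_ennreal nn_integral_completion)

lemma square_fun_measurable:
  fixes f :: "'m::finite bispace \<Rightarrow> complex"
  assumes T: "measure_iso T S" and f: "f \<in> borel_measurable borel"
  shows "square_fun T f \<in> borel_measurable lebesgue"
proof -
  have [measurable]: "T \<in> borel_measurable borel" using T by (simp add: measure_iso_def)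
  have "square_fun T f = (\<lambda>x. SUP N. ennreal (square_trunc N (f \<circ> S) (T x) powr (1 / 2)))"
    by (rule ext) (simp add: square_fun_eq_SUP[OF T f] ennpowr_SUP square_trunc_nonneg square_trunc_incseq)
  also have "\<dots> \<in> borel_measurable borel" by measurable
  finally have "square_fun T f \<in> borel_measurable lborel" by simp
  then show ?thesis by (rule measurable_completion)
qed

lemma Lp_norm_square_fun:
  fixes f :: "'m::finite bispace \<Rightarrow> complex"
  assumes T: "measure_iso T S" and f: "f \<in> borel_measurable borel" and p: "1 < p"
  shows "Lp_norm p (square_fun T f)
    = ennpowr (SUP N. square_mass p N (f \<circ> S)) (1 / p)"
proof -
  have [measurable]: "T \<in> borel_measurable borel" using T by (simp add: measure_iso_def)
  have "ennpowr (square_fun T f x) p = (SUP N. ennreal (square_trunc N (f \<circ> S) (T x) powr (p / 2)))" for x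
    unfolding square_fun_eq_SUP[OF T f] ennpowr_ennpowr
    using p by (subst ennpowr_SUP) (auto simp: square_trunc_nonneg square_trunc_incseq)
  then have "(\<integral>\<^sup>+ x. ennpowr (square_fun T f x) p \<partial>lebesgue)
      = (\<integral>\<^sup>+ x. (SUP N. ennreal (square_trunc N (f \<circ> S) (T x) powr (p / 2))) \<partial>lborel)"
    by (simp add: nn_integral_completion)
  also have "\<dots> = (SUP N. \<integral>\<^sup>+ x. ennreal (square_trunc N (f \<circ> S) (T x) powr (p / 2)) \<partial>lborel)"
  proof (rule nn_integral_monotone_convergence_SUP)
    show "incseq (\<lambda>N x. ennreal (square_trunc N (f \<circ> S) (T x) powr (p / 2)))"
    proof (intro incseq_SucI le_funI ennreal_leI powr_mono2)
      show "square_trunc N (f \<circ> S) (T x) \<le> square_trunc (Suc N) (f \<circ> S) (T x)" for N x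
        by (rule incseq_SucD[OF square_trunc_incseq])
    qed (use p in \<open>simp_all add: square_trunc_nonneg\<close>)
  qed measurable
  also have "\<dots> = (SUP N. square_mass p N (f \<circ> S))"
    by (intro SUP_cong refl measure_iso_nn_integral[OF T, where g = "\<lambda>x. ennreal (square_trunc _ (f \<circ> S) x powr (p / 2))"]) measurable
  finally show ?thesis unfolding Lp_norm_def by simp
qed

lemma Lp_mass_measure_iso:
  assumes T: "measure_iso T S" and f: "f \<in> borel_measurable borel"
  shows "Lp_mass p (f \<circ> S) = Lp_mass p f"
proof -
  have S: "\<And>x. S (T x) = x" and m [measurable]: "S \<in> borel_measurable borel"
    using T by (auto simp: measure_iso_def)
  note f [measurable]
  have "(\<integral>\<^sup>+ x. ennreal (cmod (f (S (T x))) powr p) \<partial>lborel) = (\<integral>\<^sup>+ x. ennreal (cmod (f (S x)) powr p) \<partial>lborel)"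
    by (rule measure_iso_nn_integral[OF T, where g = "\<lambda>x. ennreal (cmod (f (S x)) powr p)"]) measurable
  then show ?thesis by (simp add: Lp_mass_def S)
qed

lemma Lp_borel_representative:
  fixes f :: "'a::euclidean_space \<Rightarrow> complex"
  assumes f: "f \<in> borel_measurable lebesgue"
  obtains g where "g \<in> borel_measurable borel" "AE x in lebesgue. f x = g x"
proof -
  have "(\<lambda>x. Re (f x)) \<in> borel_measurable lebesgue" "(\<lambda>x. Im (f x)) \<in> borel_measurable lebesgue"
    using f by measurable
  then obtain u v where uv: "u \<in> borel_measurable lborel" "v \<in> borel_measurable lborel"
    "AE x in lborel. Re (f x) = u x" "AE x in lborel. Im (f x) = v x"
    by (metis completion_ex_borel_measurable_real)
  show thesis
  proof (rule that)
    show "(\<lambda>x. Complex (u x) (v x)) \<in> borel_measurable borel"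
      using uv by (simp add: borel_measurable_complex_iff)
    have "AE x in lborel. f x = Complex (u x) (v x)"
      using uv(3,4) by eventually_elim (simp add: complex_eq_iff)
    then show "AE x in lebesgue. f x = Complex (u x) (v x)" by (rule AE_completion)
  qed
qed

lemma haar_rect_measurable:
  fixes T :: "'m::finite bispace \<Rightarrow> _"
  assumes T: "measure_iso T S" and R: "R \<in> dyadic_rects T"
  shows "haar_rect T e R \<in> borel_measurable borel"
proof -
  have S: "\<And>x. T (S x) = x" and [measurable]: "T \<in> borel_measurable borel" using T by (auto simp: measure_iso_def)
  have im: "T ` (T -` Q) = Q" for Q using S by (metis surj_image_vimage_eq surj_def)
  obtain k n l n' where Req: "R = T -` (cube k n \<times> cube l n')"
    using R unfolding dyadic_rects_def dyadic_cubes_eq by auto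
  have "haar_rect T e R = (\<lambda>x. haar (fst e) (cube k n) (fst (T x)) * haar (snd e) (cube l n') (snd (T x)))"
    unfolding haar_rect_def Req im by (cases e) (simp add: haar_prod_rect fun_eq_iff)
  moreover have "(\<lambda>z. haar (fst e) (cube k n) (fst z) * haar (snd e) (cube l n') (snd z)) \<in> borel_measurable borel"
    by measurable
  ultimately show ?thesis using measurable_compose[OF \<open>T \<in> borel_measurable borel\<close>] by simp
qed

text \<open>With this and a Borel measurable representative, Lebesgue measurable functions need no separate treatment.\<close>

lemma square_fun_cong_AE:
  fixes f g :: "'m::finite bispace \<Rightarrow> complex"
  assumes T: "measure_iso T S" and f: "f \<in> borel_measurable lebesgue" and g: "g \<in> borel_measurable borel"
    and eq: "AE x in lebesgue. f x = g x"
  shows "square_fun T f = square_fun T g"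
proof -
  have "pairing f (haar_rect T e R) = pairing g (haar_rect T e R)" if R: "R \<in> dyadic_rects T" for e R
    unfolding pairing_def
  proof (rule integral_cong_AE)
    have [measurable]: "haar_rect T e R \<in> borel_measurable lebesgue"
      using haar_rect_measurable[OF T R] by (intro measurable_completion) simp
    have [measurable]: "g \<in> borel_measurable lebesgue" using g by (intro measurable_completion) simp
    note f [measurable]
    show "(\<lambda>x. f x * complex_of_real (haar_rect T e R x)) \<in> borel_measurable lebesgue"
      "(\<lambda>x. g x * complex_of_real (haar_rect T e R x)) \<in> borel_measurable lebesgue"
      by measurable
    show "AE x in lebesgue. f x * complex_of_real (haar_rect T e R x) = g x * complex_of_real (haar_rect T e R x)"
      using eq by eventually_elim simp
  qed
  then have "(\<Sum>\<^sub>\<infinity>R\<in>dyadic_rects T. \<Sum>e\<in>haar_indices \<times> haar_indices.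
          ennreal ((cmod (pairing f (haar_rect T e R) * complex_of_real (haar_rect T e R x)))\<^sup>2))
     = (\<Sum>\<^sub>\<infinity>R\<in>dyadic_rects T. \<Sum>e\<in>haar_indices \<times> haar_indices.
          ennreal ((cmod (pairing g (haar_rect T e R) * complex_of_real (haar_rect T e R x)))\<^sup>2))" for x
    by (intro infsum_cong sum.cong refl) simp
  then show ?thesis by (simp add: square_fun_def fun_eq_iff)
qed

lemma Lp_mass_cong_AE:
  assumes "AE x in lebesgue. f x = g x"
  shows "Lp_mass p f = Lp_mass p g"
proof -
  have "Lp_mass p f = (\<integral>\<^sup>+ x. ennreal (cmod (f x) powr p) \<partial>lebesgue)" by (simp add: Lp_mass_def nn_integral_completion)
  also have "\<dots> = (\<integral>\<^sup>+ x. ennreal (cmod (g x) powr p) \<partial>lebesgue)"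
    by (rule nn_integral_cong_AE) (use assms in eventually_elim, simp)
  also have "\<dots> = Lp_mass p g" by (simp add: Lp_mass_def nn_integral_completion)
  finally show ?thesis .
qed

lemma square_fun_equiv:
  assumes p: "1 < p"
  obtains c C where "0 < c" "0 < C"
    "\<And>T S (f :: 'm::finite bispace \<Rightarrow> complex). measure_iso T S \<Longrightarrow> f \<in> Lp p \<Longrightarrow>
       square_fun T f \<in> borel_measurable lebesgue \<and>
       ennreal c * Lp_norm_complex p f \<le> Lp_norm p (square_fun T f) \<and>
       Lp_norm p (square_fun T f) \<le> ennreal C * Lp_norm_complex p f"
proof -
  obtain A where A: "0 < A"
    "\<And>N (f :: 'm bispace \<Rightarrow> complex). f \<in> borel_measurable borel \<Longrightarrow> Lp_mass p f < \<infinity> \<Longrightarrow>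
      comparable (ennreal A) (square_mass p N f) (Lp_mass p (truncation N f))"
    using truncation_square_equiv[OF p, where 'm = 'm] by blast
  note A = A(1) A(2)[unfolded comparable_def, THEN conjunct1] A(2)[unfolded comparable_def, THEN conjunct2]
  define C1 where "C1 = A * (4 * 4 powr p)"
  define C2 where "C2 = 2 powr p * A"
  have C: "0 < C1" "0 < C2" using A(1) by (auto simp: C1_def C2_def)
  define Sq where "Sq = (\<lambda>f :: 'm bispace \<Rightarrow> complex. SUP N. square_mass p N f)"
  have up: "Sq f \<le> ennreal C1 * Lp_mass p f"
    if f: "f \<in> borel_measurable borel" and fin: "Lp_mass p f < \<infinity>" for f :: "'m bispace \<Rightarrow> complex"
    unfolding Sq_def
  proof (rule SUP_least)
    fix N
    have "square_mass p N f \<le> ennreal A * Lp_mass p (truncation N f)"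
      by (rule A(2)[OF f fin])
    also have "\<dots> \<le> ennreal A * (ennreal (4 * 4 powr p) * Lp_mass p f)"
      using p by (intro mult_left_mono Lp_mass_truncation_le f fin) auto
    also have "\<dots> = ennreal C1 * Lp_mass p f"
      unfolding C1_def using A(1) by (subst ennreal_mult) (auto simp: mult.assoc)
    finally show "square_mass p N f \<le> ennreal C1 * Lp_mass p f" .
  qed
  have low: "Lp_mass p f \<le> ennreal C2 * Sq f"
    if f: "f \<in> borel_measurable borel" and fin: "Lp_mass p f < \<infinity>" for f :: "'m bispace \<Rightarrow> complex"
  proof -
    have "Lp_mass p (truncation N f) \<le> ennreal A * Sq f" for N
      unfolding Sq_def by (rule order_trans[OF A(3)[OF f fin]]) (intro mult_left_mono SUP_upper, auto)
    then have "Lp_mass p f \<le> ennreal (2 powr p) * (ennreal A * Sq f)"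
      by (rule Lp_mass_le_of_truncations[OF p f fin])
    then show ?thesis unfolding C2_def using A(1) by (subst ennreal_mult) (auto simp: mult.assoc)
  qed
  have reduce: "\<exists>g. g \<in> borel_measurable borel \<and> Lp_mass p (g \<circ> S) < \<infinity> \<and> g \<circ> S \<in> borel_measurable borel \<and>
      square_fun T f = square_fun T g \<and> Lp_norm_complex p f = ennpowr (Lp_mass p (g \<circ> S)) (1 / p)"
    if T: "measure_iso T S" and f: "f \<in> Lp p" for T S and f :: "'m bispace \<Rightarrow> complex"
  proof -
    have fm: "f \<in> borel_measurable lebesgue" and fn: "Lp_norm_complex p f < \<infinity>" using f by (auto simp: Lp_def)
    obtain g where g: "g \<in> borel_measurable borel" "AE x in lebesgue. f x = g x"
      using Lp_borel_representative[OF fm] .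
    have S [measurable]: "S \<in> borel_measurable borel" using T by (simp add: measure_iso_def)
    have gS: "g \<circ> S \<in> borel_measurable borel" using measurable_compose[OF S g(1)] by (simp add: comp_def)
    have mass: "Lp_mass p (g \<circ> S) = Lp_mass p f"
      using Lp_mass_measure_iso[OF T g(1)] Lp_mass_cong_AE[OF g(2)] by simp
    have "Lp_mass p f < \<infinity>" using fn unfolding Lp_norm_complex_eq by (cases "Lp_mass p f") auto
    then show ?thesis
      using g gS mass square_fun_cong_AE[OF T fm g] by (intro exI[of _ g]) (simp add: Lp_norm_complex_eq)
  qed
  show thesis
  proof (rule that; (intro conjI)?)
    show "0 < C2 powr (- 1 / p)" "0 < C1 powr (1 / p)" using C by auto
    fix T S :: "'m bispace \<Rightarrow> 'm bispace"
      and f :: "'m bispace \<Rightarrow> complex"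
    assume T: "measure_iso T S" and f: "f \<in> Lp p"
    obtain g where g: "g \<in> borel_measurable borel" "Lp_mass p (g \<circ> S) < \<infinity>" "g \<circ> S \<in> borel_measurable borel"
      and fg: "square_fun T f = square_fun T g" "Lp_norm_complex p f = ennpowr (Lp_mass p (g \<circ> S)) (1 / p)"
      using reduce[OF T f] by blast
    have norm: "Lp_norm p (square_fun T g) = ennpowr (Sq (g \<circ> S)) (1 / p)"
      unfolding Sq_def by (rule Lp_norm_square_fun[OF T g(1) p])
    show "square_fun T f \<in> borel_measurable lebesgue"
      unfolding fg by (rule square_fun_measurable[OF T g(1)])
    have "ennpowr (Sq (g \<circ> S)) (1 / p) \<le> ennpowr (ennreal C1 * Lp_mass p (g \<circ> S)) (1 / p)"
      using p by (intro ennpowr_mono up g) auto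
    then show "Lp_norm p (square_fun T f) \<le> ennreal (C1 powr (1 / p)) * Lp_norm_complex p f"
      unfolding fg norm ennpowr_cmult[OF C(1)] .
    have "ennpowr (Lp_mass p (g \<circ> S)) (1 / p) \<le> ennpowr (ennreal C2 * Sq (g \<circ> S)) (1 / p)"
      using p by (intro ennpowr_mono low g) auto
    then have "ennreal (C2 powr (- 1 / p)) * ennpowr (Lp_mass p (g \<circ> S)) (1 / p)
        \<le> ennreal (C2 powr (- 1 / p)) * (ennreal (C2 powr (1 / p)) * ennpowr (Sq (g \<circ> S)) (1 / p))"
      unfolding ennpowr_cmult[OF C(2)] by (rule mult_left_mono) simp
    also have "\<dots> = ennpowr (Sq (g \<circ> S)) (1 / p)"
      using C by (simp add: mult.assoc[symmetric] ennreal_mult[symmetric] powr_add[symmetric])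
    finally show "ennreal (C2 powr (- 1 / p)) * Lp_norm_complex p f \<le> Lp_norm p (square_fun T f)"
      unfolding fg norm .
  qed
qed

theorem theorem4p2:
  fixes p :: real
  assumes "1 < p"
  shows "bounded_on_Lp p (square_fun (T2 :: (real ^ 'm::finite) \<times> (real ^ 'm) \<Rightarrow> _)) \<and>
    bounded_on_Lp p (square_fun (T3 :: (real ^ 'm) \<times> (real ^ 'm) \<Rightarrow> _)) \<and>
    (\<exists>c C :: real. 0 < c \<and> c \<le> C \<and>
      (\<forall>T \<in> {id, T2, T3}. \<forall>f :: (real ^ 'm) \<times> (real ^ 'm) \<Rightarrow> complex. f \<in> Lp p \<longrightarrow>
        ennreal c * Lp_norm_complex p f \<le> Lp_norm p (square_fun T f) \<and>
        Lp_norm p (square_fun T f) \<le> ennreal C * Lp_norm_complex p f))"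
proof (rule square_fun_equiv[OF assms, where 'm = 'm])
  fix c C :: real
  assume cC: "0 < c" "0 < C" and
    est: "\<And>T S (f :: (real ^ 'm) \<times> (real ^ 'm) \<Rightarrow> complex). measure_iso T S \<Longrightarrow> f \<in> Lp p \<Longrightarrow>
       square_fun T f \<in> borel_measurable lebesgue \<and>
       ennreal c * Lp_norm_complex p f \<le> Lp_norm p (square_fun T f) \<and>
       Lp_norm p (square_fun T f) \<le> ennreal C * Lp_norm_complex p f"
  note meas = est[THEN conjunct1] and low = est[THEN conjunct2, THEN conjunct1] and up = est[THEN conjunct2, THEN conjunct2]
  have up': "Lp_norm p (square_fun T f) \<le> ennreal (max c C) * Lp_norm_complex p f"
    if "measure_iso T S" "f \<in> Lp p" for T S and f :: "(real ^ 'm) \<times> (real ^ 'm) \<Rightarrow> complex"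
    by (rule order_trans[OF up[OF that]]) (intro mult_right_mono ennreal_leI, auto)
  have iso: "\<exists>S. measure_iso T S" if "T \<in> {id, T2, T3}" for T :: "(real ^ 'm) \<times> (real ^ 'm) \<Rightarrow> _"
  proof -
    from that consider "T = id" | "T = T2" | "T = T3" by auto
    then show ?thesis
    proof cases
      case 1
      show ?thesis unfolding 1 by (rule exI) (rule measure_iso_id)
    next
      case 2
      show ?thesis unfolding 2 by (rule exI) (rule measure_iso_T2)
    next
      case 3
      show ?thesis unfolding 3 by (rule exI) (rule measure_iso_T3)
    qed
  qed
  have bdd: "bounded_on_Lp p (square_fun T)" if "measure_iso T S" for T S :: "(real ^ 'm) \<times> (real ^ 'm) \<Rightarrow> _"
    unfolding bounded_on_Lp_def by (intro exI[of _ C] ballI conjI meas[OF that] up[OF that])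
  have "\<exists>c C :: real. 0 < c \<and> c \<le> C \<and>
      (\<forall>T \<in> {id, T2, T3}. \<forall>f :: (real ^ 'm) \<times> (real ^ 'm) \<Rightarrow> complex. f \<in> Lp p \<longrightarrow>
        ennreal c * Lp_norm_complex p f \<le> Lp_norm p (square_fun T f) \<and>
        Lp_norm p (square_fun T f) \<le> ennreal C * Lp_norm_complex p f)"
  proof (rule exI[of _ c], rule exI[of _ "max c C"], intro conjI ballI allI impI)
    fix T :: "(real ^ 'm) \<times> (real ^ 'm) \<Rightarrow> _" and f :: "(real ^ 'm) \<times> (real ^ 'm) \<Rightarrow> complex"
    assume "T \<in> {id, T2, T3}" and f: "f \<in> Lp p"
    then obtain S where T: "measure_iso T S" using iso[of T] by auto
    show "ennreal c * Lp_norm_complex p f \<le> Lp_norm p (square_fun T f)"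
      by (rule low[OF T f])
    show "Lp_norm p (square_fun T f) \<le> ennreal (max c C) * Lp_norm_complex p f"
      by (rule up'[OF T f])
  qed (use cC in auto)
  with bdd[OF measure_iso_T2] bdd[OF measure_iso_T3] show ?thesis by (intro conjI)
qed

end
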